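(* Assume that (1) $2\le\iota<\omega$ and $\bar c=\langle c_m:m<\omega\rangle\subseteq\omega$; (2) $T_m\subseteq{}^{\omega>}2$ (for $m<\omega$) are trees with no maximal nodes, $\bar T=\langle T_m:m<\omega\rangle$, and $B=\bigcup_{m<\omega}\lim(T_m)$; (3) $S=(\omega,\bar r,\bar\jmath,\bar k)$ is a cute $\mathcal{YZR}(\varepsilon)$-system, $0<\varepsilon<\omega_1$; (4) $\bar T$ has the $(\bar c,S)$-controlled amalgamation property; and (5) $\lambda$ is an uncountable cardinal such that $\mathrm{NPr}^{\varepsilon}(\lambda)$ holds true. Then there is a ccc forcing notion $\mathbb P$ of size $\lambda$ such that \[\Vdash_{\mathbb P}\text{``there is a sequence }\langle\eta_\alpha:\alpha<\lambda\rangle\text{ of distinct elements of }{}^{\omega}2\text{ such that }\big|(\eta_\alpha+B)\cap(\eta_\beta+B)\big|\ge 2\iota\text{ for all }\alpha,\beta<\lambda\text{''},\] where in the extension $B$ denotes the set $\bigcup_{m<\omega}\lim(T_m)$ computed there.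
   Context: **Basic notation.** Every ordinal (in particular every natural number) is identified with the set of smaller ordinals; for a set $w$ of ordinals and an ordinal $b$, $w\cap b=\{a\in w:a<b\}$. $[X]^{<\omega}$ is the family of finite subsets of $X$. For a set $u$, $u^{\langle2\rangle}=\{(x,y)\in u\times u:x\ne y\}$. ${}^n2$ is the set of 0-1 sequences of length $n$, ${}^{\omega>}2=\bigcup_{n<\omega}{}^n2$, ${}^{\omega}2$ is the Cantor space; $+$ on ${}^n2$ and on ${}^{\omega}2$ is coordinatewise addition mod 2. $\nu\vartriangleleft\eta$ means that $\nu$ is a proper initial segment of $\eta$; $\nu\trianglelefteq\eta$ means $\nu\vartriangleleft\eta$ or $\nu=\eta$. A tree is a $\vartriangleleft$-downward closed set of sequences; $\lim(T)$ is the set of $\omega$-branches through $T\subseteq{}^{\omega>}2$. **$\mathcal{YZR}$-systems.** Let $0<\varepsilon<\omega_1$. A $\mathcal{YZR}(\varepsilon)$-system is a tuple $s=(X^s,\bar r^s,\bar\jmath^s,\bar k^s)=(X,\bar r,\bar\jmath,\bar k)$ such that: $( * )_1$ $X$ is a nonempty set of ordinals; $( * )_2$ $\bar r:[X]^{<\omega}\setminus\{\emptyset\}\to\varepsilon+1$, $\bar\jmath,\bar k:[X]^{<\omega}\setminus\{\emptyset\}\to\omega$; $( * )_3$ if $\emptyset\ne u\subseteq w\in[X]^{<\omega}$ then $\bar r(u)\ge\bar r(w)$; $( * )_4$ $\bar r(\{a\})>0$ for all $a\in X$; $( * )_5$ if $\emptyset\neq w\in[X]^{<\omega}$ and $w=\{a_0,\dots,a_{n-1}\}$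 is the increasing enumeration, then $\bar k(w)<n$ and there is no $b\in X\setminus w$ such that $|w\cap b|=\bar k(w)$ and $\bar\jmath((w\setminus\{a_{\bar k(w)}\})\cup\{b\})=\bar\jmath(w)$ and $\bar r(w\cup\{b\})=\bar r(w)$. It is finite if $X^s$ is finite. A quasi-embedding of $q$ in $s$ (both $\mathcal{YZR}(\varepsilon)$-systems) is an increasing injection $\varphi:X^q\to X^s$ such that for all nonempty finite $v\subseteq X^q$: $\bar r^s(\varphi[v])=\bar r^q(v)$, $\bar k^s(\varphi[v])=\bar k^q(v)$, and if $\bar r^q(v)>0$ then $\bar\jmath^s(\varphi[v])=\bar\jmath^q(v)$. If $w\subseteq X^s$, an increasing injection $\varphi:w\to X^s$ is a quasi-embedding (into $s$) if it is a quasi-embedding of the restricted system $s\restriction w$ in $s$. A $\mathcal{YZR}(\varepsilon)$-system $S$ is cute if $X^S=\omega$ and for every finite $\mathcal{YZR}(\varepsilon)$-system $q$ and $M<\omega$ there is a quasi-embedding $\varphi$ of $q$ in $S$ with $\mathrm{rng}(\varphi)\subseteq[M,\omega)$. **The family $\mathbf M_{\bar T,\iota}$.** Let $2\le\iota<\omega$ and let $\bar T=\langle T_n:n<\omega\rangle$ be a sequence of trees $T_n\subseteq{}^{\omega>}2$ with no maximal nodes. $\mathbf M_{\bar T,\iota}$ consists of all tuples $\mathbf m=(\ell_{\mathbf m},u_{\mathbf m},\bar h_{\mathbf m},\bar g_{\mathbf m})=(\ell,u,\bar h,\bar g)$ such that: (a) $0<\ell<\omega$, $u\subseteq{}^\ell2$,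 $|u|\ge2$; (b) $\bar h=\langle h_i:i<\iota\rangle$, $\bar g=\langle g_i:i<\iota\rangle$, $h_i:u^{\langle2\rangle}\to\omega$, $g_i:u^{\langle2\rangle}\to\bigcup_{n<\omega}(T_n\cap{}^\ell2)$; (c) $g_i(\eta,\nu)\in T_{h_i(\eta,\nu)}\cap{}^\ell2$ for all $(\eta,\nu)\in u^{\langle2\rangle}$, $i<\iota$; (d) $\eta+g_i(\eta,\nu)=\nu+g_i(\nu,\eta)$ for $(\eta,\nu)\in u^{\langle2\rangle}$, $i<\iota$; (e) for each $(\eta,\nu)\in u^{\langle2\rangle}$ there are no repetitions in $\langle g_i(\eta,\nu),g_i(\nu,\eta):i<\iota\rangle$; (f) there are $\langle F(\eta):\eta\in u\rangle$ and $\langle G_i(\eta,\nu):i<\iota,(\eta,\nu)\in u^{\langle2\rangle}\rangle$ such that $\eta\vartriangleleft F(\eta)\in{}^{\omega}2$, $g_i(\eta,\nu)\vartriangleleft G_i(\eta,\nu)\in\lim(T_{h_i(\eta,\nu)})$ and $F(\eta)+G_i(\eta,\nu)=F(\nu)+G_i(\nu,\eta)$ for all $i<\iota$, $(\eta,\nu)\in u^{\langle 2\rangle}$. We write $h_i^{\mathbf m},g_i^{\mathbf m}$ for the components. For $\rho\in{}^{\ell_{\mathbf m}}2$, $\mathbf m+\rho=(\ell',u',\bar h',\bar g')$ where $\ell'=\ell_{\mathbf m}$, $u'=\{\eta+\rho:\eta\in u_{\mathbf m}\}$, $h'_i(\eta+\rho,\nu+\rho)=h^{\mathbf m}_i(\eta,\nu)$,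 $g'_i(\eta+\rho,\nu+\rho)=g^{\mathbf m}_i(\eta,\nu)$. For $\mathbf m,\mathbf n\in\mathbf M_{\bar T,\iota}$, $\mathbf n$ essentially extends $\mathbf m$ ($\mathbf m\sqsubseteq^*\mathbf n$) iff $\ell_{\mathbf m}\le\ell_{\mathbf n}$, $u_{\mathbf m}=\{\eta\restriction\ell_{\mathbf m}:\eta\in u_{\mathbf n}\}$ and for every $(\eta,\nu)\in(u_{\mathbf n})^{\langle2\rangle}$ with $\eta'=\eta\restriction\ell_{\mathbf m}\ne\nu'=\nu\restriction\ell_{\mathbf m}$: if $\iota>2$ then $\{\{g_i^{\mathbf m}(\eta',\nu'),g_i^{\mathbf m}(\nu',\eta')\}:i<\iota\}=\{\{g_i^{\mathbf n}(\eta,\nu)\restriction\ell_{\mathbf m},g_i^{\mathbf n}(\nu,\eta)\restriction\ell_{\mathbf m}\}:i<\iota\}$; if $\iota=2$ then $\{g_0^{\mathbf m}(\eta',\nu'),g_0^{\mathbf m}(\nu',\eta'),g_1^{\mathbf m}(\eta',\nu'),g_1^{\mathbf m}(\nu',\eta')\}=\{g_0^{\mathbf n}(\eta,\nu)\restriction\ell_{\mathbf m},g_0^{\mathbf n}(\nu,\eta)\restriction\ell_{\mathbf m},g_1^{\mathbf n}(\eta,\nu)\restriction\ell_{\mathbf m},g_1^{\mathbf n}(\nu,\eta)\restriction\ell_{\mathbf m}\}$; and for $i,j<\iota$: if $g_i^{\mathbf m}(\eta',\nu')=g_j^{\mathbf n}(\eta,\nu)\restriction\ell_{\mathbf m}$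 then $h_i^{\mathbf m}(\eta',\nu')=h_j^{\mathbf n}(\eta,\nu)$, and if $g_i^{\mathbf m}(\eta',\nu')=g_j^{\mathbf n}(\nu,\eta)\restriction\ell_{\mathbf m}$ then $h_i^{\mathbf m}(\eta',\nu')=h_j^{\mathbf n}(\nu,\eta)$. $\mathbf m,\mathbf n$ are essentially the same ($\mathbf m\doteqdot\mathbf n$) iff $\ell_{\mathbf m}=\ell_{\mathbf n}$, $u_{\mathbf m}=u_{\mathbf n}$ and these same conditions hold for all $(\eta,\nu)\in(u_{\mathbf m})^{\langle2\rangle}$ (with $\eta'=\eta$, $\nu'=\nu$). **Bricks.** Let $S=(\omega,\bar r,\bar\jmath,\bar k)$ be a cute $\mathcal{YZR}(\varepsilon)$-system and $\bar c=\langle c_m:m<\omega\rangle\subseteq\omega$. (Standing assumption when bricks are considered: there are pairwise different $\rho_0,\rho_1,\rho_2\in{}^{\omega}2$ with $|(\rho_j+B)\cap(\rho_{j'}+B)|\ge2\iota$ for $j,j'<3$, where $B=\bigcup_m\lim(T_m)$.) An $(S,\iota,\bar T,\bar c)$-brick is a tuple $\mathfrak b=(w^{\mathfrak b},n^{\mathfrak b},\bar\eta^{\mathfrak b},\bar h^{\mathfrak b},\bar g^{\mathfrak b},\mathcal M^{\mathfrak b})=(w,n,\bar\eta,\bar h,\bar g,\mathcal M)$ such that: $(\boxplus)_1$ $w\in[\omega]^{<\omega}$, $|w|\ge3$, $0<n<\omega$. $(\boxplus)_2$ $\bar\eta=\langle\eta_a:a\in w\rangle$ is a sequence of linearly independent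 vectors in ${}^n2$ over $\mathbb Z_2$. $(\boxplus)_3$ $\bar h=\langle h_i:i<\iota\rangle$, $h_i:w^{\langle2\rangle}\to\omega$, $c_{h_i(a,b)}\le n$ for all $(a,b)\in w^{\langle2\rangle}$, $i<\iota$; $\bar g=\langle g_i:i<\iota\rangle$, $g_i:w^{\langle2\rangle}\to\bigcup_{m<\omega}(T_m\cap{}^n2)$. $(\boxplus)_4$ Letting $n^*=n$, $u^*=\{\eta_a:a\in w\}$, $h_i^*(\eta_a,\eta_b)=h_i(a,b)$, $g_i^*(\eta_a,\eta_b)=g_i(a,b)$, we have $(n^*,u^*,\bar h^*,\bar g^* )\in\mathbf M_{\bar T,\iota}$. $(\boxplus)_5$ $\mathcal M$ consists of all $\mathbf m\in\mathbf M_{\bar T,\iota}$ such that for some $\ell_*,w_*$: $w_*\subseteq w$, $|w_*|\ge3$, $0<\ell_{\mathbf m}=\ell_*\le n$, and $c_{h_i(a,b)}\le\ell_*$ for all $(a,b)\in(w_* )^{\langle2\rangle}$, $i<\iota$; $u_{\mathbf m}=\{\eta_a\restriction\ell_*:a\in w_*\}$ and $\eta_a\restriction\ell_*\ne\eta_b\restriction\ell_*$ for distinct $a,b\in w_*$; $h_i^{\mathbf m}(\eta_a\restriction\ell_*,\eta_b\restriction\ell_* )=h_i(a,b)$ and $g_i^{\mathbf m}(\eta_a\restriction\ell_*,\eta_b\restriction\ell_* )=g_i(a,b)\restriction\ell_*$ for $(a,b)\in (w_* )^{\langle 2\rangle}$, $i<\iota$. In this situation we write $\mathbf m=\mathbf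 m(\ell_*,w_* )$. $(\boxplus)_6$ If $\mathbf m(\ell,w_0),\mathbf m(\ell,w_1)\in\mathcal M$, $\rho\in{}^\ell2$ and $\mathbf m(\ell,w_0)\doteqdot\mathbf m(\ell,w_1)+\rho$, then the order isomorphism $\pi:w_0\to w_1$ is a quasi-embedding (into $S$) and $(\eta_a\restriction\ell)+\rho=\eta_{\pi(a)}\restriction\ell$ for all $a\in w_0$. $(\boxplus)_7$ If $\mathbf m(\ell_*,w_* )\in\mathcal M$, $a\in w_*$, $|a\cap w_*|=\bar k(w_* )$, $\bar r(w_* )=0$ and $\mathbf m(\ell_*,w_* )\sqsubseteq^*\mathbf n\in\mathcal M$, then $|\{\nu\in u_{\mathbf n}:(\eta_a\restriction\ell_* )\trianglelefteq\nu\}|=1$. For bricks, $\mathfrak b_0\Subset\mathfrak b_1$ iff $w^{\mathfrak b_0}\subseteq w^{\mathfrak b_1}$, $n^{\mathfrak b_0}\le n^{\mathfrak b_1}$, $\eta_a^{\mathfrak b_0}\trianglelefteq\eta_a^{\mathfrak b_1}$ for $a\in w^{\mathfrak b_0}$, and $h_i^{\mathfrak b_1}\restriction(w^{\mathfrak b_0})^{\langle2\rangle}=h_i^{\mathfrak b_0}$, $g_i^{\mathfrak b_0}(a,b)\trianglelefteq g_i^{\mathfrak b_1}(a,b)$ for $i<\iota$, $(a,b)\in(w^{\mathfrak b_0})^{\langle2\rangle}$. For $w^*\subseteq w^{\mathfrak b}$ with $|w^*|\ge3$, $\mathfrak b\restriction w^*$ is the unique brick $\mathfrak b^*$ with $w^{\mathfrak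 b^*}=w^*$, $n^{\mathfrak b^*}=n^{\mathfrak b}$, $\mathfrak b^*\Subset\mathfrak b$. For a quasi-embedding $\varphi:w^{\mathfrak b}\to\omega$ (into $S$), $\varphi(\mathfrak b)$ is the unique brick $\mathfrak b^*$ with $w^{\mathfrak b^*}=\varphi[w^{\mathfrak b}]$, $n^{\mathfrak b^*}=n^{\mathfrak b}$, $\mathcal M^{\mathfrak b^*}=\mathcal M^{\mathfrak b}$, $\eta^{\mathfrak b}_a=\eta^{\mathfrak b^*}_{\varphi(a)}$, $h_i^{\mathfrak b}(a,b)=h_i^{\mathfrak b^*}(\varphi(a),\varphi(b))$, $g_i^{\mathfrak b}(a,b)=g_i^{\mathfrak b^*}(\varphi(a),\varphi(b))$. **Controlled amalgamation.** $\bar T$ has the $(\bar c,S)$-controlled amalgamation property if there is a sequence $\langle\mathfrak b_n:n<\omega\rangle$ of $(S,\iota,\bar T,\bar c)$-bricks such that: (1) $\mathfrak b_n\Subset\mathfrak b_{n+1}$ for each $n$; (2) $\bigcup_nw^{\mathfrak b_n}=\omega$ and $\lim_{n\to\infty}n^{\mathfrak b_n}=\infty$; (3) if (a) $n<\omega$, $u\subseteq w\subseteq w^{\mathfrak b_n}$, $|w|\ge3$, (b) $\bar k(v\cup\{\delta\})\ne|\delta\cap v|$ whenever $v\subseteq u$, $\delta\in w\setminus u$ and $\bar r(v\cup\{\delta\})=0$, and (c) $\pi_0,\pi_1:w\to\omega$ are quasi-embeddings (into $S$) with $\pi_0(a)=\pi_1(a)$ for $a\in u$ and $\pi_0[w\setminus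 u]\cap\pi_1[w\setminus u]=\emptyset$, then there are $K<\omega$ and a quasi-embedding $\pi:\mathrm{rng}(\pi_0)\cup\mathrm{rng}(\pi_1)\to w^{\mathfrak b_K}$ (into $S$) such that $(\pi\circ\pi_0)(\mathfrak b_n\restriction w)\Subset\mathfrak b_K\restriction(\pi\circ\pi_0[w])$ and $(\pi\circ\pi_1)(\mathfrak b_n\restriction w)\Subset\mathfrak b_K\restriction(\pi\circ\pi_1[w])$; (4) if $n<\omega$, $w\subseteq w^{\mathfrak b_n}$, $|w|\ge3$, $\pi_0:w\to\omega$ is a quasi-embedding (into $S$) and $\mathrm{rng}(\pi_0)\subseteq u\in[\omega]^{<\omega}$, then there are $K<\omega$ and a quasi-embedding $\pi:u\to w^{\mathfrak b_K}$ (into $S$) such that $(\pi\circ\pi_0)(\mathfrak b_n\restriction w)\Subset\mathfrak b_K\restriction(\pi\circ\pi_0[w])$. **The statement $\mathrm{NPr}^\varepsilon(\lambda)$.** Let $\mathbb M$ be a model with universe $\lambda$ and a countable vocabulary $\tau$. For finite nonempty $w=\{\alpha_0,\dots,\alpha_n\}\subseteq\lambda$, $|w|=n+1$, define by induction on ordinals $\delta$ when $\mathrm{rk}(w,\mathbb M)\ge\delta$: (a) $\mathrm{rk}(w,\mathbb M)\ge0$ iff for every quantifier free formula $\varphi\in\mathcal L(\tau)$ and each $k\le n$, if $\mathbb M\models\varphi[\alpha_0,\dots,\alpha_k,\dots,\alpha_n]$ then $\{\alpha\in\lambda:\mathbb M\models\varphi[\alpha_0,\dots,\alpha_{k-1},\alpha,\alpha_{k+1},\dots,\alpha_n]\}$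 is uncountable; (b) for limit $\delta$, $\mathrm{rk}(w,\mathbb M)\ge\delta$ iff $\mathrm{rk}(w,\mathbb M)\ge\gamma$ for all $\gamma<\delta$; (c) $\mathrm{rk}(w,\mathbb M)\ge\delta+1$ iff for every quantifier free $\varphi\in\mathcal L(\tau)$ and each $k\le n$, if $\mathbb M\models\varphi[\alpha_0,\dots,\alpha_k,\dots,\alpha_n]$ then there is $\alpha^*\in\lambda\setminus w$ with $\mathrm{rk}(w\cup\{\alpha^*\},\mathbb M)\ge\delta$ and $\mathbb M\models\varphi[\alpha_0,\dots,\alpha_{k-1},\alpha^*,\alpha_{k+1},\dots,\alpha_n]$. Then $\mathrm{rk}(w,\mathbb M)=-1$ if not $\ge0$, $=\infty$ if $\ge\delta$ for all ordinals $\delta$, and otherwise it is the unique $\delta$ with $\mathrm{rk}(w,\mathbb M)\ge\delta$ but not $\ge\delta+1$. $\mathrm{NPr}^\varepsilon(\lambda)$ says: there is a model $\mathbb M^*$ with universe $\lambda$ and a countable vocabulary such that $1+\mathrm{rk}(w,\mathbb M^* )\le\varepsilon$ for all $w\in[\lambda]^{<\omega}\setminus\{\emptyset\}$. *)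

theory Defs
  imports Complex_Main "HOL-Library.Z2" "HOL-Library.Sublist" "HOL-Library.Countable_Set"
    "HOL-Library.Function_Algebras"
begin

unbundle cardinal_syntax

section \<open>Ordinals\<close>

text \<open>
  Ordinals are the elements of an arbitrary well-ordered type without a largest element.  Such a
  type is (isomorphic to) a limit ordinal, and it is a type variable of the final statement, so
  every ordinal lies in some instance of it.
\<close>

definition ozero :: "'o::wellorder"
  where "ozero = (LEAST x. True)"

definition osucc :: "'o::{wellorder,no_top} \<Rightarrow> 'o"
  where "osucc x = (LEAST y. x < y)"

definition limit_ord :: "'o::{wellorder,no_top} \<Rightarrow> bool"
  where "limit_ord x \<longleftrightarrow> x \<noteq> ozero \<and> (\<nexists>y. x = osucc y)"

lemma less_osucc: "x < osucc x"
  unfolding osucc_def using gt_ex[of x] by (rule LeastI_ex)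

text \<open>Ordinal addition \<open>1 + x\<close>, by the identity \<open>1 + x = {0} \<union> {1 + y | y < x}\<close>.\<close>

function one_plus :: "'o::{wellorder,no_top} \<Rightarrow> 'o" where
  "one_plus x = (LEAST z. ozero < z \<and> (\<forall>y. y < x \<longrightarrow> one_plus y < z))"
  by auto
termination by (relation "{(y, x). y < x}") (auto simp: wf)

declare one_plus.simps [simp del]

section \<open>YZR-systems\<close>

text \<open>
  The three functions are only relevant on the nonempty finite subsets of the carrier.
\<close>

record ('x, 'o) yzr =
  yX :: "'x set"
  yr :: "'x set \<Rightarrow> 'o"
  yj :: "'x set \<Rightarrow> nat"
  yk :: "'x set \<Rightarrow> nat"

definition below :: "'x::linorder set \<Rightarrow> 'x \<Rightarrow> 'x set"
  where "below w b = {a \<in> w. a < b}"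

definition fin_ne :: "'x set \<Rightarrow> 'x set set"
  where "fin_ne X = {w. w \<subseteq> X \<and> finite w \<and> w \<noteq> {}}"

definition yzr_system :: "'o::{wellorder,no_top} \<Rightarrow> ('x::wellorder, 'o) yzr \<Rightarrow> bool" where
  "yzr_system \<epsilon> s \<longleftrightarrow>
     yX s \<noteq> {} \<and>
     (\<forall>w \<in> fin_ne (yX s). yr s w \<le> \<epsilon>) \<and>
     (\<forall>u w. u \<noteq> {} \<and> u \<subseteq> w \<and> w \<in> fin_ne (yX s) \<longrightarrow> yr s w \<le> yr s u) \<and>
     (\<forall>a \<in> yX s. ozero < yr s {a}) \<and>
     (\<forall>w \<in> fin_ne (yX s).
        yk s w < card w \<and>
        \<not> (\<exists>b \<in> yX s - w.
              card (below w b) = yk s w \<and>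
              yj s ((w - {sorted_list_of_set w ! yk s w}) \<union> {b}) = yj s w \<and>
              yr s (w \<union> {b}) = yr s w))"

definition yzr_finite :: "('x, 'o) yzr \<Rightarrow> bool"
  where "yzr_finite s \<longleftrightarrow> finite (yX s)"

definition quasi_embedding ::
    "('x::wellorder, 'o::{wellorder,no_top}) yzr \<Rightarrow> ('y::wellorder, 'o) yzr \<Rightarrow> ('x \<Rightarrow> 'y) \<Rightarrow> bool" where
  "quasi_embedding q s \<phi> \<longleftrightarrow>
     strict_mono_on (yX q) \<phi> \<and> \<phi> ` yX q \<subseteq> yX s \<and>
     (\<forall>v \<in> fin_ne (yX q).
        yr s (\<phi> ` v) = yr q v \<and>
        yk s (\<phi> ` v) = yk q v \<and>
        (ozero < yr q v \<longrightarrow> yj s (\<phi> ` v) = yj q v))"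

definition yzr_restrict :: "('x, 'o) yzr \<Rightarrow> 'x set \<Rightarrow> ('x, 'o) yzr"
  where "yzr_restrict s w = s\<lparr>yX := w\<rparr>"

definition quasi_emb_into ::
    "('x::wellorder, 'o::{wellorder,no_top}) yzr \<Rightarrow> 'x set \<Rightarrow> ('x \<Rightarrow> 'x) \<Rightarrow> bool" where
  "quasi_emb_into s w \<phi> \<longleftrightarrow> w \<subseteq> yX s \<and> quasi_embedding (yzr_restrict s w) s \<phi>"

definition cute :: "'o::{wellorder,no_top} \<Rightarrow> (nat, 'o) yzr \<Rightarrow> bool" where
  "cute \<epsilon> S \<longleftrightarrow>
     yzr_system \<epsilon> S \<and> yX S = UNIV \<and>
     (\<forall>q :: ('o, 'o) yzr. \<forall>M::nat. yzr_system \<epsilon> q \<and> yzr_finite q \<longrightarrow>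
        (\<exists>\<phi>. quasi_embedding q S \<phi> \<and> \<phi> ` yX q \<subseteq> {M..}))"

section \<open>Binary sequences and trees\<close>

text \<open>
  Finite 0-1 sequences are lists over the two-element field; elements of the Cantor space are
  functions on the naturals, added pointwise.
\<close>

definition ladd :: "bit list \<Rightarrow> bit list \<Rightarrow> bit list"
  where "ladd x y = map2 (+) x y"

definition initseg :: "(nat \<Rightarrow> bit) \<Rightarrow> nat \<Rightarrow> bit list"
  where "initseg x n = map x [0..<n]"

definition is_tree :: "bit list set \<Rightarrow> bool"
  where "is_tree T \<longleftrightarrow> (\<forall>t \<in> T. \<forall>s. strict_prefix s t \<longrightarrow> s \<in> T)"

definition no_maximal_nodes :: "bit list set \<Rightarrow> bool"
  where "no_maximal_nodes T \<longleftrightarrow> (\<forall>t \<in> T. \<exists>s \<in> T. strict_prefix t s)"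

definition lim_tree :: "bit list set \<Rightarrow> (nat \<Rightarrow> bit) set"
  where "lim_tree T = {x. \<forall>n. initseg x n \<in> T}"

definition offdiag :: "'a set \<Rightarrow> ('a \<times> 'a) set"
  where "offdiag u = {(x, y). x \<in> u \<and> y \<in> u \<and> x \<noteq> y}"

section \<open>The family M\<close>

text \<open>
  \<open>mh m i\<close> and \<open>mg m i\<close> are only relevant for \<open>i < \<iota>\<close> and on pairs from \<open>offdiag (mu m)\<close>;
  no definition below looks at their other values.
\<close>

record mtuple =
  ml :: nat
  mu :: "bit list set"
  mh :: "nat \<Rightarrow> bit list \<Rightarrow> bit list \<Rightarrow> nat"
  mg :: "nat \<Rightarrow> bit list \<Rightarrow> bit list \<Rightarrow> bit list"

definition MT :: "nat \<Rightarrow> (nat \<Rightarrow> bit list set) \<Rightarrow> mtuple set" where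
  "MT \<iota> T = {m.
     0 < ml m \<and> (\<forall>\<eta> \<in> mu m. length \<eta> = ml m) \<and> 2 \<le> card (mu m) \<and>
     (\<forall>(\<eta>, \<nu>) \<in> offdiag (mu m). \<forall>i<\<iota>.
        mg m i \<eta> \<nu> \<in> T (mh m i \<eta> \<nu>) \<and> length (mg m i \<eta> \<nu>) = ml m) \<and>
     (\<forall>(\<eta>, \<nu>) \<in> offdiag (mu m). \<forall>i<\<iota>. ladd \<eta> (mg m i \<eta> \<nu>) = ladd \<nu> (mg m i \<nu> \<eta>)) \<and>
     (\<forall>(\<eta>, \<nu>) \<in> offdiag (mu m).
        distinct (map (\<lambda>i. mg m i \<eta> \<nu>) [0..<\<iota>] @ map (\<lambda>i. mg m i \<nu> \<eta>) [0..<\<iota>])) \<and>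
     (\<exists>(F :: bit list \<Rightarrow> nat \<Rightarrow> bit) (G :: nat \<Rightarrow> bit list \<Rightarrow> bit list \<Rightarrow> nat \<Rightarrow> bit).
        (\<forall>\<eta> \<in> mu m. initseg (F \<eta>) (ml m) = \<eta>) \<and>
        (\<forall>(\<eta>, \<nu>) \<in> offdiag (mu m). \<forall>i<\<iota>.
           initseg (G i \<eta> \<nu>) (ml m) = mg m i \<eta> \<nu> \<and>
           G i \<eta> \<nu> \<in> lim_tree (T (mh m i \<eta> \<nu>)) \<and>
           F \<eta> + G i \<eta> \<nu> = F \<nu> + G i \<nu> \<eta>))}"

text \<open>
  Since \<open>\<eta>' = \<eta> + \<rho>\<close> iff \<open>\<eta> = \<eta>' + \<rho>\<close>, the translated functions are obtained by translating
  the arguments.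
\<close>

definition mshift :: "mtuple \<Rightarrow> bit list \<Rightarrow> mtuple" where
  "mshift m \<rho> = \<lparr>ml = ml m, mu = (\<lambda>\<eta>. ladd \<eta> \<rho>) ` mu m,
     mh = (\<lambda>i \<eta> \<nu>. mh m i (ladd \<eta> \<rho>) (ladd \<nu> \<rho>)),
     mg = (\<lambda>i \<eta> \<nu>. mg m i (ladd \<eta> \<rho>) (ladd \<nu> \<rho>))\<rparr>"

definition ess_match ::
    "nat \<Rightarrow> mtuple \<Rightarrow> mtuple \<Rightarrow> bit list \<Rightarrow> bit list \<Rightarrow> bit list \<Rightarrow> bit list \<Rightarrow> bool" where
  "ess_match \<iota> m n \<eta>' \<nu>' \<eta> \<nu> \<longleftrightarrow>
     (2 < \<iota> \<longrightarrow>
        {{mg m i \<eta>' \<nu>', mg m i \<nu>' \<eta>'} | i. i < \<iota>} =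
        {{take (ml m) (mg n i \<eta> \<nu>), take (ml m) (mg n i \<nu> \<eta>)} | i. i < \<iota>}) \<and>
     (\<iota> = 2 \<longrightarrow>
        {mg m 0 \<eta>' \<nu>', mg m 0 \<nu>' \<eta>', mg m 1 \<eta>' \<nu>', mg m 1 \<nu>' \<eta>'} =
        {take (ml m) (mg n 0 \<eta> \<nu>), take (ml m) (mg n 0 \<nu> \<eta>),
         take (ml m) (mg n 1 \<eta> \<nu>), take (ml m) (mg n 1 \<nu> \<eta>)}) \<and>
     (\<forall>i<\<iota>. \<forall>j<\<iota>.
        (mg m i \<eta>' \<nu>' = take (ml m) (mg n j \<eta> \<nu>) \<longrightarrow> mh m i \<eta>' \<nu>' = mh n j \<eta> \<nu>) \<and>
        (mg m i \<eta>' \<nu>' = take (ml m) (mg n j \<nu> \<eta>) \<longrightarrow> mh m i \<eta>' \<nu>' = mh n j \<nu> \<eta>))"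

definition ess_extends :: "nat \<Rightarrow> mtuple \<Rightarrow> mtuple \<Rightarrow> bool" where
  "ess_extends \<iota> m n \<longleftrightarrow>
     ml m \<le> ml n \<and> mu m = take (ml m) ` mu n \<and>
     (\<forall>(\<eta>, \<nu>) \<in> offdiag (mu n). take (ml m) \<eta> \<noteq> take (ml m) \<nu> \<longrightarrow>
        ess_match \<iota> m n (take (ml m) \<eta>) (take (ml m) \<nu>) \<eta> \<nu>)"

definition ess_same :: "nat \<Rightarrow> mtuple \<Rightarrow> mtuple \<Rightarrow> bool" where
  "ess_same \<iota> m n \<longleftrightarrow>
     ml m = ml n \<and> mu m = mu n \<and>
     (\<forall>(\<eta>, \<nu>) \<in> offdiag (mu m). ess_match \<iota> m n \<eta> \<nu> \<eta> \<nu>)"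

section \<open>Bricks\<close>

text \<open>
  As above, values of \<open>b\<eta>\<close>, \<open>bh\<close>, \<open>bg\<close> are only relevant on \<open>bw\<close> and \<open>offdiag bw\<close>, for \<open>i < \<iota>\<close>.
\<close>

record brick =
  bw :: "nat set"
  bn :: nat
  b\<eta> :: "nat \<Rightarrow> bit list"
  bh :: "nat \<Rightarrow> nat \<Rightarrow> nat \<Rightarrow> nat"
  bg :: "nat \<Rightarrow> nat \<Rightarrow> nat \<Rightarrow> bit list"
  bM :: "mtuple set"

definition lin_indep :: "nat \<Rightarrow> nat set \<Rightarrow> (nat \<Rightarrow> bit list) \<Rightarrow> bool" where
  "lin_indep n w \<eta> \<longleftrightarrow>
     (\<forall>x :: nat \<Rightarrow> bit. (\<forall>i<n. (\<Sum>a\<in>w. x a * \<eta> a ! i) = 0) \<longrightarrow> (\<forall>a\<in>w. x a = 0))"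

text \<open>\<open>is_m_of \<iota> c b l v m\<close> says that \<open>m = m(l, v)\<close> with respect to \<open>b\<close>.\<close>

definition is_m_of :: "nat \<Rightarrow> (nat \<Rightarrow> nat) \<Rightarrow> brick \<Rightarrow> nat \<Rightarrow> nat set \<Rightarrow> mtuple \<Rightarrow> bool" where
  "is_m_of \<iota> c b l v m \<longleftrightarrow>
     v \<subseteq> bw b \<and> 3 \<le> card v \<and> ml m = l \<and> 0 < l \<and> l \<le> bn b \<and>
     (\<forall>(a, a') \<in> offdiag v. \<forall>i<\<iota>. c (bh b i a a') \<le> l) \<and>
     mu m = (\<lambda>a. take l (b\<eta> b a)) ` v \<and>
     (\<forall>(a, a') \<in> offdiag v. take l (b\<eta> b a) \<noteq> take l (b\<eta> b a')) \<and>
     (\<forall>(a, a') \<in> offdiag v. \<forall>i<\<iota>.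
        mh m i (take l (b\<eta> b a)) (take l (b\<eta> b a')) = bh b i a a' \<and>
        mg m i (take l (b\<eta> b a)) (take l (b\<eta> b a')) = take l (bg b i a a'))"

definition brick_family ::
    "nat \<Rightarrow> (nat \<Rightarrow> bit list set) \<Rightarrow> (nat \<Rightarrow> nat) \<Rightarrow> brick \<Rightarrow> mtuple set" where
  "brick_family \<iota> T c b = {m \<in> MT \<iota> T. \<exists>l v. is_m_of \<iota> c b l v m}"

definition is_brick ::
    "(nat, 'o::{wellorder,no_top}) yzr \<Rightarrow> nat \<Rightarrow> (nat \<Rightarrow> bit list set) \<Rightarrow> (nat \<Rightarrow> nat) \<Rightarrow> brick \<Rightarrow> bool" where
  "is_brick S \<iota> T c b \<longleftrightarrow>
     finite (bw b) \<and> 3 \<le> card (bw b) \<and> 0 < bn b \<and>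
     (\<forall>a \<in> bw b. length (b\<eta> b a) = bn b) \<and> lin_indep (bn b) (bw b) (b\<eta> b) \<and>
     (\<forall>(a, a') \<in> offdiag (bw b). \<forall>i<\<iota>.
        c (bh b i a a') \<le> bn b \<and>
        (\<exists>m. bg b i a a' \<in> T m) \<and> length (bg b i a a') = bn b) \<and>
     (\<exists>m \<in> MT \<iota> T. ml m = bn b \<and> mu m = b\<eta> b ` bw b \<and>
        (\<forall>(a, a') \<in> offdiag (bw b). \<forall>i<\<iota>.
           mh m i (b\<eta> b a) (b\<eta> b a') = bh b i a a' \<and>
           mg m i (b\<eta> b a) (b\<eta> b a') = bg b i a a')) \<and>
     bM b = brick_family \<iota> T c b \<and>
     (\<forall>m0 \<in> bM b. \<forall>m1 \<in> bM b. \<forall>l w0 w1 \<rho>.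
        is_m_of \<iota> c b l w0 m0 \<and> is_m_of \<iota> c b l w1 m1 \<and> length \<rho> = l \<and>
        ess_same \<iota> m0 (mshift m1 \<rho>) \<longrightarrow>
        (\<exists>\<pi>. strict_mono_on w0 \<pi> \<and> \<pi> ` w0 = w1 \<and> quasi_emb_into S w0 \<pi> \<and>
           (\<forall>a \<in> w0. ladd (take l (b\<eta> b a)) \<rho> = take l (b\<eta> b (\<pi> a))))) \<and>
     (\<forall>m \<in> bM b. \<forall>n \<in> bM b. \<forall>l v a.
        is_m_of \<iota> c b l v m \<and> a \<in> v \<and> card (below v a) = yk S v \<and> yr S v = ozero \<and>
        ess_extends \<iota> m n \<longrightarrow>
        card {\<nu> \<in> mu n. prefix (take l (b\<eta> b a)) \<nu>} = 1)"

definition brick_le :: "nat \<Rightarrow> brick \<Rightarrow> brick \<Rightarrow> bool" where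
  "brick_le \<iota> b0 b1 \<longleftrightarrow>
     bw b0 \<subseteq> bw b1 \<and> bn b0 \<le> bn b1 \<and>
     (\<forall>a \<in> bw b0. prefix (b\<eta> b0 a) (b\<eta> b1 a)) \<and>
     (\<forall>(a, a') \<in> offdiag (bw b0). \<forall>i<\<iota>.
        bh b1 i a a' = bh b0 i a a' \<and> prefix (bg b0 i a a') (bg b1 i a a'))"

definition brick_restrict ::
    "nat \<Rightarrow> (nat \<Rightarrow> bit list set) \<Rightarrow> (nat \<Rightarrow> nat) \<Rightarrow> brick \<Rightarrow> nat set \<Rightarrow> brick" where
  "brick_restrict \<iota> T c b v = b\<lparr>bw := v, bM := brick_family \<iota> T c (b\<lparr>bw := v\<rparr>)\<rparr>"

definition brick_image :: "(nat \<Rightarrow> nat) \<Rightarrow> brick \<Rightarrow> brick" where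
  "brick_image \<phi> b = (let \<psi> = inv_into (bw b) \<phi> in
     b\<lparr>bw := \<phi> ` bw b, b\<eta> := (\<lambda>a. b\<eta> b (\<psi> a)),
       bh := (\<lambda>i a a'. bh b i (\<psi> a) (\<psi> a')),
       bg := (\<lambda>i a a'. bg b i (\<psi> a) (\<psi> a'))\<rparr>)"

definition controlled_amalgamation ::
    "(nat \<Rightarrow> nat) \<Rightarrow> (nat, 'o::{wellorder,no_top}) yzr \<Rightarrow> nat \<Rightarrow> (nat \<Rightarrow> bit list set) \<Rightarrow> bool" where
  "controlled_amalgamation c S \<iota> T \<longleftrightarrow> (\<exists>b :: nat \<Rightarrow> brick.
     (\<forall>n. is_brick S \<iota> T c (b n)) \<and>
     (\<forall>n. brick_le \<iota> (b n) (b (Suc n))) \<and>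
     (\<Union>n. bw (b n)) = UNIV \<and> filterlim (\<lambda>n. bn (b n)) at_top sequentially \<and>
     (\<forall>n u w \<pi>0 \<pi>1.
        u \<subseteq> w \<and> w \<subseteq> bw (b n) \<and> 3 \<le> card w \<and>
        (\<forall>v \<delta>. v \<subseteq> u \<and> \<delta> \<in> w - u \<and> yr S (v \<union> {\<delta>}) = ozero \<longrightarrow>
           yk S (v \<union> {\<delta>}) \<noteq> card (below v \<delta>)) \<and>
        quasi_emb_into S w \<pi>0 \<and> quasi_emb_into S w \<pi>1 \<and>
        (\<forall>a \<in> u. \<pi>0 a = \<pi>1 a) \<and> \<pi>0 ` (w - u) \<inter> \<pi>1 ` (w - u) = {} \<longrightarrow>
        (\<exists>K \<pi>. quasi_emb_into S (\<pi>0 ` w \<union> \<pi>1 ` w) \<pi> \<and>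
           \<pi> ` (\<pi>0 ` w \<union> \<pi>1 ` w) \<subseteq> bw (b K) \<and>
           brick_le \<iota> (brick_image (\<pi> \<circ> \<pi>0) (brick_restrict \<iota> T c (b n) w))
             (brick_restrict \<iota> T c (b K) ((\<pi> \<circ> \<pi>0) ` w)) \<and>
           brick_le \<iota> (brick_image (\<pi> \<circ> \<pi>1) (brick_restrict \<iota> T c (b n) w))
             (brick_restrict \<iota> T c (b K) ((\<pi> \<circ> \<pi>1) ` w)))) \<and>
     (\<forall>n u w \<pi>0.
        w \<subseteq> bw (b n) \<and> 3 \<le> card w \<and> quasi_emb_into S w \<pi>0 \<and> \<pi>0 ` w \<subseteq> u \<and> finite u \<longrightarrow>
        (\<exists>K \<pi>. quasi_emb_into S u \<pi> \<and> \<pi> ` u \<subseteq> bw (b K) \<and>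
           brick_le \<iota> (brick_image (\<pi> \<circ> \<pi>0) (brick_restrict \<iota> T c (b n) w))
             (brick_restrict \<iota> T c (b K) ((\<pi> \<circ> \<pi>0) ` w)))))"

section \<open>Models, quantifier free formulas, and the rank\<close>

datatype tm = Var nat | App nat "tm list"

datatype qf = EqF tm tm | RelF nat "tm list" | NegF qf | AndF qf qf

text \<open>
  Symbols are natural numbers, so vocabularies are countable; \<open>fun_ar\<close> and \<open>rel_ar\<close> give the arities
  of those numbers that are function, respectively relation, symbols of the vocabulary.
\<close>

record 'a model =
  fun_ar :: "nat \<Rightarrow> nat option"
  rel_ar :: "nat \<Rightarrow> nat option"
  fun_int :: "nat \<Rightarrow> 'a list \<Rightarrow> 'a"
  rel_int :: "nat \<Rightarrow> 'a list \<Rightarrow> bool"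

definition is_model :: "'a set \<Rightarrow> 'a model \<Rightarrow> bool" where
  "is_model U M \<longleftrightarrow> U \<noteq> {} \<and>
     (\<forall>f k xs. fun_ar M f = Some k \<and> length xs = k \<and> set xs \<subseteq> U \<longrightarrow> fun_int M f xs \<in> U)"

fun tm_in :: "'a model \<Rightarrow> nat \<Rightarrow> tm \<Rightarrow> bool" where
  "tm_in M n (Var i) \<longleftrightarrow> i < n"
| "tm_in M n (App f ts) \<longleftrightarrow> fun_ar M f = Some (length ts) \<and> (\<forall>t \<in> set ts. tm_in M n t)"

text \<open>\<open>qf_in M n \<phi>\<close>: \<open>\<phi>\<close> is a formula in the vocabulary of \<open>M\<close> with variables among the first \<open>n\<close>.\<close>

primrec qf_in :: "'a model \<Rightarrow> nat \<Rightarrow> qf \<Rightarrow> bool" where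
  "qf_in M n (EqF s t) \<longleftrightarrow> tm_in M n s \<and> tm_in M n t"
| "qf_in M n (RelF R ts) \<longleftrightarrow> rel_ar M R = Some (length ts) \<and> (\<forall>t \<in> set ts. tm_in M n t)"
| "qf_in M n (NegF \<phi>) \<longleftrightarrow> qf_in M n \<phi>"
| "qf_in M n (AndF \<phi> \<psi>) \<longleftrightarrow> qf_in M n \<phi> \<and> qf_in M n \<psi>"

primrec tm_val :: "'a model \<Rightarrow> 'a list \<Rightarrow> tm \<Rightarrow> 'a" where
  "tm_val M xs (Var i) = xs ! i"
| "tm_val M xs (App f ts) = fun_int M f (map (tm_val M xs) ts)"

primrec sat :: "'a model \<Rightarrow> 'a list \<Rightarrow> qf \<Rightarrow> bool" where
  "sat M xs (EqF s t) \<longleftrightarrow> tm_val M xs s = tm_val M xs t"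
| "sat M xs (RelF R ts) \<longleftrightarrow> rel_int M R (map (tm_val M xs) ts)"
| "sat M xs (NegF \<phi>) \<longleftrightarrow> \<not> sat M xs \<phi>"
| "sat M xs (AndF \<phi> \<psi>) \<longleftrightarrow> sat M xs \<phi> \<and> sat M xs \<psi>"

text \<open>
  \<open>rk_ge U M w \<delta>\<close> says that \<open>rk(w, M) \<ge> \<delta>\<close>, where \<open>U\<close> is the universe of \<open>M\<close>.  All repetition free
  enumerations \<open>xs\<close> of \<open>w\<close> are considered; as the formulas are closed under permuting variables, any
  single one would do.
\<close>

function rk_ge :: "'a set \<Rightarrow> 'a model \<Rightarrow> 'a set \<Rightarrow> 'o::{wellorder,no_top} \<Rightarrow> bool" where
  "rk_ge U M w \<delta> \<longleftrightarrow>
     (if \<delta> = ozero then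
        \<forall>xs \<phi> k. distinct xs \<and> set xs = w \<and> qf_in M (length xs) \<phi> \<and> k < length xs \<and> sat M xs \<phi> \<longrightarrow>
          uncountable {\<alpha> \<in> U. sat M (xs[k := \<alpha>]) \<phi>}
      else if limit_ord \<delta> then
        \<forall>\<gamma>. \<gamma> < \<delta> \<longrightarrow> rk_ge U M w \<gamma>
      else
        \<forall>\<gamma>. \<delta> = osucc \<gamma> \<longrightarrow>
          (\<forall>xs \<phi> k. distinct xs \<and> set xs = w \<and> qf_in M (length xs) \<phi> \<and> k < length xs \<and> sat M xs \<phi> \<longrightarrow>
            (\<exists>\<alpha> \<in> U - w. rk_ge U M (w \<union> {\<alpha>}) \<gamma> \<and> sat M (xs[k := \<alpha>]) \<phi>)))"
  by pat_completeness auto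
termination
  by (relation "inv_image {(y, x). y < x} (\<lambda>(U, M, w, \<delta>). \<delta>)") (auto simp: wf less_osucc)

declare rk_ge.simps [simp del]

datatype 'o rank = MinusOne | Rank 'o | Infinite

definition rk :: "'a set \<Rightarrow> 'a model \<Rightarrow> 'a set \<Rightarrow> 'o::{wellorder,no_top} rank" where
  "rk U M w =
     (if \<not> rk_ge U M w (ozero :: 'o) then MinusOne
      else if \<forall>\<delta> :: 'o. rk_ge U M w \<delta> then Infinite
      else Rank (THE \<delta>. rk_ge U M w \<delta> \<and> \<not> rk_ge U M w (osucc \<delta>)))"

fun one_plus_rank_le :: "'o::{wellorder,no_top} rank \<Rightarrow> 'o \<Rightarrow> bool" where
  "one_plus_rank_le MinusOne \<epsilon> \<longleftrightarrow> ozero \<le> \<epsilon>"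
| "one_plus_rank_le (Rank \<delta>) \<epsilon> \<longleftrightarrow> one_plus \<delta> \<le> \<epsilon>"
| "one_plus_rank_le Infinite \<epsilon> \<longleftrightarrow> False"

text \<open>
  Ranks \<open>\<ge>\<close> all elements of \<open>'o\<close> count as infinite; as \<open>\<epsilon> :: 'o\<close> they exceed \<open>\<epsilon>\<close>, so this has no
  effect on the following property.
\<close>

definition NPr :: "'o::{wellorder,no_top} \<Rightarrow> 'a set \<Rightarrow> bool" where
  "NPr \<epsilon> U \<longleftrightarrow> (\<exists>M :: 'a model. is_model U M \<and>
     (\<forall>w \<in> fin_ne U. one_plus_rank_le (rk U M w) \<epsilon>))"

section \<open>Forcing\<close>

text \<open>Smaller conditions are stronger: \<open>le Q q p\<close> means that \<open>q\<close> extends \<open>p\<close>.\<close>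

record 'p forcing =
  cond :: "'p set"
  le :: "'p \<Rightarrow> 'p \<Rightarrow> bool"

definition forcing_notion :: "'p forcing \<Rightarrow> bool" where
  "forcing_notion Q \<longleftrightarrow>
     (\<forall>p \<in> cond Q. le Q p p) \<and>
     (\<forall>p \<in> cond Q. \<forall>q \<in> cond Q. \<forall>r \<in> cond Q. le Q p q \<and> le Q q r \<longrightarrow> le Q p r) \<and>
     (\<exists>t \<in> cond Q. \<forall>p \<in> cond Q. le Q p t)"

definition compat :: "'p forcing \<Rightarrow> 'p \<Rightarrow> 'p \<Rightarrow> bool" where
  "compat Q p q \<longleftrightarrow> (\<exists>r \<in> cond Q. le Q r p \<and> le Q r q)"

definition ccc :: "'p forcing \<Rightarrow> bool" where
  "ccc Q \<longleftrightarrow> (\<forall>A \<subseteq> cond Q. (\<forall>p \<in> A. \<forall>q \<in> A. p \<noteq> q \<longrightarrow> \<not> compat Q p q) \<longrightarrow> countable A)"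

definition dense_below :: "'p forcing \<Rightarrow> 'p \<Rightarrow> ('p \<Rightarrow> bool) \<Rightarrow> bool" where
  "dense_below Q p D \<longleftrightarrow> (\<forall>q \<in> cond Q. le Q q p \<longrightarrow> (\<exists>r \<in> cond Q. le Q r q \<and> D r))"

text \<open>
  The universe of HOL plays the role of the ground model.  A name for a subset of (the check name of)
  a ground model type is a set of pairs of an element and a condition, i.e. \<open>(a, p)\<close> stands for
  the pair of the check name of \<open>a\<close> and \<open>p\<close>; in the extension, every subset of a ground model set has
  such a name.  A statement of the forcing language is identified with the relation of being
  forced, and the connectives and quantifiers below are the usual clauses of the recursive
  definition of the forcing relation.  Quantifiers range either over (the check name of) a ground
  model set or over all names for subsets of a ground model set.
\<close>

type_synonym ('a, 'p) name = "('a \<times> 'p) set"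

type_synonym 'p stmt = "'p forcing \<Rightarrow> 'p \<Rightarrow> bool"

definition forced :: "'p forcing \<Rightarrow> 'p stmt \<Rightarrow> bool"
  where "forced Q \<phi> \<longleftrightarrow> (\<forall>p \<in> cond Q. \<phi> Q p)"

definition f_mem :: "'a \<Rightarrow> ('a, 'p) name \<Rightarrow> 'p stmt" where
  "f_mem a \<tau> = (\<lambda>Q p. dense_below Q p (\<lambda>q. \<exists>r \<in> cond Q. (a, r) \<in> \<tau> \<and> le Q q r))"

definition f_not :: "'p stmt \<Rightarrow> 'p stmt" where
  "f_not \<phi> = (\<lambda>Q p. \<forall>q \<in> cond Q. le Q q p \<longrightarrow> \<not> \<phi> Q q)"

definition f_and :: "'p stmt \<Rightarrow> 'p stmt \<Rightarrow> 'p stmt" where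
  "f_and \<phi> \<psi> = (\<lambda>Q p. \<phi> Q p \<and> \<psi> Q p)"

definition f_imp :: "'p stmt \<Rightarrow> 'p stmt \<Rightarrow> 'p stmt" where
  "f_imp \<phi> \<psi> = f_not (f_and \<phi> (f_not \<psi>))"

definition f_iff :: "'p stmt \<Rightarrow> 'p stmt \<Rightarrow> 'p stmt" where
  "f_iff \<phi> \<psi> = f_and (f_imp \<phi> \<psi>) (f_imp \<psi> \<phi>)"

definition f_all :: "'x set \<Rightarrow> ('x \<Rightarrow> 'p stmt) \<Rightarrow> 'p stmt" where
  "f_all X \<phi> = (\<lambda>Q p. \<forall>x \<in> X. \<phi> x Q p)"

definition f_ex :: "'x set \<Rightarrow> ('x \<Rightarrow> 'p stmt) \<Rightarrow> 'p stmt" where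
  "f_ex X \<phi> = (\<lambda>Q p. dense_below Q p (\<lambda>q. \<exists>x \<in> X. \<phi> x Q q))"

text \<open>
  Elements of the Cantor space of the extension are given by names for their graphs.  A sequence of
  such elements indexed by a ground model set is given by a name for a set of triples
  \<open>(\<alpha>, n, i)\<close>, from which \<open>sect\<close> extracts the name of the \<open>\<alpha>\<close>-th member.
\<close>

type_synonym 'p real_name = "(nat \<times> bit, 'p) name"

definition sect :: "('x \<times> 'a, 'p) name \<Rightarrow> 'x \<Rightarrow> ('a, 'p) name"
  where "sect \<sigma> \<alpha> = {(a, p). ((\<alpha>, a), p) \<in> \<sigma>}"

definition f_cantor :: "'p real_name \<Rightarrow> 'p stmt" where
  "f_cantor x = f_and
     (f_all UNIV (\<lambda>n. f_ex UNIV (\<lambda>i. f_mem (n, i) x)))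
     (f_all UNIV (\<lambda>n. f_not (f_and (f_mem (n, 0) x) (f_mem (n, 1) x))))"

definition f_eq :: "('a, 'p) name \<Rightarrow> ('a, 'p) name \<Rightarrow> 'p stmt" where
  "f_eq x y = f_all UNIV (\<lambda>a. f_iff (f_mem a x) (f_mem a y))"

text \<open>\<open>z = x + y\<close>, for elements of the Cantor space.\<close>

definition f_is_sum :: "'p real_name \<Rightarrow> 'p real_name \<Rightarrow> 'p real_name \<Rightarrow> 'p stmt" where
  "f_is_sum z x y = f_all UNIV (\<lambda>n. f_all UNIV (\<lambda>i. f_all UNIV (\<lambda>j.
     f_imp (f_and (f_mem (n, i) x) (f_mem (n, j) y)) (f_mem (n, i + j) z))))"

text \<open>\<open>x \<in> lim(T)\<close> for \<open>x\<close> in the Cantor space: each \<open>x \<restriction> n\<close> equals some \<open>t \<in> T\<close> of length \<open>n\<close>.\<close>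

definition f_in_lim :: "'p real_name \<Rightarrow> bit list set \<Rightarrow> 'p stmt" where
  "f_in_lim x T = f_all UNIV (\<lambda>n. f_ex {t \<in> T. length t = n} (\<lambda>t.
     f_all {..<n} (\<lambda>i. f_mem (i, t ! i) x)))"

text \<open>\<open>z \<in> x + B\<close>, where \<open>B\<close> is the union of all \<open>lim(T m)\<close>, computed in the extension.\<close>

definition f_in_translate ::
    "'p real_name \<Rightarrow> 'p real_name \<Rightarrow> (nat \<Rightarrow> bit list set) \<Rightarrow> 'p stmt" where
  "f_in_translate z x T = f_ex UNIV (\<lambda>y :: 'p real_name.
     f_and (f_cantor y) (f_and (f_ex UNIV (\<lambda>m. f_in_lim y (T m))) (f_is_sum z x y)))"

text \<open>The set of all \<open>x\<close> in the Cantor space with \<open>\<phi> x\<close> has at least \<open>N\<close> elements.\<close>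

definition f_card_ge :: "nat \<Rightarrow> ('p real_name \<Rightarrow> 'p stmt) \<Rightarrow> 'p stmt" where
  "f_card_ge N \<phi> = f_ex UNIV (\<lambda>\<xi> :: (nat \<times> nat \<times> bit, 'p) name.
     f_and
       (f_all {..<N} (\<lambda>i. f_and (f_cantor (sect \<xi> i)) (\<phi> (sect \<xi> i))))
       (f_all {(i, j). i < j \<and> j < N} (\<lambda>(i, j). f_not (f_eq (sect \<xi> i) (sect \<xi> j)))))"

text \<open>
  There is a sequence, indexed by \<open>\<Lambda>\<close>, of distinct elements of the Cantor space such that any two
  translates of \<open>B\<close> by members of the sequence have at least \<open>N\<close> points in common.
\<close>

definition f_overlapping_sequence ::
    "'x set \<Rightarrow> (nat \<Rightarrow> bit list set) \<Rightarrow> nat \<Rightarrow> 'p stmt" where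
  "f_overlapping_sequence \<Lambda> T N = f_ex UNIV (\<lambda>\<sigma> :: ('x \<times> nat \<times> bit, 'p) name.
     f_and (f_all \<Lambda> (\<lambda>\<alpha>. f_cantor (sect \<sigma> \<alpha>)))
     (f_and (f_all (offdiag \<Lambda>) (\<lambda>(\<alpha>, \<beta>). f_not (f_eq (sect \<sigma> \<alpha>) (sect \<sigma> \<beta>))))
       (f_all \<Lambda> (\<lambda>\<alpha>. f_all \<Lambda> (\<lambda>\<beta>.
          f_card_ge N (\<lambda>z. f_and (f_in_translate z (sect \<sigma> \<alpha>) T)
                                   (f_in_translate z (sect \<sigma> \<beta>) T)))))))"

end

theory Submission
  imports Defs
begin

text \<open>
  The points \<open>\<eta>\<^sub>\<alpha>\<close> are added by finite approximations that are copied from the bricks \<open>b n\<close>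
  given by controlled amalgamation.

  \<^item> \<^emph>\<open>The index set.\<close>  A model witnessing \<open>NPr \<epsilon> (Field lam)\<close> turns \<open>Field lam\<close>, up to countably many
    points, into a YZR-system \<open>s\<close>: \<open>r(w) = 1 + rk(w)\<close>, while \<open>j(w)\<close> and \<open>k(w)\<close> record a formula and
    a variable that show why the rank of \<open>w\<close> is not larger (\<open>yzr_system_of_NPr\<close>).  Every finite
    subsystem of \<open>s\<close> has a quasi-embedding into the cute system \<open>S\<close> (\<open>cute_embeds_finite\<close>).

  \<^item> \<^emph>\<open>The forcing.\<close>  A condition is a finite set of points of \<open>s\<close> with a quasi-embedding onto vertices
    of some \<open>b n\<close>.  The points inherit the finite sequences \<open>\<eta>\<close> of these vertices, and the pairs of
    points inherit \<open>h\<^sub>i\<close> and \<open>g\<^sub>i\<close>.  A condition gets stronger when it has more points and longer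
    sequences.

  \<^item> \<^emph>\<open>The generic points.\<close>  The one-map clause of controlled amalgamation and the growth of the
    bricks show that every point occurs, with arbitrarily long approximations (\<open>dense_dom\<close>, \<open>dense_height\<close>).
    In the extension let \<open>\<eta>\<^sub>\<alpha>\<close> and \<open>G\<^sub>i(\<alpha>,\<beta>)\<close> be the unions of the approximations; then
    \<open>G\<^sub>i(\<alpha>,\<beta>)\<close> is a branch of the tree number \<open>h\<^sub>i(\<alpha>,\<beta>)\<close>, and
    \<open>\<eta>\<^sub>\<alpha> + G\<^sub>i(\<alpha>,\<beta>) = \<eta>\<^sub>\<beta> + G\<^sub>i(\<beta>,\<alpha>)\<close>.  As addition is modulo 2, this equation can be
    rearranged to \<open>\<eta>\<^sub>\<alpha> + G\<^sub>i(\<beta>,\<alpha>) = \<eta>\<^sub>\<beta> + G\<^sub>i(\<alpha>,\<beta>)\<close>, so that each \<open>i < \<iota>\<close> yields two common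
    points of \<open>\<eta>\<^sub>\<alpha> + B\<close> and \<open>\<eta>\<^sub>\<beta> + B\<close>.  All \<open>2\<iota>\<close> points differ because the \<open>G\<^sub>i(\<alpha>,\<beta>)\<close>,
    \<open>G\<^sub>i(\<beta>,\<alpha>)\<close> do (\<open>overlapping_sequence\<close>).

  \<^item> \<^emph>\<open>The chain condition.\<close>  Among uncountably many conditions there are two that live on the same
    vertices of the same brick, have the same values of \<open>j\<close>, and put common points on the same vertex
    (\<open>aligned_pair\<close>).  The two-map clause of controlled amalgamation joins them, provided that its
    premise on sets of rank 0 holds.  If this failed for a set \<open>v\<close> of common vertices and another
    vertex \<open>\<delta>\<close>, the two points on \<open>\<delta>\<close> would have the same position over the same finite set of points, and the same value of
    \<open>j\<close>, at rank 0.  This is what the last axiom of YZR-systems forbids (\<open>no_twins\<close>).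
\<close>

section \<open>Ordinal arithmetic\<close>

lemma ozero_le: "ozero \<le> x"
  unfolding ozero_def by (rule Least_le) simp

lemma not_less_ozero: "\<not> x < ozero"
  using ozero_le[of x] by simp

lemma osucc_le: "x < y \<Longrightarrow> osucc x \<le> y"
  unfolding osucc_def by (rule Least_le)

lemma less_osucc_iff: "x < osucc y \<longleftrightarrow> x \<le> y"
  using osucc_le[of y x] less_osucc[of y] by (meson le_less_trans not_less)

lemma osucc_inject: "osucc x = osucc y \<longleftrightarrow> x = y"
  by (metis less_osucc less_osucc_iff order_antisym)

lemma ozero_less_osucc: "ozero < osucc x"
  using ozero_le[of x] less_osucc_iff by blast

lemma osucc_not_ozero: "osucc x \<noteq> ozero"
  using ozero_less_osucc[of x] by auto

lemma osucc_not_limit: "\<not> limit_ord (osucc x)"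
  by (auto simp: limit_ord_def)

text \<open>
  The bound \<open>osucc x\<close> guarantees that the least element in the definition of \<open>one_plus x\<close> exists;
  monotonicity is then part of its defining property.
\<close>

lemma one_plus_bounds:
  "ozero < one_plus x \<and> (\<forall>y. y < x \<longrightarrow> one_plus y < one_plus x) \<and> one_plus x \<le> osucc x"
proof (induction x rule: less_induct)
  case (less x)
  have "one_plus y < osucc x" if "y < x" for y
    using less.IH[OF that] osucc_le[OF that] less_osucc[of x] by (meson le_less_trans)
  then have *: "ozero < osucc x \<and> (\<forall>y. y < x \<longrightarrow> one_plus y < osucc x)"
    using ozero_less_osucc by blast
  have "one_plus x = (LEAST z. ozero < z \<and> (\<forall>y. y < x \<longrightarrow> one_plus y < z))"
    by (rule one_plus.simps)
  then show ?case
    using LeastI[of "\<lambda>z. ozero < z \<and> (\<forall>y. y < x \<longrightarrow> one_plus y < z)", OF *]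
      Least_le[of "\<lambda>z. ozero < z \<and> (\<forall>y. y < x \<longrightarrow> one_plus y < z)", OF *] by simp
qed

lemma one_plus_pos: "ozero < one_plus x"
  using one_plus_bounds by blast

lemma one_plus_mono: "x \<le> y \<Longrightarrow> one_plus x \<le> one_plus y"
  using one_plus_bounds[of y] by (metis le_less order_refl)

lemma one_plus_inject: "one_plus x = one_plus y \<Longrightarrow> x = y"
  by (metis one_plus_bounds less_irrefl linorder_neqE)

section \<open>The rank of finite sets in a model\<close>

lemma rk_ge_ozero: "rk_ge U M w ozero \<longleftrightarrow>
   (\<forall>xs \<phi> k. distinct xs \<and> set xs = w \<and> qf_in M (length xs) \<phi> \<and> k < length xs \<and> sat M xs \<phi> \<longrightarrow>
      uncountable {\<alpha> \<in> U. sat M (xs[k := \<alpha>]) \<phi>})"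
  by (subst rk_ge.simps) simp

lemma rk_ge_limit: "limit_ord \<delta> \<Longrightarrow> rk_ge U M w \<delta> \<longleftrightarrow> (\<forall>\<gamma>. \<gamma> < \<delta> \<longrightarrow> rk_ge U M w \<gamma>)"
  by (subst rk_ge.simps) (auto simp: limit_ord_def)

lemma rk_ge_osucc: "rk_ge U M w (osucc \<gamma>) \<longleftrightarrow>
   (\<forall>xs \<phi> k. distinct xs \<and> set xs = w \<and> qf_in M (length xs) \<phi> \<and> k < length xs \<and> sat M xs \<phi> \<longrightarrow>
      (\<exists>\<alpha> \<in> U - w. rk_ge U M (w \<union> {\<alpha>}) \<gamma> \<and> sat M (xs[k := \<alpha>]) \<phi>))"
  by (subst rk_ge.simps) (simp add: osucc_not_ozero osucc_not_limit osucc_inject)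

lemma ord_cases:
  obtains "\<delta> = ozero" | "limit_ord \<delta>" | \<gamma> where "\<delta> = osucc \<gamma>"
  unfolding limit_ord_def by blast

lemma tm_val_append: "tm_in M (length xs) t \<Longrightarrow> tm_val M (xs @ ys) t = tm_val M xs t"
proof (induction t)
  case (App f ts)
  then have "map (tm_val M (xs @ ys)) ts = map (tm_val M xs) ts"
    by (intro map_cong) auto
  then show ?case by (simp only: tm_val.simps)
qed (simp add: nth_append)

lemma sat_append: "qf_in M (length xs) \<phi> \<Longrightarrow> sat M (xs @ ys) \<phi> = sat M xs \<phi>"
proof (induction \<phi>)
  case (RelF R ts)
  then have "map (tm_val M (xs @ ys)) ts = map (tm_val M xs) ts"
    by (intro map_cong) (auto simp: tm_val_append)
  then show ?case by (simp only: sat.simps)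
qed (simp_all add: tm_val_append)

lemma tm_in_mono: "tm_in M m t \<Longrightarrow> m \<le> n \<Longrightarrow> tm_in M n t"
  by (induction t) auto

lemma qf_in_mono: "qf_in M m \<phi> \<Longrightarrow> m \<le> n \<Longrightarrow> qf_in M n \<phi>"
  by (induction \<phi>) (auto intro: tm_in_mono)

text \<open>
  A formula about the elements of \<open>u\<close> is also a formula about the elements of \<open>w\<close>, with further dummy
  variables.
\<close>

lemma rk_ge_subset:
  assumes "u \<subseteq> w" "finite w" "rk_ge U M w \<delta>"
  shows "rk_ge U M u \<delta>"
  using assms
proof (induction \<delta> arbitrary: u w rule: less_induct)
  case (less \<delta>)
  obtain ys where ys: "distinct ys" "set ys = w - u"
    using finite_distinct_list[of "w - u"] less.prems(2) by auto
  have ext: "distinct (xs @ ys) \<and> set (xs @ ys) = w \<and> qf_in M (length (xs @ ys)) \<phi> \<and>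
      k < length (xs @ ys) \<and> sat M (xs @ ys) \<phi> \<and>
      (\<forall>\<alpha>. sat M ((xs @ ys)[k := \<alpha>]) \<phi> = sat M (xs[k := \<alpha>]) \<phi>)"
    if "distinct xs \<and> set xs = u \<and> qf_in M (length xs) \<phi> \<and> k < length xs \<and> sat M xs \<phi>"
    for xs \<phi> k
    using that ys less.prems(1)
    by (auto simp: sat_append list_update_append intro: qf_in_mono)
  consider "\<delta> = ozero" | "limit_ord \<delta>" | \<gamma> where "\<delta> = osucc \<gamma>" by (rule ord_cases)
  then show ?case
  proof cases
    case 1
    then show ?thesis
      using less.prems(3) ext unfolding 1 rk_ge_ozero by (metis (no_types, lifting) Collect_cong)
  next
    case 2
    then show ?thesis
      using less.prems less.IH by (simp add: rk_ge_limit)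
  next
    case 3
    have "\<exists>\<alpha> \<in> U - u. rk_ge U M (u \<union> {\<alpha>}) \<gamma> \<and> sat M (xs[k := \<alpha>]) \<phi>"
      if xs: "distinct xs \<and> set xs = u \<and> qf_in M (length xs) \<phi> \<and> k < length xs \<and> sat M xs \<phi>"
      for xs \<phi> k
    proof -
      obtain \<alpha> where \<alpha>: "\<alpha> \<in> U - w" "rk_ge U M (w \<union> {\<alpha>}) \<gamma>" "sat M ((xs @ ys)[k := \<alpha>]) \<phi>"
        using less.prems(3) ext[OF xs] unfolding 3 rk_ge_osucc by metis
      moreover have "rk_ge U M (u \<union> {\<alpha>}) \<gamma>"
        using less.IH[of \<gamma> "u \<union> {\<alpha>}" "w \<union> {\<alpha>}"] \<alpha>(2) less.prems(1,2) 3 less_osucc by auto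
      ultimately show ?thesis
        using ext[OF xs] less.prems(1) by auto
    qed
    then show ?thesis
      unfolding 3 rk_ge_osucc by blast
  qed
qed

text \<open>
  The formula \<open>x\<^sub>0 = x\<^sub>0\<close> yields a superset of \<open>w\<close> of rank \<open>\<ge> \<gamma>\<close>, and passing to a subset does not
  decrease the rank.
\<close>

lemma rk_ge_osuccD:
  assumes "rk_ge U M w (osucc \<gamma>)" "finite w" "w \<noteq> {}"
  shows "rk_ge U M w \<gamma>"
proof -
  obtain xs where xs: "distinct xs" "set xs = w"
    using finite_distinct_list[OF assms(2)] by auto
  then have "distinct xs \<and> set xs = w \<and> qf_in M (length xs) (EqF (Var 0) (Var 0)) \<and>
      0 < length xs \<and> sat M xs (EqF (Var 0) (Var 0))"
    using assms(3) by auto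
  then obtain \<alpha> where "rk_ge U M (w \<union> {\<alpha>}) \<gamma>"
    using assms(1) unfolding rk_ge_osucc by metis
  then show ?thesis
    by (rule rk_ge_subset[rotated 2]) (use assms(2) in auto)
qed

lemma rk_ge_mono:
  assumes "rk_ge U M w \<delta>" "\<gamma> \<le> \<delta>" "finite w" "w \<noteq> {}"
  shows "rk_ge U M w \<gamma>"
  using assms(1,2)
proof (induction \<delta> rule: less_induct)
  case (less \<delta>)
  consider "\<gamma> = \<delta>" | "\<gamma> < \<delta>" using less.prems(2) by force
  then show ?case
  proof cases
    case 2
    consider "\<delta> = ozero" | "limit_ord \<delta>" | \<beta> where "\<delta> = osucc \<beta>" by (rule ord_cases)
    then show ?thesis
    proof cases
      case 1
      then show ?thesis using 2 not_less_ozero by auto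
    next
      case L: 2
      then show ?thesis using 2 less.prems(1) by (simp add: rk_ge_limit)
    next
      case 3
      then show ?thesis
        using 2 less.IH[of \<beta>] less.prems(1) rk_ge_osuccD[OF _ assms(3,4)] less_osucc[of \<beta>]
        by (auto simp: less_osucc_iff)
    qed
  qed (use less.prems in auto)
qed

definition rank_value :: "'a set \<Rightarrow> 'a model \<Rightarrow> 'a set \<Rightarrow> 'o::{wellorder,no_top}" where
  "rank_value U M w = (THE \<delta>. rk_ge U M w \<delta> \<and> \<not> rk_ge U M w (osucc \<delta>))"

text \<open>
  The function \<open>1 + rk\<close> on sets whose rank is not infinite, where \<open>1 + (-1) = 0\<close>.
\<close>

definition rank1 :: "'a set \<Rightarrow> 'a model \<Rightarrow> 'a set \<Rightarrow> 'o::{wellorder,no_top}" where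
  "rank1 U M w = (if rk_ge U M w (ozero :: 'o) then one_plus (rank_value U M w) else ozero)"

lemma rank_value:
  fixes \<delta> :: "'o::{wellorder,no_top}"
  assumes "finite w" "w \<noteq> {}" "rk_ge U M w (ozero :: 'o)" "\<not> rk_ge U M w \<delta>"
  shows "rk_ge U M w (rank_value U M w :: 'o) \<and> \<not> rk_ge U M w (osucc (rank_value U M w :: 'o))"
proof -
  define \<mu> where "\<mu> = (LEAST \<delta> :: 'o. \<not> rk_ge U M w \<delta>)"
  have \<mu>: "\<not> rk_ge U M w \<mu>" "\<And>\<gamma>. \<gamma> < \<mu> \<Longrightarrow> rk_ge U M w \<gamma>"
    using LeastI[of "\<lambda>\<delta>. \<not> rk_ge U M w \<delta>" \<delta>] assms(4) not_less_Least unfolding \<mu>_def by blast+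
  have "\<mu> \<noteq> ozero" "\<not> limit_ord \<mu>" using \<mu> assms(3) by (auto simp: rk_ge_limit)
  then obtain \<gamma> where \<gamma>: "\<mu> = osucc \<gamma>" by (metis limit_ord_def)
  have "\<exists>!\<delta> :: 'o. rk_ge U M w \<delta> \<and> \<not> rk_ge U M w (osucc \<delta>)"
  proof (intro ex1I[of _ \<gamma>])
    show "rk_ge U M w \<gamma> \<and> \<not> rk_ge U M w (osucc \<gamma>)" using \<mu> \<gamma> less_osucc by auto
  next
    fix \<delta> :: 'o assume "rk_ge U M w \<delta> \<and> \<not> rk_ge U M w (osucc \<delta>)"
    then show "\<delta> = \<gamma>"
      using rk_ge_mono[OF _ _ assms(1,2)] \<mu> \<gamma> less_osucc
      by (metis less_osucc_iff linorder_neqE not_less order_antisym)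
  qed
  then show ?thesis unfolding rank_value_def by (rule theI')
qed

lemma rank1_cases:
  fixes w :: "'a set" and \<epsilon> :: "'o::{wellorder,no_top}"
  assumes M: "\<forall>w \<in> fin_ne U. one_plus_rank_le (rk U M w) \<epsilon>" and w: "w \<in> fin_ne U"
  obtains "\<not> rk_ge U M w (ozero :: 'o)" "rank1 U M w = (ozero :: 'o)"
  | \<delta> :: 'o where "rk_ge U M w \<delta>" "\<not> rk_ge U M w (osucc \<delta>)" "rank1 U M w = one_plus \<delta>"
      "one_plus \<delta> \<le> \<epsilon>"
proof (cases "rk_ge U M w (ozero :: 'o)")
  case True
  have *: "one_plus_rank_le (rk U M w) \<epsilon>" using M w by blast
  then have "\<not> (\<forall>\<delta> :: 'o. rk_ge U M w \<delta>)"
    using True by (auto simp: rk_def split: if_splits)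
  then have "rk U M w = Rank (rank_value U M w :: 'o)"
    using True by (auto simp: rk_def rank_value_def)
  then show ?thesis
    using that(2)[of "rank_value U M w"] rank_value[of w U M] True w * \<open>\<not> (\<forall>\<delta> :: 'o. rk_ge U M w \<delta>)\<close>
    by (auto simp: rank1_def fin_ne_def)
qed (use that(1) in \<open>auto simp: rank1_def\<close>)

lemma rank1_antimono:
  fixes \<epsilon> :: "'o::{wellorder,no_top}"
  assumes M: "\<forall>w \<in> fin_ne U. one_plus_rank_le (rk U M w) \<epsilon>"
    and "u \<noteq> {}" "u \<subseteq> w" "w \<in> fin_ne U"
  shows "rank1 U M w \<le> (rank1 U M u :: 'o)"
proof (rule rank1_cases[OF M assms(4)])
  assume "rank1 U M w = (ozero :: 'o)"
  then show ?thesis by (simp add: ozero_le)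
next
  fix \<delta> :: 'o assume \<delta>: "rk_ge U M w \<delta>" "rank1 U M w = one_plus \<delta>"
  have fu: "finite u" "u \<in> fin_ne U" using assms(2-4) finite_subset by (auto simp: fin_ne_def)
  have u\<delta>: "rk_ge U M u \<delta>" using rk_ge_subset[OF assms(3) _ \<delta>(1)] assms(4) by (simp add: fin_ne_def)
  show ?thesis
  proof (rule rank1_cases[OF M fu(2)])
    assume "\<not> rk_ge U M u (ozero :: 'o)"
    then show ?thesis using rk_ge_mono[OF u\<delta> ozero_le fu(1) assms(2)] by blast
  next
    fix \<delta>' :: 'o assume \<delta>': "\<not> rk_ge U M u (osucc \<delta>')" "rank1 U M u = one_plus \<delta>'"
    have "\<not> osucc \<delta>' \<le> \<delta>" using rk_ge_mono[OF u\<delta> _ fu(1) assms(2)] \<delta>'(1) by blast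
    then have "\<delta> \<le> \<delta>'" by (simp add: not_le less_osucc_iff)
    then show ?thesis using \<delta>(2) \<delta>'(2) one_plus_mono by simp
  qed
qed

instance tm :: countable by countable_datatype
instance qf :: countable by countable_datatype

text \<open>
  A point of negative rank satisfies a formula that has only countably many solutions, and there are
  only countably many formulas.
\<close>

lemma countable_rank_negative_singletons:
  "countable {a \<in> U. \<not> rk_ge U M {a} ozero}"
proof (rule countable_subset)
  let ?C = "\<lambda>\<phi>. {\<alpha> \<in> U. sat M [\<alpha>] \<phi>}"
  show "countable (\<Union>\<phi> \<in> {\<phi>. countable (?C \<phi>)}. ?C \<phi>)"
    by (intro countable_UN) auto
  show "{a \<in> U. \<not> rk_ge U M {a} ozero} \<subseteq> (\<Union>\<phi> \<in> {\<phi>. countable (?C \<phi>)}. ?C \<phi>)"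
  proof safe
    fix a assume "a \<in> U" "\<not> rk_ge U M {a} ozero"
    then obtain xs \<phi> k where *: "distinct xs" "set xs = {a}" "k < length xs" "sat M xs \<phi>"
      "countable {\<alpha> \<in> U. sat M (xs[k := \<alpha>]) \<phi>}"
      unfolding rk_ge_ozero by blast
    then have "xs = [a]"
      by (metis distinct_card card_1_singleton_iff One_nat_def is_singletonI is_singleton_altdef length_0_conv length_Suc_conv list.set_intros(1) singletonD)
    then show "a \<in> (\<Union>\<phi> \<in> {\<phi>. countable (?C \<phi>)}. ?C \<phi>)"
      using * \<open>a \<in> U\<close> by auto
  qed
qed

text \<open>
  A triple \<open>(xs, \<phi>, k)\<close> that certifies that the rank of \<open>w\<close> is not larger than it is: \<open>\<phi>\<close> holds at
  the enumeration \<open>xs\<close> of \<open>w\<close>, but its \<open>k\<close>-th variable has only countably many solutions (if the rank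
  is \<open>-1\<close>), respectively no solution outside \<open>w\<close> that can be added to \<open>w\<close> without loss of rank.
  The latter is phrased by an equation between values of \<open>rank1\<close> because the last axiom of YZR-systems
  has this form.
\<close>

definition rank_fail :: "'a set \<Rightarrow> 'a model \<Rightarrow> 'o::{wellorder,no_top} itself \<Rightarrow> 'a set \<Rightarrow> 'a list \<times> qf \<times> nat \<Rightarrow> bool"
  where "rank_fail U M (t :: 'o itself) w = (\<lambda>(xs, \<phi>, k). distinct xs \<and> set xs = w \<and> k < length xs \<and> sat M xs \<phi> \<and>
     (if rank1 U M w = (ozero :: 'o) then countable {\<alpha> \<in> U. sat M (xs[k := \<alpha>]) \<phi>}
      else \<forall>\<alpha> \<in> U - w. rank1 U M (w \<union> {\<alpha>}) = (rank1 U M w :: 'o) \<longrightarrow> \<not> sat M (xs[k := \<alpha>]) \<phi>))"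

lemma rank_fail_exists:
  fixes \<epsilon> :: "'o::{wellorder,no_top}"
  assumes M: "\<forall>w \<in> fin_ne U. one_plus_rank_le (rk U M w) \<epsilon>" and w: "w \<in> fin_ne U"
  shows "\<exists>t. rank_fail U M TYPE('o) w t"
proof (rule rank1_cases[OF M w])
  assume *: "\<not> rk_ge U M w (ozero :: 'o)" "rank1 U M w = (ozero :: 'o)"
  then obtain xs \<phi> k where "distinct xs" "set xs = w" "k < length xs" "sat M xs \<phi>"
    "countable {\<alpha> \<in> U. sat M (xs[k := \<alpha>]) \<phi>}"
    unfolding rk_ge_ozero by blast
  then have "rank_fail U M TYPE('o) w (xs, \<phi>, k)" using * by (simp add: rank_fail_def)
  then show ?thesis by blast
next
  fix \<delta> :: 'o
  assume *: "rk_ge U M w \<delta>" "\<not> rk_ge U M w (osucc \<delta>)" "rank1 U M w = one_plus \<delta>"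
  then obtain xs \<phi> k where xs: "distinct xs" "set xs = w" "k < length xs" "sat M xs \<phi>"
    "\<forall>\<alpha> \<in> U - w. rk_ge U M (w \<union> {\<alpha>}) \<delta> \<longrightarrow> \<not> sat M (xs[k := \<alpha>]) \<phi>"
    unfolding rk_ge_osucc by blast
  have "rk_ge U M (w \<union> {\<alpha>}) \<delta>"
    if \<alpha>: "\<alpha> \<in> U - w" "rank1 U M (w \<union> {\<alpha>}) = (rank1 U M w :: 'o)" for \<alpha>
  proof -
    have "w \<union> {\<alpha>} \<in> fin_ne U" using w \<alpha> by (auto simp: fin_ne_def)
    then show ?thesis
      using one_plus_pos[of \<delta>] * \<alpha>(2)
      by (cases rule: rank1_cases[OF M]) (auto dest!: one_plus_inject)
  qed
  then have "rank_fail U M TYPE('o) w (xs, \<phi>, k)"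
    using xs * one_plus_pos[of \<delta>] by (auto simp: rank_fail_def)
  then show ?thesis by blast
qed

text \<open>
  The content of a YZR-system before a linear order is chosen.  The carrier consists of the points of
  nonnegative rank, and \<open>xs\<close>, \<open>k\<close>, \<open>code\<close> come from a certificate: \<open>code\<close> numbers its formula together
  with the place of \<open>xs w ! k w\<close> in an enumeration of the solutions of that formula.  Suppose that
  replacing this entry by \<open>b\<close> leads to a set with the same data.  Then \<open>b\<close> is another solution.  For
  nonnegative rank this contradicts \<open>r (w \<union> {b}) = r w\<close>; for rank \<open>-1\<close> the two solutions would have
  the same place in the enumeration of a countable set.
\<close>

lemma NPr_combinatorial:
  fixes \<epsilon> :: "'o::{wellorder,no_top}" and U :: "'a set"
  assumes "NPr \<epsilon> U"
  obtains X :: "'a set" and r :: "'a set \<Rightarrow> 'o" and xs :: "'a set \<Rightarrow> 'a list"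
    and k code :: "'a set \<Rightarrow> nat"
  where "X \<subseteq> U" "countable (U - X)"
    and "\<And>w. w \<in> fin_ne X \<Longrightarrow> r w \<le> \<epsilon>"
    and "\<And>u w. u \<noteq> {} \<Longrightarrow> u \<subseteq> w \<Longrightarrow> w \<in> fin_ne X \<Longrightarrow> r w \<le> r u"
    and "\<And>a. a \<in> X \<Longrightarrow> ozero < r {a}"
    and "\<And>w. w \<in> fin_ne X \<Longrightarrow> distinct (xs w) \<and> set (xs w) = w \<and> k w < length (xs w)"
    and "\<And>w w' b. w \<in> fin_ne X \<Longrightarrow> b \<in> X - w \<Longrightarrow> w' = w - {xs w ! k w} \<union> {b} \<Longrightarrow>
      xs w' = (xs w)[k w := b] \<Longrightarrow> k w' = k w \<Longrightarrow> code w' = code w \<Longrightarrow> r (w \<union> {b}) \<noteq> r w"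
proof -
  obtain M :: "'a model" where M: "\<forall>w \<in> fin_ne U. one_plus_rank_le (rk U M w) \<epsilon>"
    using assms unfolding NPr_def by blast
  define X where "X = {a \<in> U. rk_ge U M {a} (ozero :: 'o)}"
  define r :: "'a set \<Rightarrow> 'o" where "r = rank1 U M"
  define wit where "wit w = (SOME t. rank_fail U M TYPE('o) w t)" for w
  define xs where "xs w = fst (wit w)" for w
  define \<phi> where "\<phi> w = fst (snd (wit w))" for w
  define k where "k w = snd (snd (wit w))" for w
  define C where "C w = {\<alpha> \<in> U. sat M ((xs w)[k w := \<alpha>]) (\<phi> w)}" for w
  define code where "code w = to_nat (\<phi> w, to_nat_on (C w) (xs w ! k w))" for w
  have sub: "X \<subseteq> U" by (auto simp: X_def)
  then have fin: "w \<in> fin_ne U" if "w \<in> fin_ne X" for w using that by (auto simp: fin_ne_def)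
  have wit: "rank_fail U M TYPE('o) w (xs w, \<phi> w, k w)" if "w \<in> fin_ne X" for w
    using someI_ex[OF rank_fail_exists[OF M fin[OF that]]]
    by (simp add: xs_def \<phi>_def k_def wit_def)
  have cnt: "countable (U - X)"
    using countable_rank_negative_singletons[of U M, where 'b = 'o]
    by (rule back_subst[of countable]) (auto simp: X_def)
  show ?thesis
  proof (rule that[OF sub cnt])
    show "r w \<le> \<epsilon>" if "w \<in> fin_ne X" for w
      by (rule rank1_cases[OF M fin[OF that]]) (auto simp: r_def ozero_le)
    show "r w \<le> r u" if "u \<noteq> {}" "u \<subseteq> w" "w \<in> fin_ne X" for u w
      unfolding r_def using rank1_antimono[OF M that(1,2) fin[OF that(3)]] .
    show "ozero < r {a}" if "a \<in> X" for a
      using that one_plus_pos by (simp add: r_def rank1_def X_def)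
    show "distinct (xs w) \<and> set (xs w) = w \<and> k w < length (xs w)" if "w \<in> fin_ne X" for w
      using wit[OF that] by (simp add: rank_fail_def)
    show "r (w \<union> {b}) \<noteq> r w"
      if w: "w \<in> fin_ne X" and b: "b \<in> X - w" and w': "w' = w - {xs w ! k w} \<union> {b}"
        and eq: "xs w' = (xs w)[k w := b]" "k w' = k w" "code w' = code w" for w w' b
    proof
      assume rb: "r (w \<union> {b}) = r w"
      have w'X: "w' \<in> fin_ne X" using w b w' by (auto simp: fin_ne_def)
      have k: "k w < length (xs w)" "set (xs w) = w" using wit[OF w] by (auto simp: rank_fail_def)
      have "\<phi> w' = \<phi> w" and idx: "to_nat_on (C w') (xs w' ! k w') = to_nat_on (C w) (xs w ! k w)"
        using eq(3) by (auto simp: code_def)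
      then have satb: "sat M ((xs w)[k w := b]) (\<phi> w)" and "C w' = C w"
        using wit[OF w'X] eq by (auto simp: rank_fail_def C_def)
      show False
      proof (cases "r w = ozero")
        case True
        then have "countable (C w)" using wit[OF w] by (simp add: rank_fail_def r_def C_def)
        moreover have "b \<in> C w" using satb b sub by (auto simp: C_def)
        moreover have "xs w ! k w \<in> C w"
          using wit[OF w] fin[OF w] k nth_mem[OF k(1)] by (auto simp: C_def rank_fail_def fin_ne_def)
        ultimately have "b = xs w ! k w"
          using idx \<open>C w' = C w\<close> eq k by (auto simp: inj_on_eq_iff[OF inj_on_to_nat_on])
        then show False using b nth_mem[OF k(1)] k(2) by auto
      next
        case False
        then show False
          using wit[OF w] b sub rb satb by (auto simp: rank_fail_def r_def)
      qed
    qed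
  qed
qed

section \<open>Positions in finite sets\<close>

lemma finite_below: "finite w \<Longrightarrow> finite (below w a)"
  by (simp add: below_def)

lemma below_eqI:
  assumes w: "finite w" and c: "card (below w a) = card (below w b)"
  shows "below w a = below w b"
proof (cases "a \<le> b")
  case True
  then have "below w a \<subseteq> below w b" by (auto simp: below_def)
  then show ?thesis using card_subset_eq[OF finite_below[OF w]] c by blast
next
  case False
  then have "below w b \<subseteq> below w a" by (auto simp: below_def)
  then show ?thesis using card_subset_eq[OF finite_below[OF w]] c by metis
qed

lemma below_inject:
  assumes "finite w" "card (below w a) = card (below w b)" "a \<in> w" "b \<in> w"
  shows "a = b"
  using below_eqI[OF assms(1,2)] assms(3,4)
  by (metis (no_types, lifting) below_def linorder_neqE mem_Collect_eq order_less_irrefl)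

lemma card_below_less: "finite w \<Longrightarrow> a \<in> w \<Longrightarrow> card (below w a) < card w"
  by (rule psubset_card_mono) (auto simp: below_def)

lemma card_below_nth:
  assumes "finite w" "k < card w"
  shows "sorted_list_of_set w ! k \<in> w \<and> card (below w (sorted_list_of_set w ! k)) = k"
proof -
  let ?l = "sorted_list_of_set w"
  have l: "sorted_wrt (<) ?l" "set ?l = w" "length ?l = card w"
    using assms by auto
  have "below w (?l ! k) = (!) ?l ` {..<k}"
  proof
    show "(!) ?l ` {..<k} \<subseteq> below w (?l ! k)"
    proof safe
      fix i assume "i < k"
      then have "?l ! i < ?l ! k" using sorted_wrt_nth_less[OF l(1)] l(3) assms(2) by simp
      moreover have "?l ! i \<in> w" using nth_mem[of i ?l] l \<open>i < k\<close> assms(2) by simp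
      ultimately show "?l ! i \<in> below w (?l ! k)" by (simp add: below_def)
    qed
    show "below w (?l ! k) \<subseteq> (!) ?l ` {..<k}"
    proof
      fix x assume x: "x \<in> below w (?l ! k)"
      then have "x \<in> set ?l" using l(2) by (simp add: below_def)
      then obtain i where i: "i < card w" "x = ?l ! i"
        unfolding in_set_conv_nth l(3) by blast
      have "\<not> k < i" using sorted_wrt_nth_less[OF l(1), of k i] x i l(3) by (auto simp: below_def)
      moreover have "i \<noteq> k" using x i by (auto simp: below_def)
      ultimately show "x \<in> (!) ?l ` {..<k}" using i by auto
    qed
  qed
  moreover have "inj_on ((!) ?l) {..<k}"
    using l assms by (auto intro!: inj_on_nth)
  ultimately show ?thesis using l assms by (metis card_image card_lessThan nth_mem)
qed

lemma nth_card_below: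
  assumes "finite w" "a \<in> w"
  shows "sorted_list_of_set w ! card (below w a) = a"
  using card_below_nth[OF assms(1) card_below_less[OF assms]] below_inject[OF assms(1) _ _ assms(2)]
  by blast

text \<open>
  Elements of the same position over \<open>w\<close> lie in the same cut of \<open>w - {a}\<close>, so that exchanging them
  does not move any other element.
\<close>

lemma card_below_exchange:
  assumes w: "finite w" "a \<in> w" "b \<notin> w" and pos: "card (below w b) = card (below w a)"
    and w': "w' = w - {a} \<union> {b}"
  shows "card (below w' b) = card (below w a)"
    and "x \<in> w \<Longrightarrow> x \<noteq> a \<Longrightarrow> card (below w' x) = card (below w x)"
proof -
  have lt: "y < b \<longleftrightarrow> y < a" if "y \<in> w" for y
  proof -
    have "y \<in> below w b \<longleftrightarrow> y \<in> below w a"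
      by (simp only: below_eqI[OF w(1) pos])
    then show ?thesis using that by (simp add: below_def)
  qed
  have "below w' b = below w a"
  proof (rule set_eqI)
    fix y show "y \<in> below w' b \<longleftrightarrow> y \<in> below w a"
      using lt[of y] unfolding below_def w' by (cases "y \<in> w") auto
  qed
  then show "card (below w' b) = card (below w a)" by simp
  assume x: "x \<in> w" "x \<noteq> a"
  have "x \<noteq> b" using x w by auto
  show "card (below w' x) = card (below w x)"
  proof (cases "x < a")
    case True
    then have "\<not> a < x" "\<not> b < x" using lt[OF x(1)] by auto
    then have "below w' x = below w x" unfolding below_def w' by auto
    then show ?thesis by simp
  next
    case False
    then have ax: "a < x" and bx: "b < x" using x lt[OF x(1)] \<open>x \<noteq> b\<close> by auto
    have "below w' x = insert b (below w x - {a})"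
      unfolding below_def w' using bx by auto
    moreover have "a \<in> below w x" "b \<notin> below w x - {a}"
      using w(2,3) ax by (simp_all add: below_def)
    ultimately show ?thesis
      using finite_below[OF w(1), of x] by (simp add: card_Suc_Diff1 del: card_Diff_insert)
  qed
qed

section \<open>Systems from an exchange property\<close>

text \<open>
  The positions of the entries of \<open>xs w\<close> in \<open>w\<close> are coded into \<open>j\<close>.  Since positions in a finite set
  determine its elements, equality of \<open>j\<close> on two sets that differ by exchanging elements of equal
  position means that their enumerations differ by that replacement only, which is the situation of
  the exchange property.
\<close>

lemma yzr_system_of_exchange:
  fixes X :: "'x::wellorder set" and r :: "'x set \<Rightarrow> 'o::{wellorder,no_top}"
    and xs :: "'x set \<Rightarrow> 'x list" and k code :: "'x set \<Rightarrow> nat"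
  assumes "X \<noteq> {}"
    and "\<And>w. w \<in> fin_ne X \<Longrightarrow> r w \<le> \<epsilon>"
    and "\<And>u w. u \<noteq> {} \<Longrightarrow> u \<subseteq> w \<Longrightarrow> w \<in> fin_ne X \<Longrightarrow> r w \<le> r u"
    and "\<And>a. a \<in> X \<Longrightarrow> ozero < r {a}"
    and xs: "\<And>w. w \<in> fin_ne X \<Longrightarrow> distinct (xs w) \<and> set (xs w) = w \<and> k w < length (xs w)"
    and exch: "\<And>w w' b. w \<in> fin_ne X \<Longrightarrow> b \<in> X - w \<Longrightarrow> w' = w - {xs w ! k w} \<union> {b} \<Longrightarrow>
      xs w' = (xs w)[k w := b] \<Longrightarrow> k w' = k w \<Longrightarrow> code w' = code w \<Longrightarrow> r (w \<union> {b}) \<noteq> r w"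
  shows "yzr_system \<epsilon> \<lparr>yX = X, yr = r,
    yj = (\<lambda>w. to_nat (code w, k w, map (\<lambda>x. card (below w x)) (xs w))),
    yk = (\<lambda>w. card (below w (xs w ! k w)))\<rparr>"
proof -
  let ?j = "\<lambda>w. to_nat (code w, k w, map (\<lambda>x. card (below w x)) (xs w))"
  let ?k = "\<lambda>w. card (below w (xs w ! k w))"
  have key: "?k w < card w \<and>
      \<not> (\<exists>b \<in> X - w. card (below w b) = ?k w \<and>
         ?j ((w - {sorted_list_of_set w ! ?k w}) \<union> {b}) = ?j w \<and> r (w \<union> {b}) = r w)"
    if w: "w \<in> fin_ne X" for w
  proof (intro conjI notI)
    define a where "a = xs w ! k w"
    note xw = xs[OF w, THEN conjunct1] xs[OF w, THEN conjunct2, THEN conjunct1]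
      xs[OF w, THEN conjunct2, THEN conjunct2]
    have a: "a \<in> w" unfolding a_def by (rule subst[OF xw(2), of "\<lambda>A. _ \<in> A", OF nth_mem[OF xw(3)]])
    have fin: "finite w" using w by (simp add: fin_ne_def)
    show "?k w < card w" using card_below_less[OF fin a] by (simp add: a_def)
    have nth: "sorted_list_of_set w ! ?k w = a" using nth_card_below[OF fin a] by (simp add: a_def)
    assume "\<exists>b \<in> X - w. card (below w b) = ?k w \<and>
         ?j ((w - {sorted_list_of_set w ! ?k w}) \<union> {b}) = ?j w \<and> r (w \<union> {b}) = r w"
    then obtain b where b: "b \<in> X - w" "card (below w b) = card (below w a)"
      "?j (w - {a} \<union> {b}) = ?j w" "r (w \<union> {b}) = r w"
      unfolding nth a_def by blast
    define w' where "w' = w - {a} \<union> {b}"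
    have j: "code w' = code w" "k w' = k w"
      "map (\<lambda>x. card (below w' x)) (xs w') = map (\<lambda>x. card (below w x)) (xs w)"
      using b(3) unfolding w'_def[symmetric] by (simp_all only: to_nat_split prod.inject)
    have fw': "w' \<in> fin_ne X" using w b by (auto simp: fin_ne_def w'_def)
    note pos = card_below_exchange[OF fin a _ b(2) w'_def]
    have other: "xs w ! i \<noteq> a \<and> xs w ! i \<in> w" if "i < length (xs w)" "i \<noteq> k w" for i
      using nth_eq_iff_index_eq[OF xw(1) that(1) xw(3)] that(2) nth_mem[OF that(1)]
      unfolding a_def xw(2) by blast
    have xseq: "xs w' = (xs w)[k w := b]"
    proof (rule nth_equalityI)
      show len: "length (xs w') = length ((xs w)[k w := b])"
        using arg_cong[OF j(3), of length] by simp
      fix i assume i: "i < length (xs w')"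
      have "card (below w' (xs w' ! i)) = card (below w (xs w ! i))"
        using arg_cong[OF j(3), of "\<lambda>l. l ! i"] i len by simp
      also have "\<dots> = card (below w' ((xs w)[k w := b] ! i))"
      proof (cases "i = k w")
        case True
        then have "(xs w)[k w := b] ! i = b" "xs w ! i = a" using i len by (simp_all add: a_def)
        then show ?thesis using pos(1) b(1) by simp
      next
        case False
        then have "xs w ! i \<noteq> a" "xs w ! i \<in> w" using other i len by simp_all
        moreover have "(xs w)[k w := b] ! i = xs w ! i" using False by simp
        ultimately show ?thesis using pos(2)[of "xs w ! i"] b(1) by simp
      qed
      finally show "xs w' ! i = (xs w)[k w := b] ! i"
      proof (rule below_inject[rotated])
        show "finite w'" using fw' by (simp add: fin_ne_def)
        show "xs w' ! i \<in> w'" using nth_mem[OF i] unfolding xs[OF fw', THEN conjunct2, THEN conjunct1] .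
        show "(xs w)[k w := b] ! i \<in> w'"
        proof (cases "i = k w")
          case True
          then show ?thesis using i len by (simp add: w'_def)
        next
          case False
          then have "xs w ! i \<noteq> a" "xs w ! i \<in> w" using other i len by simp_all
          then show ?thesis using False by (simp add: w'_def)
        qed
      qed
    qed
    have "r (w \<union> {b}) \<noteq> r w"
      by (rule exch[OF w b(1) _ xseq j(2,1)]) (simp only: w'_def a_def)
    then show False using b(4) by (rule notE)
  qed
  then have "\<forall>w \<in> fin_ne X. ?k w < card w \<and>
      \<not> (\<exists>b \<in> X - w. card (below w b) = ?k w \<and>
         ?j ((w - {sorted_list_of_set w ! ?k w}) \<union> {b}) = ?j w \<and> r (w \<union> {b}) = r w)"
    by (rule ballI)
  moreover have "\<forall>w \<in> fin_ne X. r w \<le> \<epsilon>"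
    by (intro ballI assms(2))
  moreover have "\<forall>a \<in> X. ozero < r {a}"
    by (intro ballI assms(4))
  moreover have "\<forall>u w. u \<noteq> {} \<and> u \<subseteq> w \<and> w \<in> fin_ne X \<longrightarrow> r w \<le> r u"
    by (intro allI impI; elim conjE; rule assms(3))
  ultimately show ?thesis
    unfolding yzr_system_def yzr.select_convs using assms(1) by (intro conjI)
qed


section \<open>Well-ordering an arbitrary type\<close>

definition some_wo :: "'a rel" where
  "some_wo = (SOME r. well_order_on UNIV r)"

lemma some_wo: "well_order_on UNIV (some_wo :: 'a rel)"
  unfolding some_wo_def using well_order_on by (rule someI_ex)

lemma some_wo_lin: "refl (some_wo :: 'a rel)" "trans (some_wo :: 'a rel)"
  "antisym (some_wo :: 'a rel)" "total (some_wo :: 'a rel)" "wf (some_wo - Id :: 'a rel)"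
  using some_wo[where 'a = 'a] unfolding order_on_defs by simp_all

lemma some_wo_total: "(a, b) \<in> some_wo \<or> (b, a) \<in> some_wo"
  using reflD[OF some_wo_lin(1)] some_wo_lin(4) unfolding total_on_def by (metis UNIV_I)

text \<open>
  YZR-systems need a carrier of class \<open>wellorder\<close>.  A copy of the type, ordered by some well-order,
  provides one for the elements of the cardinal.
\<close>

datatype 'a wo = Wo (unWo: 'a)

instantiation wo :: (type) wellorder
begin

definition less_eq_wo :: "'a wo \<Rightarrow> 'a wo \<Rightarrow> bool" where
  "less_eq_wo x y \<longleftrightarrow> (unWo x, unWo y) \<in> some_wo"

definition less_wo :: "'a wo \<Rightarrow> 'a wo \<Rightarrow> bool" where
  "less_wo x y \<longleftrightarrow> (unWo x, unWo y) \<in> some_wo - Id"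

instance
proof
  fix x y z :: "'a wo"
  show "(x < y) = (x \<le> y \<and> \<not> y \<le> x)"
    using reflD[OF some_wo_lin(1), of "unWo x"] antisymD[OF some_wo_lin(3), of "unWo x" "unWo y"]
    unfolding less_wo_def less_eq_wo_def by auto
  show "x \<le> x" unfolding less_eq_wo_def by (rule reflD[OF some_wo_lin(1)])
  show "x \<le> y \<or> y \<le> x" unfolding less_eq_wo_def by (rule some_wo_total)
  show "x \<le> z" if "x \<le> y" "y \<le> z"
    using that transD[OF some_wo_lin(2), of "unWo x" "unWo y" "unWo z"]
    unfolding less_eq_wo_def by simp
  show "x = y" if "x \<le> y" "y \<le> x"
    using that antisymD[OF some_wo_lin(3), of "unWo x" "unWo y"] unfolding less_eq_wo_def
    by (intro wo.expand) simp
next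
  fix P and a :: "'a wo"
  assume *: "\<And>x. (\<And>y. y < x \<Longrightarrow> P y) \<Longrightarrow> P (x :: 'a wo)"
  have "P (Wo x)" for x
    using some_wo_lin(5)
  proof (induction x rule: wf_induct_rule)
    case (less x)
    have "P y" if "y < Wo x" for y
      using less[of "unWo y"] that unfolding less_wo_def by simp
    then show ?case by (rule *)
  qed
  from this[of "unWo a"] show "P a" by simp
qed

end

section \<open>Systems from models\<close>

text \<open>
  The carrier omits the countably many points of negative rank, because \<open>r\<close> has to be positive on
  singletons.
\<close>

lemma yzr_system_of_NPr:
  fixes U :: "'a set" and \<epsilon> :: "'o::{wellorder,no_top}"
  assumes "NPr \<epsilon> U" "uncountable U"
  obtains s :: "('a wo, 'o) yzr"
  where "yzr_system \<epsilon> s" "yX s \<subseteq> Wo ` U" "countable (Wo ` U - yX s)"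
proof (rule NPr_combinatorial[OF assms(1)])
  fix X :: "'a set" and r :: "'a set \<Rightarrow> 'o" and xs :: "'a set \<Rightarrow> 'a list"
    and k code :: "'a set \<Rightarrow> nat"
  assume X: "X \<subseteq> U" "countable (U - X)"
    and r: "\<And>w. w \<in> fin_ne X \<Longrightarrow> r w \<le> \<epsilon>"
      "\<And>u w. u \<noteq> {} \<Longrightarrow> u \<subseteq> w \<Longrightarrow> w \<in> fin_ne X \<Longrightarrow> r w \<le> r u"
      "\<And>a. a \<in> X \<Longrightarrow> ozero < r {a}"
    and xs: "\<And>w. w \<in> fin_ne X \<Longrightarrow> distinct (xs w) \<and> set (xs w) = w \<and> k w < length (xs w)"
    and exch: "\<And>w w' b. w \<in> fin_ne X \<Longrightarrow> b \<in> X - w \<Longrightarrow> w' = w - {xs w ! k w} \<union> {b} \<Longrightarrow>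
      xs w' = (xs w)[k w := b] \<Longrightarrow> k w' = k w \<Longrightarrow> code w' = code w \<Longrightarrow> r (w \<union> {b}) \<noteq> r w"
  have inj: "inj unWo" by (simp add: inj_def wo.expand)
  have Wo_unWo: "Wo ` unWo ` w = w" for w :: "'a wo set" by (simp add: image_image)
  have fin: "unWo ` w \<in> fin_ne X" if "w \<in> fin_ne (Wo ` X)" for w
    using that by (auto simp: fin_ne_def)
  let ?xs = "\<lambda>w. map Wo (xs (unWo ` w))"
  have "yzr_system \<epsilon> \<lparr>yX = Wo ` X, yr = (\<lambda>w. r (unWo ` w)),
    yj = (\<lambda>w. to_nat (code (unWo ` w), k (unWo ` w), map (\<lambda>x. card (below w x)) (?xs w))),
    yk = (\<lambda>w. card (below w (?xs w ! k (unWo ` w))))\<rparr>"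
  proof (rule yzr_system_of_exchange)
    have "X \<noteq> {}" using assms(2) X by auto
    then show "Wo ` X \<noteq> {}" by simp
    show "r (unWo ` w) \<le> \<epsilon>" if "w \<in> fin_ne (Wo ` X)" for w
      using r(1)[OF fin[OF that]] .
    show "r (unWo ` w) \<le> r (unWo ` u)" if "u \<noteq> {}" "u \<subseteq> w" "w \<in> fin_ne (Wo ` X)" for u w
      using r(2)[OF _ _ fin[OF that(3)]] that(1,2) by (simp add: image_mono)
    show "ozero < r (unWo ` {a})" if "a \<in> Wo ` X" for a
      using r(3) that by auto
    show "distinct (?xs w) \<and> set (?xs w) = w \<and> k (unWo ` w) < length (?xs w)"
      if "w \<in> fin_ne (Wo ` X)" for w
      using xs[OF fin[OF that]] Wo_unWo[of w] by (simp add: distinct_map inj_on_def)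
    show "r (unWo ` (w \<union> {b})) \<noteq> r (unWo ` w)"
      if w: "w \<in> fin_ne (Wo ` X)" and b: "b \<in> Wo ` X - w"
        and w': "w' = w - {?xs w ! k (unWo ` w)} \<union> {b}" and eq: "?xs w' = (?xs w)[k (unWo ` w) := b]"
        "k (unWo ` w') = k (unWo ` w)" "code (unWo ` w') = code (unWo ` w)" for w w' b
    proof -
      have "?xs w ! k (unWo ` w) = Wo (xs (unWo ` w) ! k (unWo ` w))"
        using xs[OF fin[OF w]] by simp
      then have "unWo ` w' = unWo ` w - {xs (unWo ` w) ! k (unWo ` w)} \<union> {unWo b}"
        using w' by (simp add: image_set_diff[OF inj])
      moreover have "unWo b \<in> X - unWo ` w"
        using b by (auto simp: inj_image_mem_iff[OF inj])
      moreover have "xs (unWo ` w') = (xs (unWo ` w))[k (unWo ` w) := unWo b]"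
        using arg_cong[OF eq(1), of "map unWo"] by (simp add: map_update comp_def)
      ultimately show ?thesis
        using exch[OF fin[OF w] _ _ _ eq(2,3)] by simp
    qed
  qed
  then show ?thesis
  proof (rule that)
    have "Wo ` U - Wo ` X = Wo ` (U - X)" by (auto simp: image_iff)
    then show "countable (Wo ` U - yX \<lparr>yX = Wo ` X, yr = (\<lambda>w. r (unWo ` w)),
      yj = (\<lambda>w. to_nat (code (unWo ` w), k (unWo ` w), map (\<lambda>x. card (below w x)) (?xs w))),
      yk = (\<lambda>w. card (below w (?xs w ! k (unWo ` w))))\<rparr>)"
      using X(2) by simp
  qed (use X(1) in auto)
qed

lemma yzr_systemD:
  assumes "yzr_system \<epsilon> s"
  shows "yX s \<noteq> {}" "w \<in> fin_ne (yX s) \<Longrightarrow> yr s w \<le> \<epsilon>"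
    "u \<noteq> {} \<Longrightarrow> u \<subseteq> w \<Longrightarrow> w \<in> fin_ne (yX s) \<Longrightarrow> yr s w \<le> yr s u"
    "a \<in> yX s \<Longrightarrow> ozero < yr s {a}"
    "w \<in> fin_ne (yX s) \<Longrightarrow> yk s w < card w"
    "w \<in> fin_ne (yX s) \<Longrightarrow> b \<in> yX s - w \<Longrightarrow> card (below w b) = yk s w \<Longrightarrow>
      yj s (w - {sorted_list_of_set w ! yk s w} \<union> {b}) = yj s w \<Longrightarrow> yr s (w \<union> {b}) \<noteq> yr s w"
proof -
  note * = assms[unfolded yzr_system_def]
  note 5 = *[THEN conjunct2, THEN conjunct2, THEN conjunct2, THEN conjunct2, THEN bspec]
  show "yX s \<noteq> {}" using * by (rule conjunct1)
  show "w \<in> fin_ne (yX s) \<Longrightarrow> yr s w \<le> \<epsilon>"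
    using *[THEN conjunct2, THEN conjunct1] by (rule bspec)
  show "u \<noteq> {} \<Longrightarrow> u \<subseteq> w \<Longrightarrow> w \<in> fin_ne (yX s) \<Longrightarrow> yr s w \<le> yr s u"
    using *[THEN conjunct2, THEN conjunct2, THEN conjunct1] by blast
  show "a \<in> yX s \<Longrightarrow> ozero < yr s {a}"
    using *[THEN conjunct2, THEN conjunct2, THEN conjunct2, THEN conjunct1] by (rule bspec)
  show "w \<in> fin_ne (yX s) \<Longrightarrow> yk s w < card w" using 5 by (rule conjunct1)
  show "w \<in> fin_ne (yX s) \<Longrightarrow> b \<in> yX s - w \<Longrightarrow> card (below w b) = yk s w \<Longrightarrow>
      yj s (w - {sorted_list_of_set w ! yk s w} \<union> {b}) = yj s w \<Longrightarrow> yr s (w \<union> {b}) \<noteq> yr s w"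
    using 5[THEN conjunct2, of w] by blast
qed

section \<open>Quasi-embeddings\<close>

lemma yzr_restrict_sel [simp]:
  "yX (yzr_restrict s w) = w" "yr (yzr_restrict s w) = yr s"
  "yj (yzr_restrict s w) = yj s" "yk (yzr_restrict s w) = yk s"
  by (simp_all add: yzr_restrict_def)

lemma fin_ne_image: "v \<in> fin_ne A \<Longrightarrow> f ` A \<subseteq> B \<Longrightarrow> f ` v \<in> fin_ne B"
  by (auto simp: fin_ne_def)

lemma fin_ne_image_ex: "v \<in> fin_ne (f ` A) \<Longrightarrow> \<exists>u \<in> fin_ne A. v = f ` u"
  unfolding fin_ne_def using finite_subset_image[of v f A] by blast

lemma quasi_embeddingD:
  assumes "quasi_embedding q s \<phi>"
  shows "strict_mono_on (yX q) \<phi>" "inj_on \<phi> (yX q)" "\<phi> ` yX q \<subseteq> yX s"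
    "v \<in> fin_ne (yX q) \<Longrightarrow> yr s (\<phi> ` v) = yr q v"
    "v \<in> fin_ne (yX q) \<Longrightarrow> yk s (\<phi> ` v) = yk q v"
    "v \<in> fin_ne (yX q) \<Longrightarrow> ozero < yr q v \<Longrightarrow> yj s (\<phi> ` v) = yj q v"
  using assms by (auto simp: quasi_embedding_def intro: strict_mono_on_imp_inj_on)

lemma quasi_embedding_comp:
  assumes "quasi_embedding q s \<phi>" "quasi_embedding s t \<psi>"
  shows "quasi_embedding q t (\<psi> \<circ> \<phi>)"
proof -
  note 1 = quasi_embeddingD[OF assms(1)] and 2 = quasi_embeddingD[OF assms(2)]
  have "strict_mono_on (yX q) (\<psi> \<circ> \<phi>)"
    using 1(1,3) 2(1) by (auto simp: strict_mono_on_def image_subset_iff)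
  moreover have "(\<psi> \<circ> \<phi>) ` yX q \<subseteq> yX t" using 1(3) 2(3) by auto
  moreover have "yr t ((\<psi> \<circ> \<phi>) ` v) = yr q v \<and> yk t ((\<psi> \<circ> \<phi>) ` v) = yk q v \<and>
      (ozero < yr q v \<longrightarrow> yj t ((\<psi> \<circ> \<phi>) ` v) = yj q v)" if "v \<in> fin_ne (yX q)" for v
    using 1(4-6)[OF that] 2(4-6)[OF fin_ne_image[OF that 1(3)]] by (simp add: image_comp)
  ultimately show ?thesis unfolding quasi_embedding_def by blast
qed

lemma quasi_embedding_restrict_dom:
  assumes "quasi_embedding s t \<phi>" "w \<subseteq> yX s"
  shows "quasi_embedding (yzr_restrict s w) t \<phi>"
proof -
  note 1 = quasi_embeddingD[OF assms(1)]
  have fin: "v \<in> fin_ne (yX s)" if "v \<in> fin_ne w" for v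
    using that assms(2) by (auto simp: fin_ne_def)
  have "strict_mono_on w \<phi>" using 1(1) assms(2) by (rule monotone_on_subset)
  moreover have "\<phi> ` w \<subseteq> yX t" using 1(3) assms(2) by blast
  ultimately show ?thesis
    unfolding quasi_embedding_def yzr_restrict_sel
    by (intro conjI ballI impI) (use 1(4-6) fin in simp_all)
qed

lemma quasi_embedding_restrict_ran:
  assumes "quasi_embedding q s \<phi>" "\<phi> ` yX q \<subseteq> w"
  shows "quasi_embedding q (yzr_restrict s w) \<phi>"
  using assms unfolding quasi_embedding_def by simp

lemma quasi_embedding_cong:
  assumes "quasi_embedding q s \<phi>" "\<And>a. a \<in> yX q \<Longrightarrow> \<psi> a = \<phi> a"
  shows "quasi_embedding q s \<psi>"
proof -
  have "\<psi> ` v = \<phi> ` v" if "v \<subseteq> yX q" for v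
    using assms(2) that by (intro image_cong) auto
  then show ?thesis
    using assms unfolding quasi_embedding_def strict_mono_on_def fin_ne_def by simp
qed

text \<open>
  A quasi-embedding may change \<open>j\<close> on sets with \<open>r = 0\<close> only, and it preserves \<open>r\<close>; hence its inverse
  has the same property.
\<close>

lemma quasi_embedding_inverse:
  assumes "quasi_embedding q s \<phi>"
  shows "quasi_embedding (yzr_restrict s (\<phi> ` yX q)) q (inv_into (yX q) \<phi>)"
proof -
  note 1 = quasi_embeddingD[OF assms]
  have inv: "inv_into (yX q) \<phi> (\<phi> a) = a" if "a \<in> yX q" for a
    using 1(2) that by simp
  have "strict_mono_on (\<phi> ` yX q) (inv_into (yX q) \<phi>)"
    using strict_mono_on_less[OF 1(1)] inv by (auto simp: strict_mono_on_def)
  moreover have "yr q (inv_into (yX q) \<phi> ` v) = yr s v \<and> yk q (inv_into (yX q) \<phi> ` v) = yk s v \<and>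
      (ozero < yr s v \<longrightarrow> yj q (inv_into (yX q) \<phi> ` v) = yj s v)"
    if v: "v \<in> fin_ne (\<phi> ` yX q)" for v
  proof -
    obtain u where u: "u \<in> fin_ne (yX q)" "v = \<phi> ` u" using fin_ne_image_ex[OF v] by blast
    have "inv_into (yX q) \<phi> ` v = u" 
      using 1(2) u(1) unfolding u(2) by (simp add: fin_ne_def)
    then show ?thesis using 1(4-6)[OF u(1)] u(2) by simp
  qed
  ultimately show ?thesis
    unfolding quasi_embedding_def by (simp add: image_image inv)
qed

lemma quasi_embedding_id: "w \<subseteq> yX s \<Longrightarrow> quasi_embedding (yzr_restrict s w) s (\<lambda>a. a)"
  by (auto simp: quasi_embedding_def strict_mono_on_def)

section \<open>Finite systems embed in cute systems\<close>

lemma card_below_image: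
  assumes "strict_mono_on w e" "v \<subseteq> w" "b \<in> w"
  shows "card (below (e ` v) (e b)) = card (below v b)"
proof -
  have "below (e ` v) (e b) = e ` below v b"
    using strict_mono_on_less[OF assms(1) _ assms(3)] assms(2) by (auto simp: below_def)
  moreover have "inj_on e (below v b)"
    using strict_mono_on_imp_inj_on[OF assms(1)] by (rule inj_on_subset) (use assms(2) in \<open>auto simp: below_def\<close>)
  ultimately show ?thesis by (simp add: card_image)
qed

text \<open>
  Cuteness refers to finite systems of ordinals in the type of the values of \<open>r\<close>.  Finite systems over
  any other well-order can be moved there along a strictly increasing map.
\<close>

lemma yzr_system_transport:
  fixes s :: "('x::wellorder, 'o::{wellorder,no_top}) yzr" and e :: "'x \<Rightarrow> 'y::wellorder"
  assumes s: "yzr_system \<epsilon> s" and w: "w \<subseteq> yX s" "w \<noteq> {}" and e: "strict_mono_on w e"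
  defines "q \<equiv> \<lparr>yX = e ` w, yr = (\<lambda>v. yr s (inv_into w e ` v)), yj = (\<lambda>v. yj s (inv_into w e ` v)),
    yk = (\<lambda>v. yk s (inv_into w e ` v))\<rparr>"
  shows "yzr_system \<epsilon> q" "quasi_embedding (yzr_restrict s w) q e"
proof -
  have inj: "inj_on e w" by (rule strict_mono_on_imp_inj_on[OF e])
  have inv: "inv_into w e ` e ` v = v" if "v \<subseteq> w" for v
    using that inj by simp
  have sub: "v \<in> fin_ne (yX s)" if "v \<in> fin_ne w" for v using that w by (auto simp: fin_ne_def)
  show "quasi_embedding (yzr_restrict s w) q e"
    unfolding quasi_embedding_def q_def using e inv by (auto simp: fin_ne_def)
  have "yr q v \<le> \<epsilon>" if v: "v \<in> fin_ne (e ` w)" for v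
  proof -
    obtain u where u: "u \<in> fin_ne w" "v = e ` u" using fin_ne_image_ex[OF v] by blast
    then show ?thesis using inv[of u] yzr_systemD(2)[OF s sub[OF u(1)]] by (simp add: q_def fin_ne_def)
  qed
  moreover have "yr q v \<le> yr q u" if "u \<noteq> {} \<and> u \<subseteq> v \<and> v \<in> fin_ne (e ` w)" for u v
  proof -
    have "inv_into w e ` v \<in> fin_ne w"
      using that inv_into_into[of _ e w] by (intro fin_ne_image[of v "e ` w"]) auto
    then have "yr s (inv_into w e ` v) \<le> yr s (inv_into w e ` u)"
      using sub that by (intro yzr_systemD(3)[OF s]) auto
    then show ?thesis by (simp add: q_def)
  qed
  moreover have "ozero < yr q {a}" if "a \<in> e ` w" for a
    using yzr_systemD(4)[OF s] that w inj by (auto simp: q_def)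
  moreover have "yk q v < card v \<and>
      \<not> (\<exists>b \<in> e ` w - v. card (below v b) = yk q v \<and>
        yj q ((v - {sorted_list_of_set v ! yk q v}) \<union> {b}) = yj q v \<and>
        yr q (v \<union> {b}) = yr q v)" if v: "v \<in> fin_ne (e ` w)" for v
  proof -
    obtain u where u: "u \<in> fin_ne w" "v = e ` u" using fin_ne_image_ex[OF v] by blast
    have uw: "u \<subseteq> w" "finite u" using u(1) by (auto simp: fin_ne_def)
    have card: "card v = card u" using u(2) inj uw by (simp add: card_image inj_on_subset)
    have sel: "yr q (e ` z) = yr s z" "yj q (e ` z) = yj s z" "yk q (e ` z) = yk s z"
      if "z \<subseteq> w" for z using inv[OF that] by (simp_all add: q_def)
    have k: "yk s u < card u" using yzr_systemD(5)[OF s sub[OF u(1)]] .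
    define a where "a = sorted_list_of_set u ! yk s u"
    have a: "a \<in> u" "card (below u a) = yk s u"
      using card_below_nth[OF uw(2) k] by (simp_all add: a_def)
    then have "card (below v (e a)) = yk s u"
      using card_below_image[OF e uw(1)] uw(1) u(2) by auto
    then have nth: "sorted_list_of_set v ! yk s u = e a"
      using nth_card_below[of v "e a"] a u(2) uw(2) by simp
    show ?thesis
      unfolding u(2) sel(3)[OF uw(1)] nth[unfolded u(2)]
    proof (intro conjI notI)
      show "yk s u < card (e ` u)" using k card u(2) by simp
      assume "\<exists>b \<in> e ` w - e ` u. card (below (e ` u) b) = yk s u \<and>
        yj q ((e ` u - {e a}) \<union> {b}) = yj q (e ` u) \<and> yr q (e ` u \<union> {b}) = yr q (e ` u)"
      then obtain b where b: "b \<in> w" "b \<notin> u" "card (below (e ` u) (e b)) = yk s u"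
        "yj q ((e ` u - {e a}) \<union> {e b}) = yj q (e ` u)" "yr q (e ` u \<union> {e b}) = yr q (e ` u)"
        by blast
      have "(e ` u - {e a}) \<union> {e b} = e ` (u - {a} \<union> {b})" "e ` u \<union> {e b} = e ` (u \<union> {b})"
        using inj uw(1) a(1) by (auto simp: inj_on_def)
      moreover have z: "u - {a} \<union> {b} \<subseteq> w" "u \<union> {b} \<subseteq> w" using b(1) uw(1) by auto
      ultimately have "yj s (u - {a} \<union> {b}) = yj s u" "yr s (u \<union> {b}) = yr s u"
        using b(4,5) sel(2)[OF z(1)] sel(1)[OF z(2)] sel(1,2)[OF uw(1)] by simp_all
      moreover have "card (below u b) = yk s u"
        using b(3) card_below_image[OF e uw(1) b(1)] by simp
      moreover have "b \<in> yX s - u" using b(1,2) w by auto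
      ultimately show False
        using yzr_systemD(6)[OF s sub[OF u(1)], of b] by (simp only: a_def)
    qed
  qed
  moreover have X: "yX q = e ` w" by (simp add: q_def)
  ultimately show "yzr_system \<epsilon> q"
    unfolding yzr_system_def X using w(2) by (intro conjI ballI allI impI; simp only: image_is_empty; blast)
qed

lemma strict_mono_nat_ordinal:
  obtains f :: "nat \<Rightarrow> 'o::{wellorder,no_top}" where "strict_mono f"
proof
  show "strict_mono (\<lambda>n. (osucc ^^ n) (ozero :: 'o))"
    by (simp add: strict_mono_Suc_iff less_osucc)
qed

lemma cute_embeds_finite:
  fixes s :: "('x::wellorder, 'o::{wellorder,no_top}) yzr"
  assumes S: "cute \<epsilon> S" and s: "yzr_system \<epsilon> s" and w: "w \<in> fin_ne (yX s)"
  shows "\<exists>\<psi>. quasi_embedding (yzr_restrict s w) S \<psi>"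
proof -
  obtain f :: "nat \<Rightarrow> 'o" where f: "strict_mono f" by (rule strict_mono_nat_ordinal)
  define e where "e a = f (card (below w a))" for a
  have fin: "finite w" using w by (simp add: fin_ne_def)
  have "card (below w a) < card (below w b)" if "a \<in> w" "a < b" for a b
    using that by (intro psubset_card_mono finite_below[OF fin]) (auto simp: below_def)
  then have e: "strict_mono_on w e"
    using f by (auto simp: strict_mono_on_def e_def strict_mono_less)
  have wX: "w \<subseteq> yX s" "w \<noteq> {}" using w by (auto simp: fin_ne_def)
  note q = yzr_system_transport[OF s wX e]
  then obtain \<phi> where "quasi_embedding \<lparr>yX = e ` w, yr = (\<lambda>v. yr s (inv_into w e ` v)),
      yj = (\<lambda>v. yj s (inv_into w e ` v)), yk = (\<lambda>v. yk s (inv_into w e ` v))\<rparr> S \<phi>"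
    using S fin unfolding cute_def yzr_finite_def by (metis finite_imageI yzr.select_convs(1))
  then show ?thesis using quasi_embedding_comp[OF q(2)] by blast
qed

section \<open>Names for reals given by approximations\<close>

definition approximates :: "'p forcing \<Rightarrow> ('p \<Rightarrow> bit list) \<Rightarrow> bool" where
  "approximates Q A \<longleftrightarrow>
     (\<forall>p \<in> cond Q. \<forall>q \<in> cond Q. le Q q p \<longrightarrow> prefix (A p) (A q)) \<and>
     (\<forall>p \<in> cond Q. \<forall>N. \<exists>q \<in> cond Q. le Q q p \<and> N \<le> length (A q))"

text \<open>
  If \<open>A p\<close> is the part of an element of the Cantor space that is decided by the condition \<open>p\<close>, this is
  the name of the union of the \<open>A p\<close> with \<open>p\<close> in the generic filter.
\<close>

definition real_of :: "'p forcing \<Rightarrow> ('p \<Rightarrow> bit list) \<Rightarrow> 'p real_name" where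
  "real_of Q A = {((n, i), p). p \<in> cond Q \<and> n < length (A p) \<and> A p ! n = i}"

definition reals_of :: "'p forcing \<Rightarrow> ('x \<Rightarrow> 'p \<Rightarrow> bit list) \<Rightarrow> ('x \<times> nat \<times> bit, 'p) name" where
  "reals_of Q A = {((x, a), p). (a, p) \<in> real_of Q (A x)}"

lemma sect_reals_of [simp]: "sect (reals_of Q A) x = real_of Q (A x)"
  by (auto simp: sect_def reals_of_def)

lemma approximates_nth:
  assumes "approximates Q A" "p \<in> cond Q" "q \<in> cond Q" "le Q q p" "n < length (A p)"
  shows "n < length (A q)" "A q ! n = A p ! n"
proof -
  have "prefix (A p) (A q)" using assms by (auto simp: approximates_def)
  then show "n < length (A q)" "A q ! n = A p ! n"
    using assms(5) by (auto simp: prefix_def nth_append)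
qed

lemma approximates_long:
  assumes "approximates Q A" "p \<in> cond Q"
  obtains q where "q \<in> cond Q" "le Q q p" "N \<le> length (A q)"
  using assms unfolding approximates_def by blast

lemma forcing_refl: "forcing_notion Q \<Longrightarrow> p \<in> cond Q \<Longrightarrow> le Q p p"
  by (simp add: forcing_notion_def)

lemma forcing_trans:
  "forcing_notion Q \<Longrightarrow> p \<in> cond Q \<Longrightarrow> q \<in> cond Q \<Longrightarrow> r \<in> cond Q \<Longrightarrow>
    le Q p q \<Longrightarrow> le Q q r \<Longrightarrow> le Q p r"
  unfolding forcing_notion_def by blast

lemma f_exI: "forcing_notion Q \<Longrightarrow> x \<in> X \<Longrightarrow> (\<And>q. q \<in> cond Q \<Longrightarrow> \<phi> x Q q) \<Longrightarrow> f_ex X \<phi> Q p"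
  by (auto simp: f_ex_def dense_below_def intro: forcing_refl)

text \<open>
  A bit is forced as soon as no stronger condition decides it otherwise, since the conditions that
  decide it are dense.
\<close>

lemma f_mem_real_of:
  assumes Q: "forcing_notion Q" and A: "approximates Q A" and p: "p \<in> cond Q"
  shows "f_mem (n, i) (real_of Q A) Q p \<longleftrightarrow>
    (\<forall>q \<in> cond Q. le Q q p \<longrightarrow> n < length (A q) \<longrightarrow> A q ! n = i)"
proof (intro iffI ballI impI)
  fix q assume *: "f_mem (n, i) (real_of Q A) Q p" "q \<in> cond Q" "le Q q p" "n < length (A q)"
  then obtain q' r where q': "q' \<in> cond Q" "le Q q' q" "r \<in> cond Q" "le Q q' r"
    "n < length (A r)" "A r ! n = i"
    by (auto simp: f_mem_def dense_below_def real_of_def)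
  show "A q ! n = i"
    using approximates_nth(2)[OF A \<open>q \<in> cond Q\<close> q'(1,2) *(4)] approximates_nth(2)[OF A q'(3,1,4,5)] q'(6)
    by simp
next
  assume *: "\<forall>q \<in> cond Q. le Q q p \<longrightarrow> n < length (A q) \<longrightarrow> A q ! n = i"
  show "f_mem (n, i) (real_of Q A) Q p"
    unfolding f_mem_def dense_below_def
  proof (intro ballI impI)
    fix q assume q: "q \<in> cond Q" "le Q q p"
    obtain q' where q': "q' \<in> cond Q" "le Q q' q" "Suc n \<le> length (A q')"
      using approximates_long[OF A q(1)] .
    have "le Q q' p" using forcing_trans[OF Q q'(1) q(1) p q'(2) q(2)] .
    then have "((n, i), q') \<in> real_of Q A" using * q' by (auto simp: real_of_def)
    then show "\<exists>r\<in>cond Q. le Q r q \<and> (\<exists>t\<in>cond Q. ((n, i), t) \<in> real_of Q A \<and> le Q r t)"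
      using q' forcing_refl[OF Q q'(1)] by blast
  qed
qed

lemma f_mem_real_of_nth:
  assumes Q: "forcing_notion Q" and A: "approximates Q A" and p: "p \<in> cond Q" "n < length (A p)"
  shows "f_mem (n, i) (real_of Q A) Q p \<longleftrightarrow> A p ! n = i"
proof -
  have "A q ! n = A p ! n" if "q \<in> cond Q" "le Q q p" for q
    using approximates_nth(2)[OF A p(1) that p(2)] .
  then show ?thesis
    unfolding f_mem_real_of[OF Q A p(1)] using p forcing_refl[OF Q p(1)] by blast
qed

lemma f_cantor_real_of:
  assumes Q: "forcing_notion Q" and A: "approximates Q A" and p: "p \<in> cond Q"
  shows "f_cantor (real_of Q A) Q p"
proof -
  have "f_ex UNIV (\<lambda>i. f_mem (n, i) (real_of Q A)) Q p" for n
    unfolding f_ex_def dense_below_def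
  proof (intro ballI impI)
    fix q assume q: "q \<in> cond Q" "le Q q p"
    obtain q' where q': "q' \<in> cond Q" "le Q q' q" "Suc n \<le> length (A q')"
      using approximates_long[OF A q(1)] .
    then have "f_mem (n, A q' ! n) (real_of Q A) Q q'"
      using f_mem_real_of_nth[OF Q A q'(1)] by simp
    then show "\<exists>r\<in>cond Q. le Q r q \<and> (\<exists>x\<in>UNIV. f_mem (n, x) (real_of Q A) Q r)"
      using q' by blast
  qed
  moreover have "f_not (f_and (f_mem (n, 0) (real_of Q A)) (f_mem (n, 1) (real_of Q A))) Q p" for n
    unfolding f_not_def f_and_def
  proof (intro ballI impI notI)
    fix q assume q: "q \<in> cond Q" and *: "f_mem (n, 0) (real_of Q A) Q q \<and> f_mem (n, 1) (real_of Q A) Q q"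
    obtain q' where q': "q' \<in> cond Q" "le Q q' q" "Suc n \<le> length (A q')"
      using approximates_long[OF A q] .
    then have "A q' ! n = 0" "A q' ! n = 1" using * unfolding f_mem_real_of[OF Q A q] by auto
    then show False by simp
  qed
  ultimately show ?thesis
    unfolding f_cantor_def f_all_def by (simp add: f_and_def)
qed

lemma f_neq_real_of:
  assumes Q: "forcing_notion Q" and A: "approximates Q A" and B: "approximates Q B"
    and p: "p \<in> cond Q"
    and diff: "\<And>q. q \<in> cond Q \<Longrightarrow> \<exists>q' \<in> cond Q. le Q q' q \<and> length (A q') = length (B q') \<and> A q' \<noteq> B q'"
  shows "f_not (f_eq (real_of Q A) (real_of Q B)) Q p"
  unfolding f_not_def
proof (intro ballI impI notI)
  fix q assume q: "q \<in> cond Q" and eq: "f_eq (real_of Q A) (real_of Q B) Q q"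
  obtain q' where q': "q' \<in> cond Q" "le Q q' q" "length (A q') = length (B q')" "A q' \<noteq> B q'"
    using diff[OF q] by blast
  then obtain n where n: "n < length (A q')" "A q' ! n \<noteq> B q' ! n"
    using nth_equalityI by blast
  have imp: "f_imp (f_mem (n, A q' ! n) (real_of Q A)) (f_mem (n, A q' ! n) (real_of Q B)) Q q"
    using eq unfolding f_eq_def f_all_def f_iff_def f_and_def by blast
  have "f_mem (n, A q' ! n) (real_of Q A) Q q'"
    using f_mem_real_of_nth[OF Q A q'(1) n(1)] by simp
  moreover have "\<not> f_mem (n, A q' ! n) (real_of Q B) Q r" if r: "r \<in> cond Q" "le Q r q'" for r
    using approximates_nth[OF B q'(1) r, of n] f_mem_real_of_nth[OF Q B r(1), of n] n q'(3) by simp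
  ultimately show False
    using imp q'(1,2) unfolding f_imp_def f_not_def f_and_def by blast
qed

lemma f_is_sum_real_of:
  assumes Q: "forcing_notion Q" and A: "approximates Q A" and B: "approximates Q B"
    and C: "approximates Q C" and sum: "\<And>q. q \<in> cond Q \<Longrightarrow> C q = ladd (A q) (B q)"
  shows "f_is_sum (real_of Q C) (real_of Q A) (real_of Q B) Q p"
  unfolding f_is_sum_def f_all_def f_imp_def f_not_def f_and_def
proof (intro ballI impI notI)
  fix n i j q
  assume q: "q \<in> cond Q"
    and *: "(f_mem (n, i) (real_of Q A) Q q \<and> f_mem (n, j) (real_of Q B) Q q) \<and>
      (\<forall>r \<in> cond Q. le Q r q \<longrightarrow> \<not> f_mem (n, i + j) (real_of Q C) Q r)"
  have "f_mem (n, i + j) (real_of Q C) Q q"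
    using * sum unfolding f_mem_real_of[OF Q A q] f_mem_real_of[OF Q B q] f_mem_real_of[OF Q C q]
    by (auto simp: ladd_def)
  then show False using * q forcing_refl[OF Q q] by blast
qed

lemma is_tree_take: "is_tree T \<Longrightarrow> t \<in> T \<Longrightarrow> take n t \<in> T"
  unfolding is_tree_def by (metis prefix_order.le_neq_trans take_is_prefix)

lemma f_in_lim_real_of:
  assumes Q: "forcing_notion Q" and A: "approximates Q A" and p: "p \<in> cond Q"
    and T: "is_tree T" and mem: "\<And>q. q \<in> cond Q \<Longrightarrow> le Q q p \<Longrightarrow> A q \<in> T"
  shows "f_in_lim (real_of Q A) T Q p"
  unfolding f_in_lim_def f_all_def f_ex_def dense_below_def
proof (intro ballI impI)
  fix n q assume q: "q \<in> cond Q" "le Q q p"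
  obtain q' where q': "q' \<in> cond Q" "le Q q' q" "n \<le> length (A q')"
    using approximates_long[OF A q(1)] .
  have "le Q q' p" using forcing_trans[OF Q q'(1) q(1) p q'(2) q(2)] .
  then have "take n (A q') \<in> {t \<in> T. length t = n}"
    using is_tree_take[OF T mem[OF q'(1)]] q'(3) by simp
  moreover have "\<forall>i\<in>{..<n}. f_mem (i, take n (A q') ! i) (real_of Q A) Q q'"
    using f_mem_real_of_nth[OF Q A q'(1)] q'(3) by simp
  ultimately show "\<exists>r\<in>cond Q. le Q r q \<and>
      (\<exists>t\<in>{t \<in> T. length t = n}. \<forall>i\<in>{..<n}. f_mem (i, t ! i) (real_of Q A) Q r)"
    using q' by blast
qed

section \<open>Sums of finite sequences\<close>

lemma length_ladd [simp]: "length (ladd x y) = min (length x) (length y)"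
  by (simp add: ladd_def)

lemma ladd_Nil [simp]: "ladd x [] = []"
  by (simp add: ladd_def)

lemma nth_ladd: "i < length x \<Longrightarrow> i < length y \<Longrightarrow> ladd x y ! i = x ! i + y ! i"
  by (simp add: ladd_def)

lemma prefix_ladd:
  assumes "prefix x x'" "prefix y y'" "length x = length y"
  shows "prefix (ladd x y) (ladd x' y')"
  using assms by (auto simp: ladd_def prefix_def)

lemma ladd_inject:
  assumes "ladd x y = ladd x z" "length y = length x" "length z = length x"
  shows "y = z"
proof (rule nth_equalityI)
  fix i assume "i < length y"
  then have "x ! i + y ! i = ladd x y ! i" "x ! i + z ! i = ladd x z ! i"
    using assms(2,3) by (simp_all only: nth_ladd)
  then have "x ! i + y ! i = x ! i + z ! i" by (simp only: assms(1))
  then show "y ! i = z ! i" by (rule add_left_imp_eq)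
qed (use assms in simp)

text \<open>
  As \<open>z + z = 0\<close>, the summands \<open>x\<close> and \<open>y\<close> can be interchanged.  This is the reason for having two common
  points of translates for each pair of branches.
\<close>

lemma ladd_exchange:
  assumes "ladd a x = ladd b y" "length x = length a" "length y = length a" "length b = length a"
  shows "ladd a y = ladd b x"
proof (rule nth_equalityI)
  fix i assume "i < length (ladd a y)"
  then have i: "i < length a" using assms by simp
  have "a ! i + x ! i = b ! i + y ! i"
    using arg_cong[OF assms(1), of "\<lambda>l. l ! i"] i assms(2-4) by (simp add: nth_ladd)
  then have "a ! i + y ! i = b ! i + x ! i"
    by (cases "a ! i"; cases "b ! i"; cases "x ! i"; cases "y ! i") simp_all
  then show "ladd a y ! i = ladd b x ! i"
    using i assms(2-4) by (simp add: nth_ladd)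
qed (use assms in simp)

section \<open>Generic overlapping sequences\<close>

text \<open>
  An abstract forcing whose condition \<open>p\<close> knows approximations of length \<open>L p\<close> of the points with
  indices in \<open>W p\<close>, namely \<open>E p \<alpha>\<close>, and for each pair of them the numbers \<open>H p i \<alpha> \<beta>\<close> of trees with
  approximations \<open>G p i \<alpha> \<beta>\<close> of branches.
\<close>

locale overlap_forcing =
  fixes Q :: "'p forcing" and \<Lambda> :: "'x set" and T :: "nat \<Rightarrow> bit list set" and \<iota> :: nat
    and W :: "'p \<Rightarrow> 'x set" and L :: "'p \<Rightarrow> nat" and E :: "'p \<Rightarrow> 'x \<Rightarrow> bit list"
    and H :: "'p \<Rightarrow> nat \<Rightarrow> 'x \<Rightarrow> 'x \<Rightarrow> nat" and G :: "'p \<Rightarrow> nat \<Rightarrow> 'x \<Rightarrow> 'x \<Rightarrow> bit list"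
  assumes Q: "forcing_notion Q"
    and T: "\<And>m. is_tree (T m)"
    and two: "\<And>\<alpha>. \<alpha> \<in> \<Lambda> \<Longrightarrow> \<exists>\<beta> \<in> \<Lambda>. \<alpha> \<noteq> \<beta>"
    and dense: "\<And>p \<alpha> \<beta> N. p \<in> cond Q \<Longrightarrow> \<alpha> \<in> \<Lambda> \<Longrightarrow> \<beta> \<in> \<Lambda> \<Longrightarrow>
      \<exists>q \<in> cond Q. le Q q p \<and> \<alpha> \<in> W q \<and> \<beta> \<in> W q \<and> N \<le> L q"
    and mono: "\<And>p q. p \<in> cond Q \<Longrightarrow> q \<in> cond Q \<Longrightarrow> le Q q p \<Longrightarrow> W p \<subseteq> W q"
    and E_mono: "\<And>p q \<alpha>. p \<in> cond Q \<Longrightarrow> q \<in> cond Q \<Longrightarrow> le Q q p \<Longrightarrow> \<alpha> \<in> W p \<Longrightarrow>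
      prefix (E p \<alpha>) (E q \<alpha>)"
    and HG_mono: "\<And>p q \<alpha> \<beta> i. p \<in> cond Q \<Longrightarrow> q \<in> cond Q \<Longrightarrow> le Q q p \<Longrightarrow>
      \<alpha> \<in> W p \<Longrightarrow> \<beta> \<in> W p \<Longrightarrow> \<alpha> \<noteq> \<beta> \<Longrightarrow> i < \<iota> \<Longrightarrow>
      H q i \<alpha> \<beta> = H p i \<alpha> \<beta> \<and> prefix (G p i \<alpha> \<beta>) (G q i \<alpha> \<beta>)"
    and E_length: "\<And>p \<alpha>. p \<in> cond Q \<Longrightarrow> \<alpha> \<in> W p \<Longrightarrow> length (E p \<alpha>) = L p"
    and E_inj: "\<And>p \<alpha> \<beta>. p \<in> cond Q \<Longrightarrow> \<alpha> \<in> W p \<Longrightarrow> \<beta> \<in> W p \<Longrightarrow> \<alpha> \<noteq> \<beta> \<Longrightarrow> E p \<alpha> \<noteq> E p \<beta>"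
    and G_length: "\<And>p \<alpha> \<beta> i. p \<in> cond Q \<Longrightarrow> \<alpha> \<in> W p \<Longrightarrow> \<beta> \<in> W p \<Longrightarrow> \<alpha> \<noteq> \<beta> \<Longrightarrow> i < \<iota> \<Longrightarrow>
      length (G p i \<alpha> \<beta>) = L p"
    and G_tree: "\<And>p \<alpha> \<beta> i. p \<in> cond Q \<Longrightarrow> \<alpha> \<in> W p \<Longrightarrow> \<beta> \<in> W p \<Longrightarrow> \<alpha> \<noteq> \<beta> \<Longrightarrow> i < \<iota> \<Longrightarrow>
      G p i \<alpha> \<beta> \<in> T (H p i \<alpha> \<beta>)"
    and G_sum: "\<And>p \<alpha> \<beta> i. p \<in> cond Q \<Longrightarrow> \<alpha> \<in> W p \<Longrightarrow> \<beta> \<in> W p \<Longrightarrow> \<alpha> \<noteq> \<beta> \<Longrightarrow> i < \<iota> \<Longrightarrow>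
      ladd (E p \<alpha>) (G p i \<alpha> \<beta>) = ladd (E p \<beta>) (G p i \<beta> \<alpha>)"
    and G_distinct: "\<And>p \<alpha> \<beta>. p \<in> cond Q \<Longrightarrow> \<alpha> \<in> W p \<Longrightarrow> \<beta> \<in> W p \<Longrightarrow> \<alpha> \<noteq> \<beta> \<Longrightarrow>
      distinct (map (\<lambda>i. G p i \<alpha> \<beta>) [0..<\<iota>] @ map (\<lambda>i. G p i \<beta> \<alpha>) [0..<\<iota>])"
begin

text \<open>
  In this and the following definitions, \<open>[]\<close> means that nothing is decided yet.
\<close>

definition base :: "'x \<Rightarrow> 'p \<Rightarrow> bit list" where
  "base \<alpha> p = (if \<alpha> \<in> W p then E p \<alpha> else [])"

text \<open>
  The second half of the range \<open>i < 2 * \<iota>\<close> consists of the branches for \<open>(\<beta>, \<alpha>)\<close>, used as offsets from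
  \<open>\<alpha>\<close>.
\<close>

definition G2 :: "'p \<Rightarrow> nat \<Rightarrow> 'x \<Rightarrow> 'x \<Rightarrow> bit list" where
  "G2 p i \<alpha> \<beta> = (if i < \<iota> then G p i \<alpha> \<beta> else G p (i - \<iota>) \<beta> \<alpha>)"

definition H2 :: "'p \<Rightarrow> nat \<Rightarrow> 'x \<Rightarrow> 'x \<Rightarrow> nat" where
  "H2 p i \<alpha> \<beta> = (if i < \<iota> then H p i \<alpha> \<beta> else H p (i - \<iota>) \<beta> \<alpha>)"

definition offset :: "nat \<Rightarrow> 'x \<Rightarrow> 'x \<Rightarrow> 'p \<Rightarrow> bit list" where
  "offset i \<alpha> \<beta> p = (if \<alpha> \<in> W p \<and> \<beta> \<in> W p then G2 p i \<alpha> \<beta> else [])"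

definition point :: "nat \<Rightarrow> 'x \<Rightarrow> 'x \<Rightarrow> 'p \<Rightarrow> bit list" where
  "point i \<alpha> \<beta> p = ladd (base \<alpha> p) (offset i \<alpha> \<beta> p)"

lemma G2_props:
  assumes "p \<in> cond Q" "\<alpha> \<in> W p" "\<beta> \<in> W p" "\<alpha> \<noteq> \<beta>" "i < 2 * \<iota>"
  shows "length (G2 p i \<alpha> \<beta>) = L p" "G2 p i \<alpha> \<beta> \<in> T (H2 p i \<alpha> \<beta>)"
    "ladd (E p \<alpha>) (G2 p i \<alpha> \<beta>) = ladd (E p \<beta>) (G2 p i \<beta> \<alpha>)"
    "q \<in> cond Q \<Longrightarrow> le Q q p \<Longrightarrow> H2 q i \<alpha> \<beta> = H2 p i \<alpha> \<beta> \<and> prefix (G2 p i \<alpha> \<beta>) (G2 q i \<alpha> \<beta>)"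
proof -
  have i: "i - \<iota> < \<iota>" if "\<not> i < \<iota>" using that assms(5) by simp
  note a = assms(1-4) and b = assms(1,3,2) assms(4)[symmetric]
  show "length (G2 p i \<alpha> \<beta>) = L p" "G2 p i \<alpha> \<beta> \<in> T (H2 p i \<alpha> \<beta>)"
    using G_length[OF a] G_length[OF b] G_tree[OF a] G_tree[OF b] i by (auto simp: G2_def H2_def)
  show "q \<in> cond Q \<Longrightarrow> le Q q p \<Longrightarrow> H2 q i \<alpha> \<beta> = H2 p i \<alpha> \<beta> \<and> prefix (G2 p i \<alpha> \<beta>) (G2 q i \<alpha> \<beta>)"
    using HG_mono[OF a(1) _ _ a(2-4)] HG_mono[OF b(1) _ _ b(2-4)] i by (auto simp: G2_def H2_def)
  show "ladd (E p \<alpha>) (G2 p i \<alpha> \<beta>) = ladd (E p \<beta>) (G2 p i \<beta> \<alpha>)"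
  proof (cases "i < \<iota>")
    case True
    then show ?thesis using G_sum[OF a] by (simp add: G2_def)
  next
    case False
    then show ?thesis
      using ladd_exchange[OF G_sum[OF a i[OF False]]] G_length[OF a] G_length[OF b] i
        E_length[OF a(1,2)] E_length[OF a(1,3)] by (simp add: G2_def)
  qed
qed

lemma G2_inject:
  assumes "p \<in> cond Q" "\<alpha> \<in> W p" "\<beta> \<in> W p" "\<alpha> \<noteq> \<beta>" "i < j" "j < 2 * \<iota>"
  shows "G2 p i \<alpha> \<beta> \<noteq> G2 p j \<alpha> \<beta>"
proof -
  let ?l = "map (\<lambda>i. G p i \<alpha> \<beta>) [0..<\<iota>] @ map (\<lambda>i. G p i \<beta> \<alpha>) [0..<\<iota>]"
  have "G2 p k \<alpha> \<beta> = ?l ! k" if "k < 2 * \<iota>" for k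
    using that by (cases "k < \<iota>") (auto simp: G2_def nth_append)
  then show ?thesis
    using nth_eq_iff_index_eq[OF G_distinct[OF assms(1-4)], of i j] assms(5,6) by simp
qed

lemma approximates_base:
  assumes "\<alpha> \<in> \<Lambda>"
  shows "approximates Q (base \<alpha>)"
  unfolding approximates_def
proof (intro conjI ballI allI impI)
  fix p q assume "p \<in> cond Q" "q \<in> cond Q" "le Q q p"
  then show "prefix (base \<alpha> p) (base \<alpha> q)"
    using mono E_mono by (auto simp: base_def)
next
  fix p N assume "p \<in> cond Q"
  then show "\<exists>q \<in> cond Q. le Q q p \<and> N \<le> length (base \<alpha> q)"
    using dense[OF _ assms assms, of p N] E_length by (auto simp: base_def)
qed

context
  fixes \<alpha> \<beta> i
  assumes ab: "\<alpha> \<in> \<Lambda>" "\<beta> \<in> \<Lambda>" "\<alpha> \<noteq> \<beta>" and i: "i < 2 * \<iota>"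
begin

lemma approximates_offset: "approximates Q (offset i \<alpha> \<beta>)"
  unfolding approximates_def
proof (intro conjI ballI allI impI)
  fix p q assume "p \<in> cond Q" "q \<in> cond Q" "le Q q p"
  then show "prefix (offset i \<alpha> \<beta> p) (offset i \<alpha> \<beta> q)"
    using mono[of p q] G2_props(4)[OF _ _ _ ab(3) i, of p q] by (auto simp: offset_def)
next
  fix p N assume "p \<in> cond Q"
  then obtain q where "q \<in> cond Q" "le Q q p" "\<alpha> \<in> W q" "\<beta> \<in> W q" "N \<le> L q"
    using dense[OF _ ab(1,2)] by blast
  then show "\<exists>q \<in> cond Q. le Q q p \<and> N \<le> length (offset i \<alpha> \<beta> q)"
    using G2_props(1)[OF _ _ _ ab(3) i, of q] by (intro bexI[of _ q]) (auto simp: offset_def)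
qed

lemma approximates_point: "approximates Q (point i \<alpha> \<beta>)"
  unfolding approximates_def
proof (intro conjI ballI allI impI)
  fix p q assume pq: "p \<in> cond Q" "q \<in> cond Q" "le Q q p"
  show "prefix (point i \<alpha> \<beta> p) (point i \<alpha> \<beta> q)"
  proof (cases "\<alpha> \<in> W p \<and> \<beta> \<in> W p")
    case True
    have "prefix (base \<alpha> p) (base \<alpha> q)" "prefix (offset i \<alpha> \<beta> p) (offset i \<alpha> \<beta> q)"
      using approximates_base[OF ab(1)] approximates_offset pq by (simp_all add: approximates_def)
    then show ?thesis
      unfolding point_def
      by (rule prefix_ladd)
        (use True E_length pq(1) G2_props(1)[OF pq(1) _ _ ab(3) i] in \<open>simp add: base_def offset_def\<close>)
  next
    case False
    then have "point i \<alpha> \<beta> p = []" by (auto simp: point_def offset_def)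
    then show ?thesis by simp
  qed
next
  fix p N assume "p \<in> cond Q"
  then obtain q where "q \<in> cond Q" "le Q q p" "\<alpha> \<in> W q" "\<beta> \<in> W q" "N \<le> L q"
    using dense[OF _ ab(1,2)] by blast
  then show "\<exists>q \<in> cond Q. le Q q p \<and> N \<le> length (point i \<alpha> \<beta> q)"
    using G2_props(1)[OF _ _ _ ab(3) i, of q] E_length[of q \<alpha>]
    by (intro bexI[of _ q]) (auto simp: offset_def point_def base_def)
qed

lemma point_commute:
  assumes "p \<in> cond Q"
  shows "point i \<alpha> \<beta> p = ladd (base \<beta> p) (offset i \<beta> \<alpha> p)"
  using G2_props(3)[OF assms _ _ ab(3) i] by (auto simp: point_def base_def offset_def)

lemma f_in_lim_offset: "f_ex UNIV (\<lambda>m. f_in_lim (real_of Q (offset i \<alpha> \<beta>)) (T m)) Q p"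
  if p: "p \<in> cond Q"
  unfolding f_ex_def dense_below_def
proof (intro ballI impI)
  fix q assume "q \<in> cond Q"
  then obtain r where r: "r \<in> cond Q" "le Q r q" "\<alpha> \<in> W r" "\<beta> \<in> W r"
    using dense[OF _ ab(1,2)] by blast
  have "f_in_lim (real_of Q (offset i \<alpha> \<beta>)) (T (H2 r i \<alpha> \<beta>)) Q r"
  proof (rule f_in_lim_real_of[OF Q approximates_offset r(1) T])
    fix t assume t: "t \<in> cond Q" "le Q t r"
    then have "\<alpha> \<in> W t" "\<beta> \<in> W t" "H2 t i \<alpha> \<beta> = H2 r i \<alpha> \<beta>"
      using mono[OF r(1) t] r(3,4) G2_props(4)[OF r(1,3,4) ab(3) i t] by auto
    then show "offset i \<alpha> \<beta> t \<in> T (H2 r i \<alpha> \<beta>)"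
      using G2_props(2)[OF t(1) _ _ ab(3) i] by (simp add: offset_def)
  qed
  then show "\<exists>r\<in>cond Q. le Q r q \<and> (\<exists>m\<in>UNIV. f_in_lim (real_of Q (offset i \<alpha> \<beta>)) (T m) Q r)"
    using r by blast
qed

end

lemma f_in_translate_point:
  assumes ab: "\<alpha> \<in> \<Lambda>" "\<beta> \<in> \<Lambda>" "\<alpha> \<noteq> \<beta>" and i: "i < 2 * \<iota>"
  shows "f_in_translate (real_of Q (point i \<alpha> \<beta>)) (real_of Q (base \<alpha>)) T Q p"
    and "f_in_translate (real_of Q (point i \<alpha> \<beta>)) (real_of Q (base \<beta>)) T Q p"
proof -
  show "f_in_translate (real_of Q (point i \<alpha> \<beta>)) (real_of Q (base \<alpha>)) T Q p"
    unfolding f_in_translate_def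
  proof (rule f_exI[OF Q, of "real_of Q (offset i \<alpha> \<beta>)"])
    fix q assume "q \<in> cond Q"
    then show "f_and (f_cantor (real_of Q (offset i \<alpha> \<beta>)))
        (f_and (f_ex UNIV (\<lambda>m. f_in_lim (real_of Q (offset i \<alpha> \<beta>)) (T m)))
          (f_is_sum (real_of Q (point i \<alpha> \<beta>)) (real_of Q (base \<alpha>)) (real_of Q (offset i \<alpha> \<beta>)))) Q q"
      unfolding f_and_def
      using f_cantor_real_of[OF Q approximates_offset[OF ab i]] f_in_lim_offset[OF ab i]
        f_is_sum_real_of[OF Q approximates_base[OF ab(1)] approximates_offset[OF ab i]
          approximates_point[OF ab i] point_def]
      by blast
  qed simp
  note ba = ab(2,1) ab(3)[symmetric]
  show "f_in_translate (real_of Q (point i \<alpha> \<beta>)) (real_of Q (base \<beta>)) T Q p"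
    unfolding f_in_translate_def
  proof (rule f_exI[OF Q, of "real_of Q (offset i \<beta> \<alpha>)"])
    fix q assume "q \<in> cond Q"
    then show "f_and (f_cantor (real_of Q (offset i \<beta> \<alpha>)))
        (f_and (f_ex UNIV (\<lambda>m. f_in_lim (real_of Q (offset i \<beta> \<alpha>)) (T m)))
          (f_is_sum (real_of Q (point i \<alpha> \<beta>)) (real_of Q (base \<beta>)) (real_of Q (offset i \<beta> \<alpha>)))) Q q"
      unfolding f_and_def
      using f_cantor_real_of[OF Q approximates_offset[OF ba i]] f_in_lim_offset[OF ba i]
        f_is_sum_real_of[OF Q approximates_base[OF ab(2)] approximates_offset[OF ba i]
          approximates_point[OF ab i] point_commute[OF ab i]]
      by blast
  qed simp
qed

text \<open>
  The points \<open>\<eta>\<^sub>\<alpha> + G\<close> differ since their second summands do.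
\<close>

lemma f_card_ge_points:
  assumes ab: "\<alpha> \<in> \<Lambda>" "\<beta> \<in> \<Lambda>" "\<alpha> \<noteq> \<beta>"
    and \<phi>: "\<And>i q. i < 2 * \<iota> \<Longrightarrow> q \<in> cond Q \<Longrightarrow> \<phi> (real_of Q (point i \<alpha> \<beta>)) Q q"
  shows "f_card_ge (2 * \<iota>) \<phi> Q p"
  unfolding f_card_ge_def
proof (rule f_exI[OF Q, of "reals_of Q (\<lambda>i. point i \<alpha> \<beta>)"])
  fix q assume q: "q \<in> cond Q"
  have "f_not (f_eq (real_of Q (point i \<alpha> \<beta>)) (real_of Q (point j \<alpha> \<beta>))) Q q"
    if ij: "i < j" "j < 2 * \<iota>" for i j
  proof (rule f_neq_real_of[OF Q approximates_point[OF ab] approximates_point[OF ab] q])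
    show "i < 2 * \<iota>" "j < 2 * \<iota>" using ij by simp_all
    fix r assume "r \<in> cond Q"
    then obtain t where t: "t \<in> cond Q" "le Q t r" "\<alpha> \<in> W t" "\<beta> \<in> W t"
      using dense[OF _ ab(1,2)] by blast
    have "length (G2 t i \<alpha> \<beta>) = L t" "length (G2 t j \<alpha> \<beta>) = L t" "length (E t \<alpha>) = L t"
      using G2_props(1)[OF t(1,3,4) ab(3)] E_length[OF t(1,3)] ij by simp_all
    moreover have "G2 t i \<alpha> \<beta> \<noteq> G2 t j \<alpha> \<beta>" using G2_inject[OF t(1,3,4) ab(3) ij] .
    ultimately have "length (point i \<alpha> \<beta> t) = length (point j \<alpha> \<beta> t)"
      "point i \<alpha> \<beta> t \<noteq> point j \<alpha> \<beta> t"
      using t(3,4) ladd_inject by (auto simp: point_def base_def offset_def)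
    then show "\<exists>q'\<in>cond Q. le Q q' r \<and> length (point i \<alpha> \<beta> q') = length (point j \<alpha> \<beta> q') \<and>
        point i \<alpha> \<beta> q' \<noteq> point j \<alpha> \<beta> q'"
      using t by blast
  qed
  then show "f_and
      (f_all {..<2 * \<iota>} (\<lambda>i. f_and (f_cantor (sect (reals_of Q (\<lambda>i. point i \<alpha> \<beta>)) i))
        (\<phi> (sect (reals_of Q (\<lambda>i. point i \<alpha> \<beta>)) i))))
      (f_all {(i, j). i < j \<and> j < 2 * \<iota>}
        (\<lambda>(i, j). f_not (f_eq (sect (reals_of Q (\<lambda>i. point i \<alpha> \<beta>)) i)
          (sect (reals_of Q (\<lambda>i. point i \<alpha> \<beta>)) j)))) Q q"
    using \<phi> q f_cantor_real_of[OF Q approximates_point[OF ab] q]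
    by (auto simp: f_and_def f_all_def)
qed simp

text \<open>
  A single translate also has to contain \<open>2 * \<iota>\<close> points: those that it shares with any other one.
\<close>

theorem overlapping_sequence: "forced Q (f_overlapping_sequence \<Lambda> T (2 * \<iota>))"
  unfolding forced_def f_overlapping_sequence_def
proof (intro ballI f_exI[OF Q UNIV_I, of _ "reals_of Q base"])
  fix q assume q: "q \<in> cond Q"
  have "f_not (f_eq (real_of Q (base \<alpha>)) (real_of Q (base \<beta>))) Q q"
    if ab: "\<alpha> \<in> \<Lambda>" "\<beta> \<in> \<Lambda>" "\<alpha> \<noteq> \<beta>" for \<alpha> \<beta>
  proof (rule f_neq_real_of[OF Q approximates_base[OF ab(1)] approximates_base[OF ab(2)] q])
    fix r assume "r \<in> cond Q"
    then obtain t where t: "t \<in> cond Q" "le Q t r" "\<alpha> \<in> W t" "\<beta> \<in> W t"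
      using dense[OF _ ab(1,2)] by blast
    then show "\<exists>q'\<in>cond Q. le Q q' r \<and> length (base \<alpha> q') = length (base \<beta> q') \<and>
        base \<alpha> q' \<noteq> base \<beta> q'"
      using E_length[OF t(1)] E_inj[OF t(1,3,4) ab(3)]
      by (intro bexI[of _ t]) (simp_all add: base_def)
  qed
  moreover have "f_card_ge (2 * \<iota>) (\<lambda>z. f_and (f_in_translate z (real_of Q (base \<alpha>)) T)
      (f_in_translate z (real_of Q (base \<beta>)) T)) Q q" if ab: "\<alpha> \<in> \<Lambda>" "\<beta> \<in> \<Lambda>" for \<alpha> \<beta>
  proof (cases "\<alpha> = \<beta>")
    case True
    obtain \<gamma> where \<gamma>: "\<gamma> \<in> \<Lambda>" "\<alpha> \<noteq> \<gamma>" using two[OF ab(1)] by blast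
    show ?thesis
      by (rule f_card_ge_points[OF ab(1) \<gamma>])
        (simp add: f_and_def True[symmetric] f_in_translate_point(1)[OF ab(1) \<gamma>])
  next
    case False
    then show ?thesis
      by (intro f_card_ge_points[OF ab False])
        (simp add: f_and_def f_in_translate_point[OF ab False])
  qed
  ultimately show "f_and (f_all \<Lambda> (\<lambda>\<alpha>. f_cantor (sect (reals_of Q base) \<alpha>)))
     (f_and (f_all (offdiag \<Lambda>) (\<lambda>(\<alpha>, \<beta>). f_not (f_eq (sect (reals_of Q base) \<alpha>) (sect (reals_of Q base) \<beta>))))
       (f_all \<Lambda> (\<lambda>\<alpha>. f_all \<Lambda> (\<lambda>\<beta>.
          f_card_ge (2 * \<iota>) (\<lambda>z. f_and (f_in_translate z (sect (reals_of Q base) \<alpha>) T)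
                                   (f_in_translate z (sect (reals_of Q base) \<beta>) T)))))) Q q"
    using f_cantor_real_of[OF Q approximates_base q]
    unfolding f_and_def f_all_def offdiag_def by auto
qed

end

section \<open>Bricks\<close>

lemma sum_pair: "a \<noteq> a' \<Longrightarrow> sum f {a, a'} = f a + (f a' :: 'b::comm_monoid_add)"
  by simp

text \<open>
  Over the two-element field, equal vectors have sum zero.
\<close>

lemma lin_indep_inj:
  assumes "lin_indep n w \<eta>" "finite w" "a \<in> w" "a' \<in> w" "a \<noteq> a'"
  shows "\<eta> a \<noteq> \<eta> a'"
proof
  assume eq: "\<eta> a = \<eta> a'"
  define x :: "nat \<Rightarrow> bit" where "x b = of_bool (b = a \<or> b = a')" for b
  have "(\<Sum>b\<in>w. x b * \<eta> b ! i) = 0" for i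
  proof -
    have "(\<Sum>b\<in>w. x b * \<eta> b ! i) = (\<Sum>b\<in>{a, a'}. x b * \<eta> b ! i)"
      by (rule sum.mono_neutral_right) (use assms in \<open>auto simp: x_def\<close>)
    also have "\<dots> = x a * \<eta> a ! i + x a' * \<eta> a' ! i" by (rule sum_pair[OF assms(5)])
    also have "\<dots> = \<eta> a' ! i + \<eta> a' ! i" using eq by (simp add: x_def)
    also have "\<dots> = 0" by (cases "\<eta> a' ! i") simp_all
    finally show ?thesis .
  qed
  then have "x a = 0" using assms(1,3) unfolding lin_indep_def by blast
  then show False by (simp add: x_def)
qed

lemma brick_pairs:
  assumes B: "is_brick S \<iota> T c B" and a: "a \<in> bw B" "a' \<in> bw B" "a \<noteq> a'"
  shows "b\<eta> B a \<noteq> b\<eta> B a'"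
    and "i < \<iota> \<Longrightarrow> length (bg B i a a') = bn B"
    and "i < \<iota> \<Longrightarrow> bg B i a a' \<in> T (bh B i a a')"
    and "i < \<iota> \<Longrightarrow> ladd (b\<eta> B a) (bg B i a a') = ladd (b\<eta> B a') (bg B i a' a)"
    and "distinct (map (\<lambda>i. bg B i a a') [0..<\<iota>] @ map (\<lambda>i. bg B i a' a) [0..<\<iota>])"
proof -
  show ne: "b\<eta> B a \<noteq> b\<eta> B a'"
    using B a by (intro lin_indep_inj[of "bn B" "bw B"]) (simp_all add: is_brick_def)
  have off: "(a, a') \<in> offdiag (bw B)" "(a', a) \<in> offdiag (bw B)"
    using a by (auto simp: offdiag_def)
  obtain m where m: "m \<in> MT \<iota> T" "ml m = bn B" "mu m = b\<eta> B ` bw B"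
    and hg: "\<forall>(a, a') \<in> offdiag (bw B). \<forall>i<\<iota>.
           mh m i (b\<eta> B a) (b\<eta> B a') = bh B i a a' \<and> mg m i (b\<eta> B a) (b\<eta> B a') = bg B i a a'"
    using B[unfolded is_brick_def, THEN conjunct2, THEN conjunct2, THEN conjunct2, THEN conjunct2,
      THEN conjunct2, THEN conjunct2, THEN conjunct1] by (elim bexE conjE)
  have mem: "(b\<eta> B a, b\<eta> B a') \<in> offdiag (mu m)"
    using a ne m(3) by (auto simp: offdiag_def)
  have eqs: "mh m i (b\<eta> B a) (b\<eta> B a') = bh B i a a'" "mg m i (b\<eta> B a) (b\<eta> B a') = bg B i a a'"
    "mg m i (b\<eta> B a') (b\<eta> B a) = bg B i a' a" if "i < \<iota>" for i
    using bspec[OF hg off(1)] bspec[OF hg off(2)] that by simp_all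
  have M: "\<forall>(\<eta>, \<nu>) \<in> offdiag (mu m). \<forall>i<\<iota>.
        mg m i \<eta> \<nu> \<in> T (mh m i \<eta> \<nu>) \<and> length (mg m i \<eta> \<nu>) = ml m"
    "\<forall>(\<eta>, \<nu>) \<in> offdiag (mu m). \<forall>i<\<iota>. ladd \<eta> (mg m i \<eta> \<nu>) = ladd \<nu> (mg m i \<nu> \<eta>)"
    "\<forall>(\<eta>, \<nu>) \<in> offdiag (mu m).
        distinct (map (\<lambda>i. mg m i \<eta> \<nu>) [0..<\<iota>] @ map (\<lambda>i. mg m i \<nu> \<eta>) [0..<\<iota>])"
    using m(1) unfolding MT_def by blast+
  show "length (bg B i a a') = bn B" "bg B i a a' \<in> T (bh B i a a')"
    "ladd (b\<eta> B a) (bg B i a a') = ladd (b\<eta> B a') (bg B i a' a)" if "i < \<iota>"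
    using bspec[OF M(1) mem] bspec[OF M(2) mem] eqs that m(2) by simp_all
  have "map (\<lambda>i. mg m i (b\<eta> B a) (b\<eta> B a')) [0..<\<iota>] = map (\<lambda>i. bg B i a a') [0..<\<iota>]"
    "map (\<lambda>i. mg m i (b\<eta> B a') (b\<eta> B a)) [0..<\<iota>] = map (\<lambda>i. bg B i a' a) [0..<\<iota>]"
    using eqs by simp_all
  then show "distinct (map (\<lambda>i. bg B i a a') [0..<\<iota>] @ map (\<lambda>i. bg B i a' a) [0..<\<iota>])"
    using bspec[OF M(3) mem] by (simp only: prod.case)
qed

lemma brick_le_trans:
  assumes 1: "brick_le \<iota> b0 b1" and 2: "brick_le \<iota> b1 b2"
  shows "brick_le \<iota> b0 b2"
proof -
  have off: "offdiag (bw b0) \<subseteq> offdiag (bw b1)"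
    using 1 by (auto simp: brick_le_def offdiag_def)
  have "bh b2 i a a' = bh b0 i a a' \<and> prefix (bg b0 i a a') (bg b2 i a a')"
    if "(a, a') \<in> offdiag (bw b0)" "i < \<iota>" for a a' i
  proof -
    have "bh b1 i a a' = bh b0 i a a' \<and> prefix (bg b0 i a a') (bg b1 i a a')"
      using 1 that unfolding brick_le_def by blast
    moreover have "bh b2 i a a' = bh b1 i a a' \<and> prefix (bg b1 i a a') (bg b2 i a a')"
      using 2 that off unfolding brick_le_def by blast
    ultimately show ?thesis
      using prefix_order.trans[of "bg b0 i a a'" "bg b1 i a a'" "bg b2 i a a'"] by simp
  qed
  moreover have "prefix (b\<eta> b0 a) (b\<eta> b2 a)" if "a \<in> bw b0" for a
  proof (rule prefix_order.trans)
    show "prefix (b\<eta> b0 a) (b\<eta> b1 a)" using 1 that unfolding brick_le_def by blast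
    show "prefix (b\<eta> b1 a) (b\<eta> b2 a)" using 1 2 that unfolding brick_le_def by blast
  qed
  moreover have "bw b0 \<subseteq> bw b2 \<and> bn b0 \<le> bn b2"
    using 1 2 unfolding brick_le_def by (meson order_trans subset_trans)
  ultimately show ?thesis unfolding brick_le_def by blast
qed

lemma brick_le_chain:
  assumes "\<And>n. brick_le \<iota> (b n) (b (Suc n))" "n \<le> m"
  shows "brick_le \<iota> (b n) (b m)"
  using assms(2)
proof (induction rule: dec_induct)
  case base
  show ?case by (auto simp: brick_le_def)
next
  case (step m)
  then show ?case using brick_le_trans assms(1) by blast
qed

lemma brick_le_image:
  assumes "brick_le \<iota> (brick_image f (brick_restrict \<iota> T c B v)) (brick_restrict \<iota> T c B' (f ` v))"
    and "inj_on f v" "a \<in> v"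
  shows "prefix (b\<eta> B a) (b\<eta> B' (f a))"
    and "a' \<in> v \<Longrightarrow> a \<noteq> a' \<Longrightarrow> i < \<iota> \<Longrightarrow>
      bh B' i (f a) (f a') = bh B i a a' \<and> prefix (bg B i a a') (bg B' i (f a) (f a'))"
proof -
  have inv: "inv_into v f (f a) = a" if "a \<in> v" for a using assms(2) that by simp
  show "prefix (b\<eta> B a) (b\<eta> B' (f a))"
    using assms(1,3) inv unfolding brick_le_def brick_image_def brick_restrict_def Let_def by simp
  assume a': "a' \<in> v" "a \<noteq> a'" "i < \<iota>"
  have "(f a, f a') \<in> offdiag (f ` v)"
    using assms(2,3) a' by (auto simp: offdiag_def inj_on_def)
  from bspec[OF assms(1)[unfolded brick_le_def brick_image_def brick_restrict_def Let_def,
      THEN conjunct2, THEN conjunct2, THEN conjunct2, simplified] this]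
  show "bh B' i (f a) (f a') = bh B i a a' \<and> prefix (bg B i a a') (bg B' i (f a) (f a'))"
    using inv[OF assms(3)] inv[OF a'(1)] a'(3) by simp
qed

section \<open>Aligned pairs in uncountable families\<close>

lemma uncountable_ex: "uncountable A \<Longrightarrow> \<exists>x. x \<in> A"
  by (metis countable_empty equals0I)

lemma uncountable_fibre:
  assumes "uncountable A" "countable (f ` A)"
  obtains y where "uncountable {x \<in> A. f x = y}"
proof -
  have "A = (\<Union>y \<in> f ` A. {x \<in> A. f x = y})" by auto
  then have "\<not> (\<forall>y \<in> f ` A. countable {x \<in> A. f x = y})"
    using assms(1) countable_UN[OF assms(2), of "\<lambda>y. {x \<in> A. f x = y}"] by auto
  then show ?thesis using that by blast
qed

text \<open>
  A weak form of the Delta-system lemma.  If some coordinate has the same value at uncountably many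
  members of the family, the induction hypothesis for the remaining coordinates applies to these
  members.  Otherwise each of the finitely many values of a fixed member occurs at countably many
  members only, and all others have range disjoint from it.
\<close>

lemma aligned_pair:
  assumes "finite v" "uncountable I" "\<And>p. p \<in> I \<Longrightarrow> inj_on (g p) v"
  shows "\<exists>p \<in> I. \<exists>q \<in> I. p \<noteq> q \<and> (\<forall>i \<in> v. \<forall>j \<in> v. g p i = g q j \<longrightarrow> i = j)"
  using assms
proof (induction "card v" arbitrary: v I)
  case 0
  then obtain p where "p \<in> I" using uncountable_ex by blast
  moreover have "uncountable (I - {p})" using 0(3) by (simp add: uncountable_minus_countable)
  from uncountable_ex[OF this] obtain q where "q \<in> I - {p}" by (rule exE)
  ultimately show ?case using 0(1,2) by auto
next
  case (Suc n)
  show ?case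
  proof (cases "\<exists>i \<in> v. \<exists>a. uncountable {p \<in> I. g p i = a}")
    case True
    then obtain k a where k: "k \<in> v" and unc: "uncountable {p \<in> I. g p k = a}" by blast
    have "n = card (v - {k})" "finite (v - {k})" using Suc.hyps(2) Suc.prems(1) k by simp_all
    moreover have "inj_on (g p) (v - {k})" if "p \<in> {p \<in> I. g p k = a}" for p
      using Suc.prems(3) that by (auto intro: inj_on_subset)
    ultimately obtain p q where pq: "p \<in> I" "g p k = a" "q \<in> I" "g q k = a" "p \<noteq> q"
      and al: "\<And>i j. i \<in> v - {k} \<Longrightarrow> j \<in> v - {k} \<Longrightarrow> g p i = g q j \<Longrightarrow> i = j"
      using Suc.hyps(1)[OF _ _ unc] by blast
    have "i = j" if "i \<in> v" "j \<in> v" "g p i = g q j" for i j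
    proof (cases "i = k \<or> j = k")
      case True
      then show ?thesis
        using that pq(2,4) k inj_onD[OF Suc.prems(3)[OF pq(1)], of i k]
          inj_onD[OF Suc.prems(3)[OF pq(3)], of k j] by auto
    next
      case False
      then show ?thesis using al[of i j] that by blast
    qed
    then show ?thesis using pq by blast
  next
    case False
    obtain p where p: "p \<in> I" using uncountable_ex[OF Suc.prems(2)] by blast
    let ?bad = "(\<Union>i \<in> v. \<Union>j \<in> v. {q \<in> I. g q j = g p i}) \<union> {p}"
    have "countable ?bad"
      using False Suc.prems(1) by (intro countable_Un countable_UN) (auto simp: countable_finite)
    then have "uncountable (I - ?bad)" using Suc.prems(2) by (simp add: uncountable_minus_countable)
    from uncountable_ex[OF this] obtain q where q: "q \<in> I - ?bad" by (rule exE)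
    then have qI: "q \<in> I" "q \<noteq> p" and nb: "q \<notin> (\<Union>i \<in> v. \<Union>j \<in> v. {q \<in> I. g q j = g p i})"
      by simp_all
    have "g p i \<noteq> g q j" if "i \<in> v" "j \<in> v" for i j
    proof
      assume "g p i = g q j"
      then have "q \<in> {q \<in> I. g q j = g p i}" using qI(1) by simp
      then show False using nb that by blast
    qed
    then show ?thesis using p qI(1) qI(2)[symmetric] by blast
  qed
qed

text \<open>
  With \<open>w = insert d0 V\<close> the element \<open>d0\<close> has position \<open>k(w)\<close>, and so does \<open>d1\<close>; exchanging them
  leaves \<open>j\<close> unchanged.  The last axiom of YZR-systems then says that adding \<open>d1\<close> to \<open>w\<close> decreases
  \<open>r\<close>, which is impossible at \<open>r = 0\<close>.  The assumption \<open>d1 < d0\<close> is there because the position of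
  \<open>d1\<close> in the axiom is counted in \<open>w\<close>, not in \<open>V\<close>.
\<close>

lemma no_twins_aux:
  assumes s: "yzr_system \<epsilon> s" and V: "finite V" "insert d0 (insert d1 V) \<subseteq> yX s" "d0 \<notin> V" "d1 \<notin> V"
    and lt: "d1 < d0" and r: "yr s (insert d0 V) = ozero"
    and k: "yk s (insert d0 V) = card (below V d0)" "card (below V d0) = card (below V d1)"
    and j: "yj s (insert d0 V) = yj s (insert d1 V)"
  shows False
proof -
  let ?w = "insert d0 V"
  have w: "?w \<in> fin_ne (yX s)" and b: "d1 \<in> yX s - ?w"
    using V lt by (auto simp: fin_ne_def)
  have "below ?w d1 = below V d1" "below ?w d0 = below V d0" using lt by (auto simp: below_def)
  then have pos: "card (below ?w d1) = yk s ?w" "card (below ?w d0) = yk s ?w" using k by simp_all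
  have "sorted_list_of_set ?w ! yk s ?w = d0"
    using nth_card_below[of ?w d0] V(1) pos(2) by simp
  then have "?w - {sorted_list_of_set ?w ! yk s ?w} \<union> {d1} = insert d1 V"
    using V(3) by auto
  then have "yr s (?w \<union> {d1}) \<noteq> yr s ?w"
    using j by (intro yzr_systemD(6)[OF s w b pos(1)]) simp
  moreover have "yr s (?w \<union> {d1}) \<le> yr s ?w"
    by (rule yzr_systemD(3)[OF s]) (use V in \<open>auto simp: fin_ne_def\<close>)
  ultimately show False using r ozero_le[of "yr s (?w \<union> {d1})"] by simp
qed

lemma no_twins:
  assumes s: "yzr_system \<epsilon> s" and V: "finite V" "insert d0 (insert d1 V) \<subseteq> yX s" "d0 \<notin> V" "d1 \<notin> V"
    and ne: "d0 \<noteq> d1" and r: "yr s (insert d0 V) = ozero" "yr s (insert d1 V) = ozero"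
    and k: "yk s (insert d0 V) = card (below V d0)" "yk s (insert d1 V) = card (below V d1)"
      "card (below V d0) = card (below V d1)"
    and j: "yj s (insert d0 V) = yj s (insert d1 V)"
  shows False
proof (cases "d1 < d0")
  case True
  show False by (rule no_twins_aux[OF s V True r(1) k(1,3) j])
next
  case False
  then have lt: "d0 < d1" using ne by simp
  show False
    by (rule no_twins_aux[OF s V(1) _ V(4,3) lt r(2) k(2) k(3)[symmetric] j[symmetric]]) (use V(2) in auto)
qed

section \<open>The forcing notion\<close>

record 'x condition =
  cdom :: "'x set"
  cstage :: nat
  cemb :: "'x \<Rightarrow> nat"

text \<open>
  The data of controlled amalgamation, together with an infinite YZR-system \<open>s\<close> that indexes the points
  to be added.
\<close>

locale amalgamation =
  fixes S :: "(nat, 'o::{wellorder,no_top}) yzr" and \<iota> :: nat and T :: "nat \<Rightarrow> bit list set"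
    and c :: "nat \<Rightarrow> nat" and b :: "nat \<Rightarrow> brick" and \<epsilon> :: 'o and s :: "('x::wellorder, 'o) yzr"
  assumes brick: "\<And>n. is_brick S \<iota> T c (b n)"
    and chain: "\<And>n. brick_le \<iota> (b n) (b (Suc n))"
    and height: "filterlim (\<lambda>n. bn (b n)) at_top sequentially"
    and amalgamate: "\<And>n u w \<pi>0 \<pi>1. u \<subseteq> w \<Longrightarrow> w \<subseteq> bw (b n) \<Longrightarrow> 3 \<le> card w \<Longrightarrow>
        (\<And>v \<delta>. v \<subseteq> u \<Longrightarrow> \<delta> \<in> w - u \<Longrightarrow> yr S (v \<union> {\<delta>}) = ozero \<Longrightarrow>
           yk S (v \<union> {\<delta>}) \<noteq> card (below v \<delta>)) \<Longrightarrow>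
        quasi_emb_into S w \<pi>0 \<Longrightarrow> quasi_emb_into S w \<pi>1 \<Longrightarrow>
        (\<And>a. a \<in> u \<Longrightarrow> \<pi>0 a = \<pi>1 a) \<Longrightarrow> \<pi>0 ` (w - u) \<inter> \<pi>1 ` (w - u) = {} \<Longrightarrow>
        \<exists>K \<pi>. quasi_emb_into S (\<pi>0 ` w \<union> \<pi>1 ` w) \<pi> \<and> \<pi> ` (\<pi>0 ` w \<union> \<pi>1 ` w) \<subseteq> bw (b K) \<and>
           brick_le \<iota> (brick_image (\<pi> \<circ> \<pi>0) (brick_restrict \<iota> T c (b n) w))
             (brick_restrict \<iota> T c (b K) ((\<pi> \<circ> \<pi>0) ` w)) \<and>
           brick_le \<iota> (brick_image (\<pi> \<circ> \<pi>1) (brick_restrict \<iota> T c (b n) w))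
             (brick_restrict \<iota> T c (b K) ((\<pi> \<circ> \<pi>1) ` w))"
    and extend: "\<And>n u w \<pi>0. w \<subseteq> bw (b n) \<Longrightarrow> 3 \<le> card w \<Longrightarrow> quasi_emb_into S w \<pi>0 \<Longrightarrow>
        \<pi>0 ` w \<subseteq> u \<Longrightarrow> finite u \<Longrightarrow>
        \<exists>K \<pi>. quasi_emb_into S u \<pi> \<and> \<pi> ` u \<subseteq> bw (b K) \<and>
           brick_le \<iota> (brick_image (\<pi> \<circ> \<pi>0) (brick_restrict \<iota> T c (b n) w))
             (brick_restrict \<iota> T c (b K) ((\<pi> \<circ> \<pi>0) ` w))"
    and cute: "cute \<epsilon> S"
    and sys: "yzr_system \<epsilon> s"
    and inf: "infinite (yX s)"
begin

text \<open>
  The empty domain is admitted in order to have a weakest condition, whereas the amalgamation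
  clauses concern sets with at least three elements.  The embedding vanishes outside the domain, so
  that a condition is given by finitely many data.
\<close>

definition conds :: "'x condition set" where
  "conds = {p. finite (cdom p) \<and> cdom p \<subseteq> yX s \<and> (cdom p = {} \<or> 3 \<le> card (cdom p)) \<and>
     cemb p ` cdom p \<subseteq> bw (b (cstage p)) \<and>
     quasi_embedding (yzr_restrict s (cdom p)) S (cemb p) \<and> (\<forall>a. a \<notin> cdom p \<longrightarrow> cemb p a = 0)}"

definition base_of :: "'x condition \<Rightarrow> 'x \<Rightarrow> bit list" where
  "base_of p a = b\<eta> (b (cstage p)) (cemb p a)"

definition h_of :: "'x condition \<Rightarrow> nat \<Rightarrow> 'x \<Rightarrow> 'x \<Rightarrow> nat" where
  "h_of p i a a' = bh (b (cstage p)) i (cemb p a) (cemb p a')"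

definition g_of :: "'x condition \<Rightarrow> nat \<Rightarrow> 'x \<Rightarrow> 'x \<Rightarrow> bit list" where
  "g_of p i a a' = bg (b (cstage p)) i (cemb p a) (cemb p a')"

definition stronger :: "'x condition \<Rightarrow> 'x condition \<Rightarrow> bool" where
  "stronger q p \<longleftrightarrow> cdom p \<subseteq> cdom q \<and> (\<forall>a \<in> cdom p. prefix (base_of p a) (base_of q a)) \<and>
     (\<forall>a \<in> cdom p. \<forall>a' \<in> cdom p. a \<noteq> a' \<longrightarrow> (\<forall>i<\<iota>.
        h_of q i a a' = h_of p i a a' \<and> prefix (g_of p i a a') (g_of q i a a')))"

lemma stronger_refl: "stronger p p"
  by (simp add: stronger_def)

lemma stronger_trans:
  assumes "stronger p q" "stronger q r"
  shows "stronger p r"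
proof -
  have sub: "cdom r \<subseteq> cdom q" "cdom q \<subseteq> cdom p" using assms by (simp_all add: stronger_def)
  have "prefix (base_of r a) (base_of p a)" if "a \<in> cdom r" for a
  proof (rule prefix_order.trans)
    show "prefix (base_of r a) (base_of q a)" using assms that unfolding stronger_def by blast
    show "prefix (base_of q a) (base_of p a)" using assms that sub unfolding stronger_def by blast
  qed
  moreover have "h_of p i a a' = h_of r i a a' \<and> prefix (g_of r i a a') (g_of p i a a')"
    if "a \<in> cdom r" "a' \<in> cdom r" "a \<noteq> a'" "i < \<iota>" for i a a'
  proof -
    have "h_of q i a a' = h_of r i a a' \<and> prefix (g_of r i a a') (g_of q i a a')"
      using assms(2) that unfolding stronger_def by blast
    moreover have "h_of p i a a' = h_of q i a a' \<and> prefix (g_of q i a a') (g_of p i a a')"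
      using assms(1) that sub unfolding stronger_def by blast
    ultimately show ?thesis
      using prefix_order.trans[of "g_of r i a a'" "g_of q i a a'" "g_of p i a a'"] by simp
  qed
  ultimately show ?thesis using sub unfolding stronger_def by blast
qed

lemma stronger_empty: "cdom p = {} \<Longrightarrow> stronger q p"
  by (simp add: stronger_def)

definition empty_cond :: "'x condition" where
  "empty_cond = \<lparr>cdom = {}, cstage = 0, cemb = (\<lambda>_. 0)\<rparr>"

lemma empty_cond: "empty_cond \<in> conds" "stronger p empty_cond"
  by (auto simp: conds_def empty_cond_def stronger_empty quasi_embedding_def fin_ne_def)

lemma condsD:
  assumes "p \<in> conds"
  shows "finite (cdom p)" "cdom p \<subseteq> yX s" "cdom p \<noteq> {} \<Longrightarrow> 3 \<le> card (cdom p)"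
    "cemb p ` cdom p \<subseteq> bw (b (cstage p))" "quasi_embedding (yzr_restrict s (cdom p)) S (cemb p)"
    "inj_on (cemb p) (cdom p)"
proof -
  show "quasi_embedding (yzr_restrict s (cdom p)) S (cemb p)" using assms by (simp add: conds_def)
  from quasi_embeddingD(2)[OF this] show "inj_on (cemb p) (cdom p)" by simp
qed (use assms in \<open>auto simp: conds_def\<close>)

subsection \<open>Density\<close>

definition vert :: "'x condition \<Rightarrow> nat set" where "vert p = cemb p ` cdom p"

text \<open>
  The way back from vertices to points.  The clauses \<open>amalgamate\<close> and \<open>extend\<close> move sets of
  vertices, so that a quasi-embedding \<open>\<psi>\<close> of points has to be composed with this map first.
\<close>

definition pull :: "'x condition \<Rightarrow> nat \<Rightarrow> 'x" where "pull p = inv_into (cdom p) (cemb p)"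

lemma pull:
  assumes "p \<in> conds"
  shows "a \<in> cdom p \<Longrightarrow> pull p (cemb p a) = a" "pull p ` vert p = cdom p"
    "quasi_embedding (yzr_restrict S (vert p)) (yzr_restrict s (cdom p)) (pull p)"
    "inj_on (pull p) (vert p)" "finite (vert p)" "card (vert p) = card (cdom p)"
    "vert p \<subseteq> bw (b (cstage p))"
proof -
  note p = condsD[OF assms]
  show "pull p (cemb p a) = a" if "a \<in> cdom p" for a
    using p(6) that by (simp add: pull_def)
  then show "pull p ` vert p = cdom p" by (simp add: vert_def image_image)
  show qe: "quasi_embedding (yzr_restrict S (vert p)) (yzr_restrict s (cdom p)) (pull p)"
    using quasi_embedding_inverse[OF p(5)] by (simp add: vert_def pull_def)
  show "inj_on (pull p) (vert p)" using quasi_embeddingD(2)[OF qe] by simp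
  show "finite (vert p)" "card (vert p) = card (cdom p)"
    using p(1,6) by (simp_all add: vert_def card_image)
  show "vert p \<subseteq> bw (b (cstage p))" using p(4) by (simp add: vert_def)
qed

lemma S_univ: "yX S = UNIV"
  using cute by (simp add: cute_def)

lemma restrict_restrict: "yzr_restrict (yzr_restrict t w) v = yzr_restrict t v"
  by (simp add: yzr_restrict_def)

definition mk :: "'x set \<Rightarrow> nat \<Rightarrow> ('x \<Rightarrow> nat) \<Rightarrow> 'x condition" where
  "mk W K f = \<lparr>cdom = W, cstage = K, cemb = (\<lambda>a. if a \<in> W then f a else 0)\<rparr>"

lemma mk_conds:
  assumes W: "finite W" "W \<subseteq> yX s" "3 \<le> card W" and \<psi>: "quasi_embedding (yzr_restrict s W) S \<psi>"
    and \<pi>: "quasi_embedding (yzr_restrict S u) S \<pi>" "\<psi> ` W \<subseteq> u" "\<pi> ` u \<subseteq> bw (b K)"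
  shows "mk W K (\<pi> \<circ> \<psi>) \<in> conds"
proof -
  have "quasi_embedding (yzr_restrict s W) (yzr_restrict S u) \<psi>"
    using quasi_embedding_restrict_ran[OF \<psi>] \<pi>(2) by simp
  from quasi_embedding_comp[OF this \<pi>(1)]
  have "quasi_embedding (yzr_restrict s W) S (\<lambda>a. if a \<in> W then (\<pi> \<circ> \<psi>) a else 0)"
    by (rule quasi_embedding_cong) simp
  then show ?thesis
    using W \<pi>(2,3) by (auto simp: conds_def mk_def)
qed

text \<open>
  The amalgamation clauses compare bricks along a map \<open>f\<close> of vertices; \<open>h\<close> is the same map seen from
  the points.
\<close>

lemma mk_stronger:
  assumes p: "p \<in> conds" and W: "cdom p \<subseteq> W"
    and le: "brick_le \<iota> (brick_image f (brick_restrict \<iota> T c (b (cstage p)) (vert p)))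
      (brick_restrict \<iota> T c (b K) (f ` vert p))"
    and f: "inj_on f (vert p)" "\<And>a. a \<in> cdom p \<Longrightarrow> f (cemb p a) = h a"
  shows "stronger (mk W K h) p"
proof -
  have v: "cemb p a \<in> vert p" if "a \<in> cdom p" for a using that by (simp add: vert_def)
  have ne: "cemb p a \<noteq> cemb p a'" if "a \<in> cdom p" "a' \<in> cdom p" "a \<noteq> a'" for a a'
    using condsD(6)[OF p] that by (auto simp: inj_on_def)
  have "prefix (base_of p a) (base_of (mk W K h) a)" if "a \<in> cdom p" for a
    using brick_le_image(1)[OF le f(1) v[OF that]] f(2)[OF that] that W
    by (auto simp: base_of_def mk_def)
  moreover have "h_of (mk W K h) i a a' = h_of p i a a' \<and> prefix (g_of p i a a') (g_of (mk W K h) i a a')"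
    if "a \<in> cdom p" "a' \<in> cdom p" "a \<noteq> a'" "i < \<iota>" for a a' i
    using brick_le_image(2)[OF le f(1) v[OF that(1)] v[OF that(2)] ne[OF that(1-3)] that(4)]
      f(2)[OF that(1)] f(2)[OF that(2)] that W
    by (auto simp: h_of_def g_of_def mk_def)
  ultimately show ?thesis
    using W unfolding stronger_def by (simp add: mk_def)
qed

lemma section_into_S:
  assumes p: "p \<in> conds" and W: "cdom p \<subseteq> W" and \<psi>: "quasi_embedding (yzr_restrict s W) S \<psi>"
  shows "quasi_emb_into S (vert p) (\<psi> \<circ> pull p)" "(\<psi> \<circ> pull p) ` vert p = \<psi> ` cdom p"
    "inj_on (\<psi> \<circ> pull p) (vert p)"
proof -
  have "quasi_embedding (yzr_restrict s (cdom p)) S \<psi>"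
    using quasi_embedding_restrict_dom[OF \<psi>, of "cdom p"] W by (simp add: restrict_restrict)
  note comp = quasi_embedding_comp[OF pull(3)[OF p] this]
  show "quasi_emb_into S (vert p) (\<psi> \<circ> pull p)"
    using comp by (simp add: quasi_emb_into_def S_univ)
  show "(\<psi> \<circ> pull p) ` vert p = \<psi> ` cdom p"
    by (simp only: image_comp[symmetric] pull(2)[OF p])
  show "inj_on (\<psi> \<circ> pull p) (vert p)"
    using quasi_embeddingD(2)[OF comp] by simp
qed

lemma extend_cond:
  assumes p: "p \<in> conds" "cdom p \<noteq> {}" and W: "finite W" "cdom p \<subseteq> W" "W \<subseteq> yX s"
  shows "\<exists>q \<in> conds. stronger q p \<and> cdom q = W"
proof -
  have Wf: "W \<in> fin_ne (yX s)" using W p(2) by (auto simp: fin_ne_def)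
  obtain \<psi> where \<psi>: "quasi_embedding (yzr_restrict s W) S \<psi>"
    using cute_embeds_finite[OF cute sys Wf] by blast
  note sec = section_into_S[OF p(1) W(2) \<psi>]
  have card: "3 \<le> card (vert p)" using condsD(3)[OF p] pull(6)[OF p(1)] by simp
  obtain K \<pi> where \<pi>: "quasi_emb_into S (\<psi> ` W) \<pi>" "\<pi> ` (\<psi> ` W) \<subseteq> bw (b K)"
    and le: "brick_le \<iota> (brick_image (\<pi> \<circ> (\<psi> \<circ> pull p)) (brick_restrict \<iota> T c (b (cstage p)) (vert p)))
             (brick_restrict \<iota> T c (b K) ((\<pi> \<circ> (\<psi> \<circ> pull p)) ` vert p))"
    using extend[OF pull(7)[OF p(1)] card sec(1), of "\<psi> ` W"] W sec(2) by blast
  have \<pi>q: "quasi_embedding (yzr_restrict S (\<psi> ` W)) S \<pi>" using \<pi>(1) by (simp add: quasi_emb_into_def)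
  have "mk W K (\<pi> \<circ> \<psi>) \<in> conds"
    using mk_conds[OF W(1,3) _ \<psi> \<pi>q _ \<pi>(2)] condsD(3)[OF p] card_mono[OF W(1,2)] by simp
  moreover have "stronger (mk W K (\<pi> \<circ> \<psi>)) p"
  proof (rule mk_stronger[OF p(1) W(2) le])
    show "inj_on (\<pi> \<circ> (\<psi> \<circ> pull p)) (vert p)"
      using inj_on_subset[OF quasi_embeddingD(2)[OF \<pi>q], of "\<psi> ` cdom p"] W(2)
      by (intro comp_inj_on[OF sec(3)]) (simp only: sec(2) yzr_restrict_sel image_mono)
  qed (simp add: pull(1)[OF p(1)])
  ultimately show ?thesis by (intro bexI[of _ "mk W K (\<pi> \<circ> \<psi>)"]) (auto simp: mk_def)
qed

text \<open>
  A brick that contains a copy of \<open>W\<close> comes from \<open>extend\<close>, applied to the identity on the vertices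
  of the first brick and to a finite set that contains these vertices as well as a copy of \<open>W\<close>.
\<close>

lemma exists_cond:
  assumes W: "finite W" "W \<subseteq> yX s" "3 \<le> card W"
  shows "\<exists>q \<in> conds. cdom q = W"
proof -
  have Wf: "W \<in> fin_ne (yX s)" using W by (auto simp: fin_ne_def)
  obtain \<psi> where \<psi>: "quasi_embedding (yzr_restrict s W) S \<psi>"
    using cute_embeds_finite[OF cute sys Wf] by blast
  have v: "3 \<le> card (bw (b 0))" "finite (bw (b 0))" using brick[of 0] by (simp_all add: is_brick_def)
  let ?u = "\<psi> ` W \<union> bw (b 0)"
  have id: "quasi_emb_into S (bw (b 0)) (\<lambda>a. a)"
    by (simp add: quasi_emb_into_def quasi_embedding_id S_univ)
  obtain K \<pi> where \<pi>: "quasi_emb_into S ?u \<pi>" "\<pi> ` ?u \<subseteq> bw (b K)"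
    using extend[OF subset_refl v(1) id, of ?u] v(2) W(1) by auto
  then have "mk W K (\<pi> \<circ> \<psi>) \<in> conds"
    using mk_conds[OF W \<psi>, of ?u \<pi> K] by (simp add: quasi_emb_into_def)
  then show ?thesis by (intro bexI[of _ "mk W K (\<pi> \<circ> \<psi>)"]) (auto simp: mk_def)
qed

lemma dense_dom:
  assumes p: "p \<in> conds" and A: "finite A" "A \<subseteq> yX s"
  shows "\<exists>q \<in> conds. stronger q p \<and> A \<subseteq> cdom q"
proof (cases "cdom p = {}")
  case True
  obtain B where B: "finite B" "card B = 3" "B \<subseteq> yX s"
    using infinite_arbitrarily_large[OF inf] by blast
  have "3 \<le> card (A \<union> B)" using card_mono[of "A \<union> B" B] A B by simp
  then obtain q where "q \<in> conds" "cdom q = A \<union> B"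
    using exists_cond[of "A \<union> B"] A B by auto
  then show ?thesis using stronger_empty[OF True] by blast
next
  case False
  then obtain q where "q \<in> conds" "stronger q p" "cdom q = cdom p \<union> A"
    using extend_cond[OF p False, of "cdom p \<union> A"] A condsD(1,2)[OF p] by auto
  then show ?thesis by blast
qed

lemma dense_height:
  assumes p: "p \<in> conds"
  shows "\<exists>q \<in> conds. stronger q p \<and> cdom q = cdom p \<and> N \<le> bn (b (cstage q))"
proof -
  have "\<forall>\<^sub>F n in sequentially. N \<le> bn (b n)"
    using height by (simp add: filterlim_at_top)
  then obtain m where m: "\<And>n. m \<le> n \<Longrightarrow> N \<le> bn (b n)"
    by (auto simp: eventually_sequentially)
  define k where "k = max m (cstage p)"
  have le: "brick_le \<iota> (b (cstage p)) (b k)"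
    using brick_le_chain[of \<iota> b, OF chain] by (simp add: k_def)
  define q where "q = p\<lparr>cstage := k\<rparr>"
  have v: "cemb p a \<in> bw (b (cstage p))" if "a \<in> cdom p" for a using condsD(4)[OF p] that by auto
  have "bw (b (cstage p)) \<subseteq> bw (b k)" using le by (simp add: brick_le_def)
  then have "q \<in> conds" using p by (auto simp: conds_def q_def)
  moreover have "stronger q p"
    unfolding stronger_def
  proof (intro conjI ballI impI allI)
    fix a assume a: "a \<in> cdom p"
    then show "prefix (base_of p a) (base_of q a)"
      using le v by (simp add: base_of_def q_def brick_le_def)
    fix a' i assume a': "a' \<in> cdom p" "a \<noteq> a'" "i < \<iota>"
    then have "(cemb p a, cemb p a') \<in> offdiag (bw (b (cstage p)))"
      using v a condsD(6)[OF p] by (auto simp: offdiag_def inj_on_def)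
    then have "bh (b k) i (cemb p a) (cemb p a') = bh (b (cstage p)) i (cemb p a) (cemb p a') \<and>
        prefix (bg (b (cstage p)) i (cemb p a) (cemb p a')) (bg (b k) i (cemb p a) (cemb p a'))"
      using le a'(3) unfolding brick_le_def by blast
    then show "h_of q i a a' = h_of p i a a'" "prefix (g_of p i a a') (g_of q i a a')"
      by (simp_all add: h_of_def g_of_def q_def)
  qed (simp add: q_def)
  moreover have "N \<le> bn (b (cstage q))" by (simp add: q_def m k_def)
  ultimately show ?thesis by (intro bexI[of _ q]) (auto simp: q_def)
qed

subsection \<open>Chain condition\<close>

text \<open>
  What two conditions must have in common in order to be amalgamated.  The values of \<open>j\<close> have to be
  included because the embedding of a condition does not preserve \<open>j\<close> on sets with \<open>r = 0\<close>, which are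
  the sets of interest.  Sets of vertices are represented by sorted lists to get finite subsets of
  a countable type.
\<close>

definition ctype :: "'x condition \<Rightarrow> nat \<times> nat set \<times> (nat list \<times> nat) set" where
  "ctype p = (cstage p, vert p, (\<lambda>z. (sorted_list_of_set z, yj s (pull p ` z))) ` Pow (vert p))"

lemma countable_ctype: "countable (ctype ` conds)"
proof (rule countable_subset)
  show "ctype ` conds \<subseteq> UNIV \<times> Collect finite \<times> Collect finite"
    using pull(5) by (auto simp: ctype_def)
  show "countable ((UNIV :: nat set) \<times> (Collect finite :: nat set set) \<times>
      (Collect finite :: (nat list \<times> nat) set set))"
    by (intro countable_SIGMA countable_Collect_finite) simp
qed

lemma ctype_eqD:
  assumes "ctype p = ctype q" "q \<in> conds"
  shows "cstage p = cstage q" "vert p = vert q"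
    "z \<subseteq> vert q \<Longrightarrow> yj s (pull p ` z) = yj s (pull q ` z)"
proof -
  show *: "cstage p = cstage q" "vert p = vert q" using assms(1) by (simp_all add: ctype_def)
  assume z: "z \<subseteq> vert q"
  have fin: "finite y" if "y \<subseteq> vert q" for y
    using pull(5)[OF assms(2)] that finite_subset by blast
  have "(\<lambda>z. (sorted_list_of_set z, yj s (pull p ` z))) ` Pow (vert q) =
      (\<lambda>z. (sorted_list_of_set z, yj s (pull q ` z))) ` Pow (vert q)"
    using assms(1) * by (simp add: ctype_def)
  then have "(sorted_list_of_set z, yj s (pull p ` z)) \<in>
      (\<lambda>z. (sorted_list_of_set z, yj s (pull q ` z))) ` Pow (vert q)"
    using z by blast
  then obtain y where y: "y \<subseteq> vert q" "sorted_list_of_set z = sorted_list_of_set y"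
    "yj s (pull p ` z) = yj s (pull q ` y)" by auto
  have "z = y" using arg_cong[OF y(2), of set] fin[OF z] fin[OF y(1)] by simp
  then show "yj s (pull p ` z) = yj s (pull q ` z)" using y(3) by simp
qed

text \<open>
  The points of both conditions are quasi-embedded into \<open>S\<close> together, by \<open>\<psi>\<close>.  The clause \<open>amalgamate\<close> applies to
  the two maps \<open>\<psi> \<circ> pull p\<close> and \<open>\<psi> \<circ> pull q\<close> of the common set \<open>v\<close> of vertices, which agree exactly on
  the vertices of common points.
\<close>

lemma amalgamate_aligned:
  assumes p: "p \<in> conds" and q: "q \<in> conds" and type: "ctype p = ctype q"
    and aligned: "\<And>i j. i \<in> vert q \<Longrightarrow> j \<in> vert q \<Longrightarrow> pull p i = pull q j \<Longrightarrow> i = j"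
  shows "\<exists>r \<in> conds. stronger r p \<and> stronger r q"
proof (cases "cdom p = {}")
  case True
  then show ?thesis using stronger_empty stronger_refl q by blast
next
  case False
  define v where "v = vert q"
  have v: "vert p = v" "vert q = v" "cstage p = cstage q" using ctype_eqD[OF type q] by (simp_all add: v_def)
  have finv: "finite v" using pull(5)[OF q] v by simp
  define W where "W = cdom p \<union> cdom q"
  have W: "finite W" "W \<subseteq> yX s" "cdom p \<subseteq> W" "cdom q \<subseteq> W"
    using condsD(1,2)[OF p] condsD(1,2)[OF q] by (auto simp: W_def)
  have Wf: "W \<in> fin_ne (yX s)" using W False by (auto simp: fin_ne_def)
  have W3: "3 \<le> card W" using condsD(3)[OF p False] card_mono[OF W(1,3)] by simp
  obtain \<psi> where \<psi>: "quasi_embedding (yzr_restrict s W) S \<psi>"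
    using cute_embeds_finite[OF cute sys Wf] by blast
  note injW = quasi_embeddingD(2)[OF \<psi>, simplified]
  note secp = section_into_S[OF p W(3) \<psi>, unfolded v] and secq = section_into_S[OF q W(4) \<psi>, unfolded v]
  have backp: "pull p i \<in> cdom p" and backq: "pull q i \<in> cdom q" if "i \<in> v" for i
    using pull(2)[OF p] pull(2)[OF q] that v by auto
  define u where "u = {i \<in> v. pull p i = pull q i}"
  have card: "3 \<le> card v" using condsD(3)[OF p False] pull(6)[OF p] v by simp
  have vb: "v \<subseteq> bw (b (cstage q))" using pull(7)[OF q] v by simp
  note qep = quasi_embeddingD[OF pull(3)[OF p], unfolded v, simplified]
    and qeq = quasi_embeddingD[OF pull(3)[OF q], unfolded v, simplified]
  \<comment> \<open>The premise of \<open>amalgamate\<close> on sets of rank 0: a violation would make the two points over the vertex \<open>\<delta>\<close> twins over the points of \<open>z\<close>.\<close>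
  have free: "yk S (z \<union> {\<delta>}) \<noteq> card (below z \<delta>)"
    if z: "z \<subseteq> u" and \<delta>: "\<delta> \<in> v - u" and r: "yr S (z \<union> {\<delta>}) = ozero" for z \<delta>
  proof
    assume k: "yk S (z \<union> {\<delta>}) = card (below z \<delta>)"
    have zv: "z \<subseteq> v" "z \<union> {\<delta>} \<in> fin_ne v" "\<delta> \<in> v"
      using z \<delta> finv finite_subset[of z v] by (auto simp: u_def fin_ne_def)
    define V where "V = pull p ` z"
    have Vq: "V = pull q ` z" unfolding V_def using z by (intro image_cong) (auto simp: u_def)
    have imp: "pull p ` (z \<union> {\<delta>}) = insert (pull p \<delta>) V" by (simp add: V_def)
    have imq: "pull q ` (z \<union> {\<delta>}) = insert (pull q \<delta>) V" by (simp add: Vq)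
    show False
    proof (rule no_twins[OF sys, of V "pull p \<delta>" "pull q \<delta>"])
      show "finite V" using zv finite_subset[OF zv(1) finv] by (simp add: V_def)
      show "insert (pull p \<delta>) (insert (pull q \<delta>) V) \<subseteq> yX s"
        using backp backq zv condsD(2)[OF p] condsD(2)[OF q] by (auto simp: V_def)
      show "pull p \<delta> \<notin> V"
        using inj_on_image_mem_iff[OF qep(2) zv(3,1)] z \<delta> by (auto simp: V_def)
      show "pull q \<delta> \<notin> V"
        using inj_on_image_mem_iff[OF qeq(2) zv(3,1)] z \<delta> by (auto simp: Vq)
      show "pull p \<delta> \<noteq> pull q \<delta>" using \<delta> by (auto simp: u_def)
      show "yr s (insert (pull p \<delta>) V) = ozero" "yr s (insert (pull q \<delta>) V) = ozero"
        using qep(4)[OF zv(2)] qeq(4)[OF zv(2)] r unfolding imp imq by simp_all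
      have cp: "card (below V (pull p \<delta>)) = card (below z \<delta>)"
        using card_below_image[OF qep(1) zv(1,3)] by (simp add: V_def)
      have cq: "card (below V (pull q \<delta>)) = card (below z \<delta>)"
        using card_below_image[OF qeq(1) zv(1,3)] by (simp add: Vq)
      show "yk s (insert (pull p \<delta>) V) = card (below V (pull p \<delta>))"
        "yk s (insert (pull q \<delta>) V) = card (below V (pull q \<delta>))"
        using qep(5)[OF zv(2)] qeq(5)[OF zv(2)] k cp cq unfolding imp imq by simp_all
      show "card (below V (pull p \<delta>)) = card (below V (pull q \<delta>))" using cp cq by simp
      show "yj s (insert (pull p \<delta>) V) = yj s (insert (pull q \<delta>) V)"
        using ctype_eqD(3)[OF type q, of "z \<union> {\<delta>}"] zv v unfolding imp imq by simp
    qed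
  qed
  have agree: "(\<psi> \<circ> pull p) a = (\<psi> \<circ> pull q) a" if "a \<in> u" for a
    using that by (simp add: u_def)
  have disj: "(\<psi> \<circ> pull p) ` (v - u) \<inter> (\<psi> \<circ> pull q) ` (v - u) = {}"
  proof (rule ccontr)
    assume "(\<psi> \<circ> pull p) ` (v - u) \<inter> (\<psi> \<circ> pull q) ` (v - u) \<noteq> {}"
    then obtain i j where ij: "i \<in> v - u" "j \<in> v - u" "\<psi> (pull p i) = \<psi> (pull q j)" by auto
    then have "pull p i = pull q j"
      using inj_onD[OF injW] backp backq W(3,4) by blast
    then show False using aligned[of i j] ij v by (auto simp: u_def)
  qed
  have uv: "u \<subseteq> v" by (auto simp: u_def)
  obtain K \<pi> where \<pi>: "quasi_emb_into S ((\<psi> \<circ> pull p) ` v \<union> (\<psi> \<circ> pull q) ` v) \<pi>"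
      "\<pi> ` ((\<psi> \<circ> pull p) ` v \<union> (\<psi> \<circ> pull q) ` v) \<subseteq> bw (b K)"
    and lep: "brick_le \<iota> (brick_image (\<pi> \<circ> (\<psi> \<circ> pull p)) (brick_restrict \<iota> T c (b (cstage q)) v))
             (brick_restrict \<iota> T c (b K) ((\<pi> \<circ> (\<psi> \<circ> pull p)) ` v))"
    and leq: "brick_le \<iota> (brick_image (\<pi> \<circ> (\<psi> \<circ> pull q)) (brick_restrict \<iota> T c (b (cstage q)) v))
             (brick_restrict \<iota> T c (b K) ((\<pi> \<circ> (\<psi> \<circ> pull q)) ` v))"
    using amalgamate[OF uv vb card free secp(1) secq(1) agree disj] by blast
  have ran: "(\<psi> \<circ> pull p) ` v \<union> (\<psi> \<circ> pull q) ` v = \<psi> ` W"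
    using secp(2) secq(2) by (simp add: W_def image_Un)
  have \<pi>q: "quasi_embedding (yzr_restrict S (\<psi> ` W)) S \<pi>"
    using \<pi>(1) unfolding quasi_emb_into_def ran by (rule conjunct2)
  have conds: "mk W K (\<pi> \<circ> \<psi>) \<in> conds"
    by (rule mk_conds[OF W(1,2) W3 \<psi> \<pi>q subset_refl \<pi>(2)[unfolded ran]])
  have inj: "inj_on (\<pi> \<circ> (\<psi> \<circ> pull p)) v" "inj_on (\<pi> \<circ> (\<psi> \<circ> pull q)) v"
    using inj_on_subset[OF quasi_embeddingD(2)[OF \<pi>q], of "\<psi> ` cdom p"] W(3)
      inj_on_subset[OF quasi_embeddingD(2)[OF \<pi>q], of "\<psi> ` cdom q"] W(4)
    by (intro comp_inj_on[OF secp(3)] comp_inj_on[OF secq(3)];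
        simp only: secp(2) secq(2) yzr_restrict_sel image_mono)+
  have "stronger (mk W K (\<pi> \<circ> \<psi>)) p"
    by (rule mk_stronger[OF p W(3), of "\<pi> \<circ> (\<psi> \<circ> pull p)", unfolded v, OF lep inj(1)])
      (simp add: pull(1)[OF p])
  moreover have "stronger (mk W K (\<pi> \<circ> \<psi>)) q"
    by (rule mk_stronger[OF q W(4), of "\<pi> \<circ> (\<psi> \<circ> pull q)", unfolded v, OF leq inj(2)])
      (simp add: pull(1)[OF q])
  ultimately show ?thesis using conds by blast
qed

lemma uncountable_compatible:
  assumes "A \<subseteq> conds" "uncountable A"
  shows "\<exists>p \<in> A. \<exists>q \<in> A. p \<noteq> q \<and> (\<exists>r \<in> conds. stronger r p \<and> stronger r q)"
proof -
  have "countable (ctype ` A)"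
    using countable_subset[OF image_mono[OF assms(1)] countable_ctype] .
  then obtain t where t: "uncountable {p \<in> A. ctype p = t}"
    by (rule uncountable_fibre[OF assms(2)])
  let ?I = "{p \<in> A. ctype p = t}"
  obtain q0 where q0: "q0 \<in> ?I" using uncountable_ex[OF t] by blast
  define v where "v = vert q0"
  have vI: "vert p = v" if "p \<in> ?I" for p
    using ctype_eqD(2)[of p q0] that q0 assms(1) by (auto simp: v_def)
  have "inj_on (pull p) v" if "p \<in> ?I" for p
    using pull(4)[of p] vI[OF that] that assms(1) by auto
  moreover have "finite v" using pull(5)[of q0] q0 assms(1) by (auto simp: v_def)
  ultimately obtain p q where pq: "p \<in> ?I" "q \<in> ?I" "p \<noteq> q"
    "\<forall>i \<in> v. \<forall>j \<in> v. pull p i = pull q j \<longrightarrow> i = j"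
    using aligned_pair[OF _ t, of v pull] by blast
  then have "\<exists>r \<in> conds. stronger r p \<and> stronger r q"
    using amalgamate_aligned[of p q] vI[OF pq(2)] assms(1) by auto
  then show ?thesis using pq by blast
qed

end

section \<open>Cardinality and existence of the forcing notion\<close>

lemma countable_ordLeq_infinite:
  assumes "countable A" "infinite B"
  shows "|A| \<le>o |B|"
proof -
  have "|A| \<le>o |UNIV :: nat set|"
    using assms(1) card_of_ordLeq[of A "UNIV :: nat set"] by (auto simp: countable_def)
  then show ?thesis
    using ordLeq_transitive iffD1[OF infinite_iff_card_of_nat assms(2)] by blast
qed

lemma Times_ordLeq_infinite:
  assumes "infinite A" "|B| \<le>o |A|" "|C| \<le>o |A|"
  shows "|B \<times> C| \<le>o |A|"
  using card_of_Times_ordLeq_infinite_Field[OF _ assms(2,3) card_of_Card_order] assms(1)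
  by (simp add: Field_card_of)

lemma card_of_lists_infinite:
  assumes A: "infinite A"
  shows "|lists A| \<le>o |A|"
proof -
  have n: "|{xs \<in> lists A. length xs = n}| \<le>o |A|" for n
  proof (induction n)
    case 0
    have "{xs \<in> lists A. length xs = 0} = {[]}" by auto
    then show ?case by (simp only:) (rule countable_ordLeq_infinite[OF _ A], simp)
  next
    case (Suc n)
    let ?L = "{xs \<in> lists A. length xs = n}"
    have "{xs \<in> lists A. length xs = Suc n} = (\<lambda>(x, xs). x # xs) ` (A \<times> ?L)"
      by (auto simp: length_Suc_conv image_iff)
    moreover have "|A \<times> ?L| \<le>o |A|"
      by (rule Times_ordLeq_infinite[OF A card_of_mono1[OF subset_refl] Suc])
    ultimately show ?case using ordLeq_transitive[OF card_of_image] by simp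
  qed
  have "lists A = (\<Union>n \<in> (UNIV :: nat set). {xs \<in> lists A. length xs = n})" by auto
  also have "|\<dots>| \<le>o |A|"
    by (intro card_of_UNION_ordLeq_infinite[OF A countable_ordLeq_infinite[OF _ A]] ballI n) simp
  finally show ?thesis .
qed

lemma card_of_Diff_countable:
  assumes "uncountable B" "A \<subseteq> B" "countable (B - A)"
  shows "|A| =o |B|"
proof -
  have A: "infinite A"
    using assms by (metis Diff_partition countable_Un countable_finite)
  have "|A \<union> (B - A)| \<le>o |A <+> (B - A)|" by (rule card_of_Un_Plus_ordLeq)
  also have "|A <+> (B - A)| =o |A|"
    by (rule card_of_Plus_infinite1[OF A countable_ordLeq_infinite[OF assms(3) A]])
  finally have "|B| \<le>o |A|" using assms(2) by (simp add: Un_absorb1)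
  then show ?thesis
    using card_of_mono1[OF assms(2)] by (simp add: ordIso_iff_ordLeq)
qed

context amalgamation
begin

text \<open>
  A condition is coded by a finite list of pairs of points and vertices and a number.  Conversely
  the domains, which are finite, cover the carrier.
\<close>

lemma card_conds: "|conds| =o |yX s|"
proof -
  define F :: "('x \<times> nat) list \<times> nat \<Rightarrow> 'x condition" where
    "F = (\<lambda>(zs, n). \<lparr>cdom = fst ` set zs, cstage = n,
      cemb = (\<lambda>a. case map_of zs a of None \<Rightarrow> 0 | Some v \<Rightarrow> v)\<rparr>)"
  let ?P = "yX s \<times> (UNIV :: nat set)"
  have P: "infinite ?P" using inf by (auto simp: finite_cartesian_product_iff)
  have "conds \<subseteq> F ` (lists ?P \<times> UNIV)"
  proof
    fix p assume p: "p \<in> conds"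
    obtain xs where xs: "set xs = cdom p" using finite_list[OF condsD(1)[OF p]] by blast
    let ?zs = "map (\<lambda>a. (a, cemb p a)) xs"
    have emb: "cemb p a = (case map_of ?zs a of None \<Rightarrow> 0 | Some v \<Rightarrow> v)" for a
      using p xs by (auto simp: map_of_map_restrict restrict_map_def conds_def)
    have dom: "cdom p = fst ` set ?zs" using xs by (simp add: image_image)
    have "p = F (?zs, cstage p)"
      unfolding F_def prod.case
    proof (rule condition.equality, unfold condition.simps)
      show "cdom p = fst ` set ?zs" by (rule dom)
      show "cemb p = (\<lambda>a. case map_of ?zs a of None \<Rightarrow> 0 | Some v \<Rightarrow> v)"
        using emb by (rule ext)
    qed simp_all
    moreover have "?zs \<in> lists ?P" using xs condsD(2)[OF p] by auto
    ultimately show "p \<in> F ` (lists ?P \<times> UNIV)" by blast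
  qed
  from ordLeq_transitive[OF card_of_mono1[OF this] card_of_image]
  have le1: "|conds| \<le>o |lists ?P \<times> (UNIV :: nat set)|" .
  have nat: "|UNIV :: nat set| \<le>o |yX s|" by (rule iffD1[OF infinite_iff_card_of_nat inf])
  have PX: "|?P| \<le>o |yX s|"
    by (rule Times_ordLeq_infinite[OF inf card_of_mono1[OF subset_refl] nat])
  have lists: "|lists ?P| \<le>o |yX s|"
    by (rule ordLeq_transitive[OF card_of_lists_infinite[OF P] PX])
  have le2: "|lists ?P \<times> (UNIV :: nat set)| \<le>o |yX s|"
    by (rule Times_ordLeq_infinite[OF inf lists nat])
  have upper: "|conds| \<le>o |yX s|" by (rule ordLeq_transitive[OF le1 le2])
  have cover: "yX s \<subseteq> (\<Union>p \<in> conds. cdom p)"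
  proof
    fix a assume "a \<in> yX s"
    then obtain q where "q \<in> conds" "{a} \<subseteq> cdom q"
      using dense_dom[OF empty_cond(1), of "{a}"] by auto
    then show "a \<in> (\<Union>p \<in> conds. cdom p)" by auto
  qed
  have "infinite conds"
    using finite_subset[OF cover] inf condsD(1) by auto
  then have le3: "|\<Union>p \<in> conds. cdom p| \<le>o |conds|"
    by (intro card_of_UNION_ordLeq_infinite ballI card_of_mono1 subset_refl)
      (simp_all add: countable_ordLeq_infinite countable_finite condsD(1))
  show ?thesis
    using upper ordLeq_transitive[OF card_of_mono1[OF cover] le3] by (simp add: ordIso_iff_ordLeq)
qed

lemma cond_pairs:
  assumes p: "p \<in> conds" and a: "a \<in> cdom p" "a' \<in> cdom p" "a \<noteq> a'"
  shows "base_of p a \<noteq> base_of p a'"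
    and "i < \<iota> \<Longrightarrow> length (g_of p i a a') = bn (b (cstage p))"
    and "i < \<iota> \<Longrightarrow> g_of p i a a' \<in> T (h_of p i a a')"
    and "i < \<iota> \<Longrightarrow> ladd (base_of p a) (g_of p i a a') = ladd (base_of p a') (g_of p i a' a)"
    and "distinct (map (\<lambda>i. g_of p i a a') [0..<\<iota>] @ map (\<lambda>i. g_of p i a' a) [0..<\<iota>])"
proof -
  have "cemb p a \<in> bw (b (cstage p))" "cemb p a' \<in> bw (b (cstage p))" "cemb p a \<noteq> cemb p a'"
    using condsD(4,6)[OF p] a by (auto simp: inj_on_def)
  note 1 = brick_pairs[OF brick this]
  show "base_of p a \<noteq> base_of p a'" using 1(1) by (simp add: base_of_def)
  show "length (g_of p i a a') = bn (b (cstage p))" "g_of p i a a' \<in> T (h_of p i a a')"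
    "ladd (base_of p a) (g_of p i a a') = ladd (base_of p a') (g_of p i a' a)" if "i < \<iota>"
    using 1(2-4)[OF that] by (simp_all add: base_of_def g_of_def h_of_def)
  show "distinct (map (\<lambda>i. g_of p i a a') [0..<\<iota>] @ map (\<lambda>i. g_of p i a' a) [0..<\<iota>])"
    using 1(5) by (simp only: g_of_def)
qed

lemma length_base_of: "p \<in> conds \<Longrightarrow> a \<in> cdom p \<Longrightarrow> length (base_of p a) = bn (b (cstage p))"
  using condsD(4)[of p] brick[of "cstage p"] by (auto simp: base_of_def is_brick_def)

text \<open>
  The conditions are coded by the elements of \<open>\<Lambda>\<close>, through the bijection \<open>d\<close>; another bijection \<open>f\<close>
  indexes the points of \<open>s\<close> by \<open>\<Lambda>\<close>.
\<close>

lemma forcing_exists: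
  assumes \<Lambda>: "|\<Lambda> :: 'l set| =o |yX s|" and tree: "\<And>m. is_tree (T m)"
  shows "\<exists>Q :: 'l forcing. cond Q = \<Lambda> \<and> forcing_notion Q \<and> ccc Q \<and>
    forced Q (f_overlapping_sequence \<Lambda> T (2 * \<iota>))"
proof -
  obtain f where f: "bij_betw f \<Lambda> (yX s)"
    using \<Lambda> card_of_ordIso by blast
  obtain d where d: "bij_betw d \<Lambda> conds"
    using ordIso_transitive[OF \<Lambda> ordIso_symmetric[OF card_conds]] card_of_ordIso by blast
  have fX: "f \<alpha> \<in> yX s" if "\<alpha> \<in> \<Lambda>" for \<alpha> using bij_betwE[OF f] that by blast
  have fI: "f \<alpha> \<noteq> f \<beta>" if "\<alpha> \<in> \<Lambda>" "\<beta> \<in> \<Lambda>" "\<alpha> \<noteq> \<beta>" for \<alpha> \<beta>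
    using f that by (auto simp: bij_betw_def inj_on_def)
  have dC: "d x \<in> conds" if "x \<in> \<Lambda>" for x using bij_betwE[OF d] that by blast
  have dS: "\<exists>x \<in> \<Lambda>. d x = q" if "q \<in> conds" for q
    using d that unfolding bij_betw_def by (metis imageE)
  define Q :: "'l forcing" where "Q = \<lparr>cond = \<Lambda>, le = (\<lambda>x y. stronger (d x) (d y))\<rparr>"
  have Q_sel: "cond Q = \<Lambda>" "le Q x y = stronger (d x) (d y)" for x y by (simp_all add: Q_def)
  have notion: "forcing_notion Q"
    unfolding forcing_notion_def Q_sel
  proof (intro conjI ballI impI)
    show "stronger (d x) (d x)" for x by (rule stronger_refl)
    show "stronger (d x) (d z)" if "stronger (d x) (d y) \<and> stronger (d y) (d z)" for x y z
      using that stronger_trans by blast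
    show "\<exists>t \<in> \<Lambda>. \<forall>p \<in> \<Lambda>. stronger (d p) (d t)"
      using dS[OF empty_cond(1)] empty_cond(2) by metis
  qed
  have chain: "ccc Q"
    unfolding ccc_def compat_def Q_sel
  proof (intro allI impI)
    fix A assume A: "A \<subseteq> \<Lambda>"
      and anti: "\<forall>p\<in>A. \<forall>q\<in>A. p \<noteq> q \<longrightarrow> \<not> (\<exists>r\<in>\<Lambda>. stronger (d r) (d p) \<and> stronger (d r) (d q))"
    show "countable A"
    proof (rule ccontr)
      assume "uncountable A"
      moreover have inj: "inj_on d A" using d A by (auto simp: bij_betw_def intro: inj_on_subset)
      ultimately have "uncountable (d ` A)" using countable_image_inj_on by blast
      moreover have "d ` A \<subseteq> conds" using dC A by auto
      ultimately obtain p q r where pq: "p \<in> A" "q \<in> A" "d p \<noteq> d q"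
        and r: "r \<in> conds" "stronger r (d p)" "stronger r (d q)"
        using uncountable_compatible[of "d ` A"] by blast
      then obtain x where "x \<in> \<Lambda>" "d x = r" using dS by blast
      moreover have "p \<noteq> q" using pq(3) by auto
      ultimately show False using anti pq(1,2) r(2,3) by blast
    qed
  qed
  have dense: "\<exists>q \<in> conds. stronger q p \<and> {a, a'} \<subseteq> cdom q \<and> N \<le> bn (b (cstage q))"
    if p: "p \<in> conds" and a: "a \<in> yX s" "a' \<in> yX s" for p a a' N
  proof -
    obtain q where q: "q \<in> conds" "stronger q p" "{a, a'} \<subseteq> cdom q"
      using dense_dom[OF p, of "{a, a'}"] a by auto
    obtain r where "r \<in> conds" "stronger r q" "cdom r = cdom q" "N \<le> bn (b (cstage r))"
      using dense_height[OF q(1)] by blast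
    then show ?thesis using q stronger_trans by blast
  qed
  interpret overlap_forcing Q \<Lambda> T \<iota> "\<lambda>x. {\<alpha> \<in> \<Lambda>. f \<alpha> \<in> cdom (d x)}" "\<lambda>x. bn (b (cstage (d x)))"
    "\<lambda>x \<alpha>. base_of (d x) (f \<alpha>)" "\<lambda>x i \<alpha> \<beta>. h_of (d x) i (f \<alpha>) (f \<beta>)"
    "\<lambda>x i \<alpha> \<beta>. g_of (d x) i (f \<alpha>) (f \<beta>)"
  proof (unfold_locales, unfold Q_sel mem_Collect_eq)
    show "forcing_notion Q" by (rule notion)
    show "is_tree (T m)" for m by (rule tree)
    show "\<exists>\<beta>\<in>\<Lambda>. \<alpha> \<noteq> \<beta>" if "\<alpha> \<in> \<Lambda>" for \<alpha>
    proof -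
      have "infinite \<Lambda>" using bij_betw_finite[OF f] inf by simp
      then have "infinite (\<Lambda> - {\<alpha>})" by simp
      then have "\<Lambda> - {\<alpha>} \<noteq> {}" by (metis finite.emptyI)
      then show ?thesis by auto
    qed
    show "\<exists>q\<in>\<Lambda>. stronger (d q) (d p) \<and> (\<alpha> \<in> \<Lambda> \<and> f \<alpha> \<in> cdom (d q)) \<and>
        (\<beta> \<in> \<Lambda> \<and> f \<beta> \<in> cdom (d q)) \<and> N \<le> bn (b (cstage (d q)))"
      if pab: "p \<in> \<Lambda>" "\<alpha> \<in> \<Lambda>" "\<beta> \<in> \<Lambda>" for p \<alpha> \<beta> N
    proof -
      obtain q where q: "q \<in> conds" "stronger q (d p)" "{f \<alpha>, f \<beta>} \<subseteq> cdom q" "N \<le> bn (b (cstage q))"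
        using dense[OF dC[OF pab(1)] fX[OF pab(2)] fX[OF pab(3)]] by blast
      obtain x where "x \<in> \<Lambda>" "d x = q" using dS[OF q(1)] by blast
      then show ?thesis using q pab by (intro bexI[of _ x]) simp_all
    qed
    show "{\<alpha> \<in> \<Lambda>. f \<alpha> \<in> cdom (d p)} \<subseteq> {\<alpha> \<in> \<Lambda>. f \<alpha> \<in> cdom (d q)}"
      if "stronger (d q) (d p)" for p q
      using that by (auto simp: stronger_def)
    show "prefix (base_of (d p) (f \<alpha>)) (base_of (d q) (f \<alpha>))"
      if "stronger (d q) (d p)" "\<alpha> \<in> \<Lambda> \<and> f \<alpha> \<in> cdom (d p)" for p q \<alpha>
      using that by (simp add: stronger_def)
    show "h_of (d q) i (f \<alpha>) (f \<beta>) = h_of (d p) i (f \<alpha>) (f \<beta>) \<and>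
        prefix (g_of (d p) i (f \<alpha>) (f \<beta>)) (g_of (d q) i (f \<alpha>) (f \<beta>))"
      if "stronger (d q) (d p)" "\<alpha> \<in> \<Lambda> \<and> f \<alpha> \<in> cdom (d p)" "\<beta> \<in> \<Lambda> \<and> f \<beta> \<in> cdom (d p)"
        "\<alpha> \<noteq> \<beta>" "i < \<iota>" for p q \<alpha> \<beta> i
      using that fI[of \<alpha> \<beta>] unfolding stronger_def by blast
    show "length (base_of (d p) (f \<alpha>)) = bn (b (cstage (d p)))"
      if "p \<in> \<Lambda>" "\<alpha> \<in> \<Lambda> \<and> f \<alpha> \<in> cdom (d p)" for p \<alpha>
      using length_base_of[OF dC] that by blast
    fix p \<alpha> \<beta>
    assume p: "p \<in> \<Lambda>" and \<alpha>: "\<alpha> \<in> \<Lambda> \<and> f \<alpha> \<in> cdom (d p)" and \<beta>: "\<beta> \<in> \<Lambda> \<and> f \<beta> \<in> cdom (d p)"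
      and ne: "\<alpha> \<noteq> \<beta>"
    note 1 = cond_pairs[OF dC[OF p] conjunct2[OF \<alpha>] conjunct2[OF \<beta>]
        fI[OF conjunct1[OF \<alpha>] conjunct1[OF \<beta>] ne]]
    show "base_of (d p) (f \<alpha>) \<noteq> base_of (d p) (f \<beta>)" by (rule 1)
    show "distinct (map (\<lambda>i. g_of (d p) i (f \<alpha>) (f \<beta>)) [0..<\<iota>] @
        map (\<lambda>i. g_of (d p) i (f \<beta>) (f \<alpha>)) [0..<\<iota>])" by (rule 1)
    fix i assume "i < \<iota>"
    then show "length (g_of (d p) i (f \<alpha>) (f \<beta>)) = bn (b (cstage (d p)))"
      "g_of (d p) i (f \<alpha>) (f \<beta>) \<in> T (h_of (d p) i (f \<alpha>) (f \<beta>))"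
      "ladd (base_of (d p) (f \<alpha>)) (g_of (d p) i (f \<alpha>) (f \<beta>)) =
        ladd (base_of (d p) (f \<beta>)) (g_of (d p) i (f \<beta>) (f \<alpha>))"
      using 1(2-4) by blast+
  qed
  show ?thesis
    using Q_sel(1) notion chain overlapping_sequence by blast
qed

end

theorem theorem3p10:
  fixes \<iota> :: nat
    and c :: "nat \<Rightarrow> nat"
    and T :: "nat \<Rightarrow> bit list set"
    and \<epsilon> :: "'o::{wellorder,no_top}"
    and S :: "(nat, 'o) yzr"
    and lam :: "'l rel"
  assumes "2 \<le> \<iota>"
    and "\<And>m. is_tree (T m)"
    and "\<And>m. no_maximal_nodes (T m)"
    and "ozero < \<epsilon>" and "countable {..<\<epsilon>}"
    and "cute \<epsilon> S"
    and "controlled_amalgamation c S \<iota> T"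
    and "Card_order lam" and "uncountable (Field lam)"
    and "NPr \<epsilon> (Field lam)"
  shows "\<exists>Q :: 'l forcing. forcing_notion Q \<and> ccc Q \<and> |cond Q| =o lam \<and>
           forced Q (f_overlapping_sequence (Field lam) T (2 * \<iota>))"
proof -
  obtain s :: "('l wo, 'o) yzr" where s: "yzr_system \<epsilon> s" "yX s \<subseteq> Wo ` Field lam"
    "countable (Wo ` Field lam - yX s)"
    by (rule yzr_system_of_NPr[OF assms(10,9)])
  have injWo: "inj_on Wo (Field lam)" by (simp add: inj_on_def)
  have uncW: "uncountable (Wo ` Field lam)"
    using assms(9) countable_image_inj_on[OF _ injWo] by blast
  have "|Wo ` Field lam| =o |yX s|"
    using card_of_Diff_countable[OF uncW s(2,3)] by (rule ordIso_symmetric)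
  moreover have "|Field lam| =o |Wo ` Field lam|"
    using card_of_ordIso injWo by (metis bij_betw_imageI)
  ultimately have card: "|Field lam| =o |yX s|" using ordIso_transitive by blast
  have "infinite (yX s)"
    using card_of_ordIso_finite[OF card] uncountable_infinite[OF assms(9)] by simp
  obtain b where b: "\<forall>n. is_brick S \<iota> T c (b n)" "\<forall>n. brick_le \<iota> (b n) (b (Suc n))"
      "filterlim (\<lambda>n. bn (b n)) at_top sequentially"
    and am: "\<forall>n u w \<pi>0 \<pi>1.
        u \<subseteq> w \<and> w \<subseteq> bw (b n) \<and> 3 \<le> card w \<and>
        (\<forall>v \<delta>. v \<subseteq> u \<and> \<delta> \<in> w - u \<and> yr S (v \<union> {\<delta>}) = ozero \<longrightarrow>
           yk S (v \<union> {\<delta>}) \<noteq> card (below v \<delta>)) \<and>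
        quasi_emb_into S w \<pi>0 \<and> quasi_emb_into S w \<pi>1 \<and>
        (\<forall>a \<in> u. \<pi>0 a = \<pi>1 a) \<and> \<pi>0 ` (w - u) \<inter> \<pi>1 ` (w - u) = {} \<longrightarrow>
        (\<exists>K \<pi>. quasi_emb_into S (\<pi>0 ` w \<union> \<pi>1 ` w) \<pi> \<and>
           \<pi> ` (\<pi>0 ` w \<union> \<pi>1 ` w) \<subseteq> bw (b K) \<and>
           brick_le \<iota> (brick_image (\<pi> \<circ> \<pi>0) (brick_restrict \<iota> T c (b n) w))
             (brick_restrict \<iota> T c (b K) ((\<pi> \<circ> \<pi>0) ` w)) \<and>
           brick_le \<iota> (brick_image (\<pi> \<circ> \<pi>1) (brick_restrict \<iota> T c (b n) w))
             (brick_restrict \<iota> T c (b K) ((\<pi> \<circ> \<pi>1) ` w)))"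
    and ex: "\<forall>n u w \<pi>0.
        w \<subseteq> bw (b n) \<and> 3 \<le> card w \<and> quasi_emb_into S w \<pi>0 \<and> \<pi>0 ` w \<subseteq> u \<and> finite u \<longrightarrow>
        (\<exists>K \<pi>. quasi_emb_into S u \<pi> \<and> \<pi> ` u \<subseteq> bw (b K) \<and>
           brick_le \<iota> (brick_image (\<pi> \<circ> \<pi>0) (brick_restrict \<iota> T c (b n) w))
             (brick_restrict \<iota> T c (b K) ((\<pi> \<circ> \<pi>0) ` w)))"
    using assms(7) unfolding controlled_amalgamation_def by (elim exE conjE) (rule that)
  interpret amalgamation S \<iota> T c b \<epsilon> s
  proof (unfold_locales, goal_cases)
    case (4 n u w \<pi>0 \<pi>1)
    then show ?case
      by (intro am[rule_format, of u w n \<pi>0 \<pi>1]) blast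
  next
    case (5 n u w \<pi>0)
    then show ?case by (intro ex[rule_format, of w n \<pi>0 u]) blast
  qed (use b s assms(6) \<open>infinite (yX s)\<close> in blast)+
  obtain Q :: "'l forcing" where "cond Q = Field lam" "forcing_notion Q" "ccc Q"
    "forced Q (f_overlapping_sequence (Field lam) T (2 * \<iota>))"
    using forcing_exists[OF card assms(2)] by blast
  then show ?thesis
    using card_of_Field_ordIso[OF assms(8)] by auto
qed

end
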